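(* Every hierarchically hyperbolic group is semihyperbolic. In particular, the mapping class group of a surface of finite type is semihyperbolic.
   Context: Semihyperbolicity. A quasigeodesic bicombing on a metric space $(X,\sigma)$ is a map $\gamma:X\times X\times[0,1]\to X$ such that for each distinct pair $a,b\in X$ the map $[0,\sigma(a,b)]\to X$, $t\mapsto\gamma_{a,b}(t/\sigma(a,b))$, is a quasigeodesic from $a$ to $b$ with uniform constants. It is bounded if there is $C\ge0$ with $\sigma(\gamma_{a,b}(t),\gamma_{a',b'}(t))\le C\max(\sigma(a,a'),\sigma(b,b'))+C$ for all $a,b,a',b'\in X$, $t\in[0,1]$. A finitely generated group is semihyperbolic if it has a Cayley graph that admits an equivariant bounded quasigeodesic bicombing. Hierarchically hyperbolic space (HHS). A quasigeodesic metric space $(X,d)$ is an HHS, written $(X,\mathfrak S)$, if there are a constant $E\ge 1$, a set $\mathfrak S$ (of "domains"), and for each $U\in\mathfrak S$ a geodesic $E$-hyperbolic space $\mathcal CU$, with the following. Write $d_U(x,y)=d_{\mathcal CU}(\pi_U(x),\pi_U(y))$ for $x,y\in X$, and similarly for subsets of $X$ or $\mathcal CU$; distances between sets are infima. (1) Projections: for each $U$ there is an $E$-coarsely onto, $(E,E)$-coarsely Lipschitz map $\pi_U:X\to\mathcal CU$. (2) Nesting: $\mathfrak S$ has a partial order $\sqsubseteq$ with a unique maximal element (if $\mathfrak S\ne\emptyset$). If $U\sqsubsetneq V$ there are a nonempty set $\rho^U_V\subset\mathcal CV$ of diameter at most $E$ and a map $\rho^V_U:\mathcal CV\to\mathcal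 CU$. (3) Orthogonality: there is a symmetric, anti-reflexive relation $\bot$ on $\mathfrak S$; if $U\sqsubseteq V$ and $V\bot W$ then $U\bot W$; orthogonal domains are not $\sqsubseteq$-comparable; for each $T\in\mathfrak S$ and $U\sqsubseteq T$ such that some $V\sqsubseteq T$ has $V\bot U$, there is $W\sqsubsetneq T$ such that every $V\sqsubseteq T$ with $V\bot U$ satisfies $V\sqsubseteq W$. (4) Transversality and consistency: $U,V$ are transverse, $U\pitchfork V$, if they are neither orthogonal nor $\sqsubseteq$-comparable; then there are nonempty sets $\rho^U_V\subset\mathcal CV$, $\rho^V_U\subset\mathcal CU$ of diameter at most $E$ with $\min\{d_U(x,\rho^V_U),d_V(x,\rho^U_V)\}\le E$ for all $x\in X$. If $U\sqsubsetneq V$ then $\min\{d_V(x,\rho^U_V),\operatorname{diam}(\{\pi_U(x)\}\cup\rho^V_U(\pi_V(x)))\}\le E$ for all $x\in X$. If $U\sqsubseteq V$, then $d_W(\rho^U_W,\rho^V_W)\le E$ whenever $V\sqsubsetneq W$, or $V\pitchfork W$ and $W\not\perp U$. (5) Finite complexity: the cardinalities of sets of pairwise $\sqsubseteq$-comparable domains are at most $E$. (6) Large links: for $W\in\mathfrak S$ and $x,x'\in X$, put $N=E\,d_W(x,x')+E$. There are $T_1,\dots,T_{\lfloor N\rfloor}\sqsubsetneq W$ such that every $T\sqsubsetneq W$ satisfies $T\sqsubseteq T_i$ for some $i$ or $d_T(x,x')<E$; and $d_W(x,\rho^{T_i}_W)\le N$ for all $i$. (7) Bounded geodesic image: if $U\sqsubsetneq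 V$ and $\gamma\subset\mathcal CV$ is a geodesic with $d_V(\gamma,\rho^U_V)>E$, then $\operatorname{diam}\rho^V_U(\gamma)\le E$. (8) Partial realisation: if $\{U_i\}$ is a set of pairwise orthogonal domains and $p_i\in\mathcal CU_i$, there is $x\in X$ with $d_{U_i}(x,p_i)\le E$ for all $i$ and $d_V(x,\rho^{U_i}_V)\le E$ whenever $U_i\sqsubsetneq V$ or $U_i\pitchfork V$. (9) Uniqueness: for each $\kappa\ge0$ there is $\theta(\kappa)$ such that if $d(x,y)\ge\theta(\kappa)$ then $d_V(x,y)\ge\kappa$ for some $V\in\mathfrak S$. Hierarchically hyperbolic group (HHG). A finitely generated group $G$ is an HHG if its Cayley graph (with respect to a finite generating set) admits an HHS structure $(G,\mathfrak S)$ such that: $G$ acts on $\mathfrak S$, with finitely many orbits, preserving $\sqsubseteq$ and $\bot$; and for each $g\in G$, $U\in\mathfrak S$ there is an isometry $g:\mathcal CU\to\mathcal C(gU)$, compatibly with composition in $G$, such that $g\pi_U(x)=\pi_{gU}(gx)$ for all $x\in G$, and $g\rho^U_V=\rho^{gU}_{gV}$ whenever $U\sqsubsetneq V$ or $U\pitchfork V$. Mapping class groups of finite type surfaces are HHGs (a known result). *)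

theory Defs
  imports "HOL-Analysis.Analysis" "HOL-Algebra.Algebra" "HOL-Homology.Homology"
begin

definition geodesic_segment :: "'c metric \<Rightarrow> 'c \<Rightarrow> 'c \<Rightarrow> 'c set \<Rightarrow> bool" where
  "geodesic_segment M x y A \<longleftrightarrow>
     (\<exists>p L. 0 \<le> L \<and> p \<in> {0..L} \<rightarrow> mspace M \<and> p 0 = x \<and> p L = y \<and> A = p ` {0..L} \<and>
        (\<forall>s\<in>{0..L::real}. \<forall>t\<in>{0..L}. mdist M (p s) (p t) = \<bar>s - t\<bar>))"

definition geodesic_space :: "'c metric \<Rightarrow> bool" where
  "geodesic_space M \<longleftrightarrow> (\<forall>x\<in>mspace M. \<forall>y\<in>mspace M. \<exists>A. geodesic_segment M x y A)"

text \<open>Hyperbolicity is taken in the sense of slim geodesic triangles. By the symmetry of the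
  condition in the vertices it is enough to constrain one of the three sides.\<close>

definition slim_hyperbolic :: "'c metric \<Rightarrow> real \<Rightarrow> bool" where
  "slim_hyperbolic M \<delta> \<longleftrightarrow>
     (\<forall>x y z A B C. geodesic_segment M x y A \<and> geodesic_segment M y z B \<and> geodesic_segment M x z C
        \<longrightarrow> (\<forall>a\<in>A. \<exists>b\<in>B \<union> C. mdist M a b \<le> \<delta>))"

definition quasigeodesic ::
    "'x metric \<Rightarrow> real \<Rightarrow> real \<Rightarrow> real \<Rightarrow> (real \<Rightarrow> 'x) \<Rightarrow> 'x \<Rightarrow> 'x \<Rightarrow> bool" where
  "quasigeodesic M K C L q a b \<longleftrightarrow>
     0 \<le> L \<and> q \<in> {0..L} \<rightarrow> mspace M \<and> q 0 = a \<and> q L = b \<and>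
     (\<forall>s\<in>{0..L}. \<forall>t\<in>{0..L}.
        \<bar>s - t\<bar> / K - C \<le> mdist M (q s) (q t) \<and> mdist M (q s) (q t) \<le> K * \<bar>s - t\<bar> + C)"

definition quasigeodesic_space :: "'x metric \<Rightarrow> bool" where
  "quasigeodesic_space M \<longleftrightarrow>
     (\<exists>K\<ge>1. \<exists>C\<ge>0. \<forall>a\<in>mspace M. \<forall>b\<in>mspace M. \<exists>L q. quasigeodesic M K C L q a b)"

text \<open>The statement ``the diameter of \<open>A\<close> is at most \<open>e\<close>'', avoiding a supremum that need not exist
  in the reals.\<close>

definition diam_le :: "'c metric \<Rightarrow> 'c set \<Rightarrow> real \<Rightarrow> bool" where
  "diam_le M A e \<longleftrightarrow> (\<forall>a\<in>A. \<forall>b\<in>A. mdist M a b \<le> e)"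

text \<open>Only meaningful for nonempty sets.\<close>

definition set_mdist :: "'c metric \<Rightarrow> 'c set \<Rightarrow> 'c set \<Rightarrow> real" where
  "set_mdist M A B = Inf {mdist M a b | a b. a \<in> A \<and> b \<in> B}"

definition finite_generating_set :: "('g, 'm) monoid_scheme \<Rightarrow> 'g set \<Rightarrow> bool" where
  "finite_generating_set G S \<longleftrightarrow> finite S \<and> S \<subseteq> carrier G \<and> generate G S = carrier G"

definition word_length :: "('g, 'm) monoid_scheme \<Rightarrow> 'g set \<Rightarrow> 'g \<Rightarrow> nat" where
  "word_length G S x =
     (LEAST n. \<exists>ws. length ws = n \<and> set ws \<subseteq> S \<union> (\<lambda>s. inv\<^bsub>G\<^esub> s) ` S \<and>
        foldr (\<lambda>s y. s \<otimes>\<^bsub>G\<^esub> y) ws \<one>\<^bsub>G\<^esub> = x)"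

definition word_dist :: "('g, 'm) monoid_scheme \<Rightarrow> 'g set \<Rightarrow> 'g \<Rightarrow> 'g \<Rightarrow> real" where
  "word_dist G S x y =
     (if x \<in> carrier G \<and> y \<in> carrier G
      then real (word_length G S (inv\<^bsub>G\<^esub> x \<otimes>\<^bsub>G\<^esub> y)) else 0)"

text \<open>The Cayley graph is represented by its vertex set with the path metric, i.e. by the group with
  the left-invariant word metric, on which the group acts by left multiplication.\<close>

definition word_metric :: "('g, 'm) monoid_scheme \<Rightarrow> 'g set \<Rightarrow> 'g metric" where
  "word_metric G S = metric (carrier G, word_dist G S)"

context group
begin

lemma foldr_closed:
  assumes "set ws \<subseteq> carrier G"
  shows "foldr (\<lambda>s y. s \<otimes> y) ws \<one> \<in> carrier G"
  using assms by (induction ws) auto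

lemma foldr_append:
  assumes "set u \<subseteq> carrier G" "set v \<subseteq> carrier G"
  shows "foldr (\<lambda>s y. s \<otimes> y) (u @ v) \<one> = foldr (\<lambda>s y. s \<otimes> y) u \<one> \<otimes> foldr (\<lambda>s y. s \<otimes> y) v \<one>"
  using assms(1)
proof (induction u)
  case Nil
  then show ?case using foldr_closed[OF assms(2)] by simp
next
  case (Cons a u)
  then show ?case using foldr_closed[OF assms(2)] foldr_closed[of u] m_assoc by auto
qed

lemma foldr_inv:
  assumes "set u \<subseteq> carrier G"
  shows "foldr (\<lambda>s y. s \<otimes> y) (rev (map (\<lambda>s. inv s) u)) \<one> = inv (foldr (\<lambda>s y. s \<otimes> y) u \<one>)"
  using assms
proof (induction u)
  case Nil
  then show ?case by simp
next
  case (Cons a u)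
  have "set (rev (map (\<lambda>s. inv s) u)) \<subseteq> carrier G" using Cons.prems by auto
  then show ?case
    using Cons foldr_append[of "rev (map (\<lambda>s. inv s) u)" "[inv a]"] foldr_closed[of u]
    by (simp add: inv_mult_group)
qed

lemma word_exists:
  assumes "S \<subseteq> carrier G" "x \<in> generate G S"
  shows "\<exists>ws. set ws \<subseteq> S \<union> (\<lambda>s. inv s) ` S \<and> foldr (\<lambda>s y. s \<otimes> y) ws \<one> = x"
  using assms(2)
proof (induction rule: generate.induct)
  case one
  show ?case by (rule exI[of _ "[]"]) simp
next
  case (incl h)
  then show ?case using assms(1) by (intro exI[of _ "[h]"]) auto
next
  case (inv h)
  then show ?case using assms(1) by (intro exI[of _ "[inv h]"]) auto
next
  case (eng h1 h2)
  then obtain u v where u: "set u \<subseteq> S \<union> (\<lambda>s. inv s) ` S" "foldr (\<lambda>s y. s \<otimes> y) u \<one> = h1"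
    and v: "set v \<subseteq> S \<union> (\<lambda>s. inv s) ` S" "foldr (\<lambda>s y. s \<otimes> y) v \<one> = h2" by blast
  have "S \<union> (\<lambda>s. inv s) ` S \<subseteq> carrier G" using assms(1) by auto
  then have "set u \<subseteq> carrier G" "set v \<subseteq> carrier G" using u(1) v(1) by blast+
  then have "foldr (\<lambda>s y. s \<otimes> y) (u @ v) \<one> = h1 \<otimes> h2" using foldr_append u(2) v(2) by metis
  then show ?case using u(1) v(1) by (intro exI[of _ "u @ v"]) auto
qed

lemma word_length_le:
  assumes "set ws \<subseteq> S \<union> (\<lambda>s. inv s) ` S" "foldr (\<lambda>s y. s \<otimes> y) ws \<one> = x"
  shows "word_length G S x \<le> length ws"
  unfolding word_length_def by (rule Least_le) (use assms in blast)

lemma word_length_word: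
  assumes "finite_generating_set G S" "x \<in> carrier G"
  obtains ws where "length ws = word_length G S x" "set ws \<subseteq> S \<union> (\<lambda>s. inv s) ` S"
    "foldr (\<lambda>s y. s \<otimes> y) ws \<one> = x"
proof -
  have "\<exists>n ws. length ws = n \<and> set ws \<subseteq> S \<union> (\<lambda>s. inv s) ` S \<and> foldr (\<lambda>s y. s \<otimes> y) ws \<one> = x"
    using word_exists[of S x] assms unfolding finite_generating_set_def by blast
  from LeastI_ex[OF this] show thesis unfolding word_length_def[symmetric] using that by blast
qed

lemma word_length_inv_le:
  assumes "finite_generating_set G S" "x \<in> carrier G"
  shows "word_length G S (inv x) \<le> word_length G S x"
proof -
  obtain ws where ws: "length ws = word_length G S x" "set ws \<subseteq> S \<union> (\<lambda>s. inv s) ` S"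
    "foldr (\<lambda>s y. s \<otimes> y) ws \<one> = x" using word_length_word[OF assms] .
  have S: "S \<subseteq> carrier G" using assms(1) by (simp add: finite_generating_set_def)
  have sub: "set ws \<subseteq> carrier G" using ws(2) S by auto
  have "set (rev (map (\<lambda>s. inv s) ws)) \<subseteq> S \<union> (\<lambda>s. inv s) ` S"
    using ws(2) S by (fastforce simp: subset_iff)
  then show ?thesis
    using word_length_le[of "rev (map (\<lambda>s. inv s) ws)"] foldr_inv[OF sub] ws by simp
qed

lemma Metric_space_word_dist:
  assumes "finite_generating_set G S"
  shows "Metric_space (carrier G) (word_dist G S)"
proof
  fix x y z
  have S: "S \<union> (\<lambda>s. inv s) ` S \<subseteq> carrier G"
    using assms by (auto simp: finite_generating_set_def)
  show "0 \<le> word_dist G S x y" by (simp add: word_dist_def)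
  have le: "word_dist G S x y \<le> word_dist G S y x" if "x \<in> carrier G" "y \<in> carrier G" for x y
    using word_length_inv_le[OF assms, of "inv y \<otimes> x"] that
    by (simp add: word_dist_def inv_mult_group)
  show "word_dist G S x y = word_dist G S y x"
  proof (cases "x \<in> carrier G \<and> y \<in> carrier G")
    case True
    then show ?thesis using le[of x y] le[of y x] by simp
  next
    case False
    then show ?thesis by (auto simp: word_dist_def)
  qed
  show "word_dist G S x y = 0 \<longleftrightarrow> x = y" if "x \<in> carrier G" "y \<in> carrier G"
  proof
    assume "word_dist G S x y = 0"
    then have "word_length G S (inv x \<otimes> y) = 0" using that by (simp add: word_dist_def)
    moreover have "inv x \<otimes> y \<in> carrier G" using that by simp
    from word_length_word[OF assms this] obtain ws where
      "length ws = word_length G S (inv x \<otimes> y)" "foldr (\<lambda>s y. s \<otimes> y) ws \<one> = inv x \<otimes> y"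
      by blast
    ultimately have "inv x \<otimes> y = \<one>" by simp
    then show "x = y" using that by (metis inv_closed inv_inv inv_equality)
  next
    assume "x = y"
    then show "word_dist G S x y = 0"
      using that word_length_le[of "[]" S \<one>] by (simp add: word_dist_def)
  qed
  show "word_dist G S x z \<le> word_dist G S x y + word_dist G S y z"
    if xyz: "x \<in> carrier G" "y \<in> carrier G" "z \<in> carrier G"
  proof -
    obtain u where u: "length u = word_length G S (inv x \<otimes> y)" "set u \<subseteq> S \<union> (\<lambda>s. inv s) ` S"
      "foldr (\<lambda>s y. s \<otimes> y) u \<one> = inv x \<otimes> y"
      using word_length_word[OF assms, of "inv x \<otimes> y"] xyz by auto
    obtain v where v: "length v = word_length G S (inv y \<otimes> z)" "set v \<subseteq> S \<union> (\<lambda>s. inv s) ` S"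
      "foldr (\<lambda>s y. s \<otimes> y) v \<one> = inv y \<otimes> z"
      using word_length_word[OF assms, of "inv y \<otimes> z"] xyz by auto
    have "set u \<subseteq> carrier G" "set v \<subseteq> carrier G" using u(2) v(2) S by blast+
    then have "foldr (\<lambda>s y. s \<otimes> y) (u @ v) \<one> = (inv x \<otimes> y) \<otimes> (inv y \<otimes> z)"
      using foldr_append u(3) v(3) by metis
    also have "\<dots> = inv x \<otimes> z"
      using xyz by (metis inv_closed m_assoc m_closed r_inv l_one)
    finally have "word_length G S (inv x \<otimes> z) \<le> length (u @ v)"
      using u(2) v(2) by (intro word_length_le) auto
    then show ?thesis using u(1) v(1) xyz by (simp add: word_dist_def)
  qed
qed

lemma mspace_word_metric: "finite_generating_set G S \<Longrightarrow> mspace (word_metric G S) = carrier G"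
  and mdist_word_metric: "finite_generating_set G S \<Longrightarrow> mdist (word_metric G S) = word_dist G S"
  using Metric_space.mspace_metric[OF Metric_space_word_dist]
    Metric_space.mdist_metric[OF Metric_space_word_dist]
  by (auto simp: word_metric_def)

end

definition quasigeodesic_bicombing :: "'x metric \<Rightarrow> ('x \<Rightarrow> 'x \<Rightarrow> real \<Rightarrow> 'x) \<Rightarrow> bool" where
  "quasigeodesic_bicombing M \<gamma> \<longleftrightarrow>
     (\<forall>a\<in>mspace M. \<forall>b\<in>mspace M. \<gamma> a b \<in> {0..1} \<rightarrow> mspace M) \<and>
     (\<exists>K\<ge>1. \<exists>C\<ge>0. \<forall>a\<in>mspace M. \<forall>b\<in>mspace M. a \<noteq> b \<longrightarrow>
        quasigeodesic M K C (mdist M a b) (\<lambda>t. \<gamma> a b (t / mdist M a b)) a b)"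

definition bounded_bicombing :: "'x metric \<Rightarrow> ('x \<Rightarrow> 'x \<Rightarrow> real \<Rightarrow> 'x) \<Rightarrow> bool" where
  "bounded_bicombing M \<gamma> \<longleftrightarrow>
     (\<exists>C\<ge>0. \<forall>a\<in>mspace M. \<forall>b\<in>mspace M. \<forall>a'\<in>mspace M. \<forall>b'\<in>mspace M. \<forall>t\<in>{0..1}.
        mdist M (\<gamma> a b t) (\<gamma> a' b' t) \<le> C * max (mdist M a a') (mdist M b b') + C)"

definition equivariant_bicombing ::
    "('g, 'm) monoid_scheme \<Rightarrow> ('g \<Rightarrow> 'g \<Rightarrow> real \<Rightarrow> 'g) \<Rightarrow> bool" where
  "equivariant_bicombing G \<gamma> \<longleftrightarrow>
     (\<forall>g\<in>carrier G. \<forall>a\<in>carrier G. \<forall>b\<in>carrier G. \<forall>t\<in>{0..1}.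
        \<gamma> (g \<otimes>\<^bsub>G\<^esub> a) (g \<otimes>\<^bsub>G\<^esub> b) t = g \<otimes>\<^bsub>G\<^esub> \<gamma> a b t)"

definition semihyperbolic_group :: "('g, 'm) monoid_scheme \<Rightarrow> bool" where
  "semihyperbolic_group G \<longleftrightarrow>
     group G \<and>
     (\<exists>S \<gamma>. finite_generating_set G S \<and>
        quasigeodesic_bicombing (word_metric G S) \<gamma> \<and>
        bounded_bicombing (word_metric G S) \<gamma> \<and>
        equivariant_bicombing G \<gamma>)"

text \<open>The domains are \<open>\<SS>\<close>, the hyperbolic space of \<open>U\<close> is \<open>C U\<close>, with projection \<open>proj U\<close>.
  The set written $\rho^U_V \subset C V$ (for \<open>U\<close> properly nested in, or transverse to, \<open>V\<close>) is
  \<open>rho U V\<close>, and the map $\rho^V_U : C V \to C U$ (for \<open>U\<close> properly nested in \<open>V\<close>) is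
  \<open>rhomap V U\<close>.\<close>

locale hhs_data =
  fixes M :: "'x metric"
    and \<SS> :: "'i set"
    and nest :: "'i \<Rightarrow> 'i \<Rightarrow> bool" (infix \<open>\<preceq>\<close> 50)
    and orth :: "'i \<Rightarrow> 'i \<Rightarrow> bool"
    and C :: "'i \<Rightarrow> 'c metric"
    and proj :: "'i \<Rightarrow> 'x \<Rightarrow> 'c"
    and rho :: "'i \<Rightarrow> 'i \<Rightarrow> 'c set"
    and rhomap :: "'i \<Rightarrow> 'i \<Rightarrow> 'c \<Rightarrow> 'c"
    and E :: real
begin

abbreviation properly_nested :: "'i \<Rightarrow> 'i \<Rightarrow> bool" (infix \<open>\<prec>\<close> 50) where
  "U \<prec> V \<equiv> U \<preceq> V \<and> U \<noteq> V"

abbreviation transverse :: "'i \<Rightarrow> 'i \<Rightarrow> bool" where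
  "transverse U V \<equiv> \<not> orth U V \<and> \<not> U \<preceq> V \<and> \<not> V \<preceq> U"

abbreviation dpts :: "'i \<Rightarrow> 'x \<Rightarrow> 'x \<Rightarrow> real" where
  "dpts U x y \<equiv> mdist (C U) (proj U x) (proj U y)"

abbreviation dset :: "'i \<Rightarrow> 'x \<Rightarrow> 'c set \<Rightarrow> real" where
  "dset U x A \<equiv> set_mdist (C U) {proj U x} A"

end

text \<open>In the large links axiom the list $T_1,\dots,T_{\lfloor N\rfloor}$ is read as a set of at most
  $\lfloor N\rfloor$ domains; it has to be empty when \<open>W\<close> is minimal.\<close>

locale hierarchically_hyperbolic_space = hhs_data +
  assumes E_ge_1: "1 \<le> E"
    and quasigeodesic: "quasigeodesic_space M"
    and geodesic: "U \<in> \<SS> \<Longrightarrow> geodesic_space (C U)"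
    and hyperbolic: "U \<in> \<SS> \<Longrightarrow> slim_hyperbolic (C U) E"
    and proj_in: "U \<in> \<SS> \<Longrightarrow> x \<in> mspace M \<Longrightarrow> proj U x \<in> mspace (C U)"
    and coarsely_onto:
      "U \<in> \<SS> \<Longrightarrow> p \<in> mspace (C U) \<Longrightarrow> \<exists>x\<in>mspace M. mdist (C U) p (proj U x) \<le> E"
    and coarsely_Lipschitz:
      "U \<in> \<SS> \<Longrightarrow> x \<in> mspace M \<Longrightarrow> y \<in> mspace M \<Longrightarrow> dpts U x y \<le> E * mdist M x y + E"
    and nest_refl: "reflp_on \<SS> (\<preceq>)"
    and nest_trans: "transp_on \<SS> (\<preceq>)"
    and nest_antisym: "antisymp_on \<SS> (\<preceq>)"
    and nest_maximal: "\<SS> \<noteq> {} \<Longrightarrow> \<exists>!U. U \<in> \<SS> \<and> (\<forall>V\<in>\<SS>. U \<preceq> V \<longrightarrow> V = U)"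
    and rho_nest: "U \<in> \<SS> \<Longrightarrow> V \<in> \<SS> \<Longrightarrow> U \<prec> V \<Longrightarrow>
        rho U V \<noteq> {} \<and> rho U V \<subseteq> mspace (C V) \<and> diam_le (C V) (rho U V) E"
    and rhomap_in: "U \<in> \<SS> \<Longrightarrow> V \<in> \<SS> \<Longrightarrow> U \<prec> V \<Longrightarrow> rhomap V U \<in> mspace (C V) \<rightarrow> mspace (C U)"
    and orth_sym: "symp_on \<SS> orth"
    and orth_irrefl: "irreflp_on \<SS> orth"
    and orth_nest: "U \<in> \<SS> \<Longrightarrow> V \<in> \<SS> \<Longrightarrow> W \<in> \<SS> \<Longrightarrow> U \<preceq> V \<Longrightarrow> orth V W \<Longrightarrow> orth U W"
    and orth_incomparable: "U \<in> \<SS> \<Longrightarrow> V \<in> \<SS> \<Longrightarrow> orth U V \<Longrightarrow> \<not> U \<preceq> V \<and> \<not> V \<preceq> U"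
    and orth_container: "T \<in> \<SS> \<Longrightarrow> U \<in> \<SS> \<Longrightarrow> U \<preceq> T \<Longrightarrow> \<exists>V\<in>\<SS>. V \<preceq> T \<and> orth V U \<Longrightarrow>
        \<exists>W\<in>\<SS>. W \<prec> T \<and> (\<forall>V\<in>\<SS>. V \<preceq> T \<and> orth V U \<longrightarrow> V \<preceq> W)"
    and rho_transverse: "U \<in> \<SS> \<Longrightarrow> V \<in> \<SS> \<Longrightarrow> transverse U V \<Longrightarrow>
        rho U V \<noteq> {} \<and> rho U V \<subseteq> mspace (C V) \<and> diam_le (C V) (rho U V) E"
    and consistency_transverse:
      "U \<in> \<SS> \<Longrightarrow> V \<in> \<SS> \<Longrightarrow> transverse U V \<Longrightarrow> x \<in> mspace M \<Longrightarrow>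
        min (dset U x (rho V U)) (dset V x (rho U V)) \<le> E"
    and consistency_nested:
      "U \<in> \<SS> \<Longrightarrow> V \<in> \<SS> \<Longrightarrow> U \<prec> V \<Longrightarrow> x \<in> mspace M \<Longrightarrow>
        dset V x (rho U V) \<le> E \<or> diam_le (C U) {proj U x, rhomap V U (proj V x)} E"
    and consistency_rho:
      "U \<in> \<SS> \<Longrightarrow> V \<in> \<SS> \<Longrightarrow> W \<in> \<SS> \<Longrightarrow> U \<preceq> V \<Longrightarrow>
        V \<prec> W \<or> (transverse V W \<and> \<not> orth W U) \<Longrightarrow>
        set_mdist (C W) (rho U W) (rho V W) \<le> E"
    and finite_complexity:
      "\<U> \<subseteq> \<SS> \<Longrightarrow> \<forall>U\<in>\<U>. \<forall>V\<in>\<U>. U \<preceq> V \<or> V \<preceq> U \<Longrightarrow> finite \<U> \<and> real (card \<U>) \<le> E"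
    and large_links:
      "W \<in> \<SS> \<Longrightarrow> x \<in> mspace M \<Longrightarrow> x' \<in> mspace M \<Longrightarrow> N = E * dpts W x x' + E \<Longrightarrow>
        \<exists>\<T>. finite \<T> \<and> int (card \<T>) \<le> \<lfloor>N\<rfloor> \<and> (\<forall>T\<in>\<T>. T \<in> \<SS> \<and> T \<prec> W) \<and>
          (\<forall>T\<in>\<SS>. T \<prec> W \<longrightarrow> (\<exists>T'\<in>\<T>. T \<preceq> T') \<or> dpts T x x' < E) \<and>
          (\<forall>T\<in>\<T>. dset W x (rho T W) \<le> N)"
    and bounded_geodesic_image:
      "U \<in> \<SS> \<Longrightarrow> V \<in> \<SS> \<Longrightarrow> U \<prec> V \<Longrightarrow> geodesic_segment (C V) a b A \<Longrightarrow>
        set_mdist (C V) A (rho U V) > E \<Longrightarrow> diam_le (C U) (rhomap V U ` A) E"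
    and partial_realisation:
      "\<U> \<subseteq> \<SS> \<Longrightarrow> \<forall>U\<in>\<U>. \<forall>V\<in>\<U>. U \<noteq> V \<longrightarrow> orth U V \<Longrightarrow> \<forall>U\<in>\<U>. r U \<in> mspace (C U) \<Longrightarrow>
        \<exists>x\<in>mspace M. \<forall>U\<in>\<U>. mdist (C U) (proj U x) (r U) \<le> E \<and>
          (\<forall>V\<in>\<SS>. U \<prec> V \<or> transverse U V \<longrightarrow> dset V x (rho U V) \<le> E)"
    and uniqueness:
      "\<kappa> \<ge> 0 \<Longrightarrow> \<exists>\<theta>. \<forall>x\<in>mspace M. \<forall>y\<in>mspace M. mdist M x y \<ge> \<theta> \<longrightarrow> (\<exists>V\<in>\<SS>. dpts V x y \<ge> \<kappa>)"

locale hhg_structure =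
  group G + hierarchically_hyperbolic_space "word_metric G S" \<SS> nest orth C proj rho rhomap E
    + group_action G \<SS> act
  for G :: "('g, 'm) monoid_scheme" (structure)
    and S :: "'g set"
    and \<SS> :: "'i set"
    and nest :: "'i \<Rightarrow> 'i \<Rightarrow> bool" (infix \<open>\<preceq>\<close> 50)
    and orth :: "'i \<Rightarrow> 'i \<Rightarrow> bool"
    and C :: "'i \<Rightarrow> 'c metric"
    and proj :: "'i \<Rightarrow> 'g \<Rightarrow> 'c"
    and rho :: "'i \<Rightarrow> 'i \<Rightarrow> 'c set"
    and rhomap :: "'i \<Rightarrow> 'i \<Rightarrow> 'c \<Rightarrow> 'c"
    and E :: real
    and act :: "'g \<Rightarrow> 'i \<Rightarrow> 'i"
    and isom :: "'g \<Rightarrow> 'i \<Rightarrow> 'c \<Rightarrow> 'c" +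
  assumes generating: "finite_generating_set G S"
    and finite_orbits: "finite (orbits G \<SS> act)"
    and act_nest: "g \<in> carrier G \<Longrightarrow> U \<in> \<SS> \<Longrightarrow> V \<in> \<SS> \<Longrightarrow> act g U \<preceq> act g V \<longleftrightarrow> U \<preceq> V"
    and act_orth: "g \<in> carrier G \<Longrightarrow> U \<in> \<SS> \<Longrightarrow> V \<in> \<SS> \<Longrightarrow> orth (act g U) (act g V) \<longleftrightarrow> orth U V"
    and isom_bij: "g \<in> carrier G \<Longrightarrow> U \<in> \<SS> \<Longrightarrow>
        bij_betw (isom g U) (mspace (C U)) (mspace (C (act g U)))"
    and isom_dist: "g \<in> carrier G \<Longrightarrow> U \<in> \<SS> \<Longrightarrow> p \<in> mspace (C U) \<Longrightarrow> q \<in> mspace (C U) \<Longrightarrow>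
        mdist (C (act g U)) (isom g U p) (isom g U q) = mdist (C U) p q"
    and isom_mult: "g \<in> carrier G \<Longrightarrow> h \<in> carrier G \<Longrightarrow> U \<in> \<SS> \<Longrightarrow> p \<in> mspace (C U) \<Longrightarrow>
        isom (g \<otimes> h) U p = isom g (act h U) (isom h U p)"
    and isom_proj: "g \<in> carrier G \<Longrightarrow> U \<in> \<SS> \<Longrightarrow> x \<in> carrier G \<Longrightarrow>
        isom g U (proj U x) = proj (act g U) (g \<otimes> x)"
    and isom_rho: "g \<in> carrier G \<Longrightarrow> U \<in> \<SS> \<Longrightarrow> V \<in> \<SS> \<Longrightarrow> U \<prec> V \<or> transverse U V \<Longrightarrow>
        isom g V ` rho U V = rho (act g U) (act g V)"

text \<open>HOL cannot quantify existentially over types, so the type \<open>'i\<close> of domains and the type \<open>'c\<close>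
  containing the points of the hyperbolic spaces are parameters of the predicate. A theorem with this
  predicate as hypothesis and \<open>'i\<close>, \<open>'c\<close> arbitrary covers all hierarchically hyperbolic groups.\<close>

definition hierarchically_hyperbolic_group ::
    "'i itself \<Rightarrow> 'c itself \<Rightarrow> ('g, 'm) monoid_scheme \<Rightarrow> bool" where
  "hierarchically_hyperbolic_group (I :: 'i itself) (J :: 'c itself) G \<longleftrightarrow>
     (\<exists>S (\<SS> :: 'i set) nest orth (C :: 'i \<Rightarrow> 'c metric) proj rho rhomap E act isom.
        hhg_structure G S \<SS> nest orth C proj rho rhomap E act isom)"

definition topological_surface :: "'a topology \<Rightarrow> bool" where
  "topological_surface S \<longleftrightarrow>
     topspace S \<noteq> {} \<and> connected_space S \<and> Hausdorff_space S \<and> second_countable S \<and>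
     (\<forall>x\<in>topspace S. \<exists>U. openin S U \<and> x \<in> U \<and>
        subtopology S U homeomorphic_space (euclidean :: (real ^ 2) topology))"

text \<open>An orientation is a choice of a generator of each local homology group
  $H_2(S, S \setminus \{x\}) \cong \mathbb Z$ which is locally induced from a single class.\<close>

definition orientation :: "'a topology \<Rightarrow> ('a \<Rightarrow> 'a chain set) \<Rightarrow> bool" where
  "orientation S \<mu> \<longleftrightarrow>
     (\<forall>x\<in>topspace S.
        \<mu> x \<in> carrier (relative_homology_group 2 S (topspace S - {x})) \<and>
        generate (relative_homology_group 2 S (topspace S - {x})) {\<mu> x} =
          carrier (relative_homology_group 2 S (topspace S - {x}))) \<and>
     (\<forall>x\<in>topspace S. \<exists>B. openin S B \<and> x \<in> B \<and>
        (\<exists>\<alpha> \<in> carrier (relative_homology_group 2 S (topspace S - B)).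
           \<forall>y\<in>B. hom_induced 2 S (topspace S - B) S (topspace S - {y}) id \<alpha> = \<mu> y))"

definition orientable :: "'a topology \<Rightarrow> bool" where
  "orientable S \<longleftrightarrow> (\<exists>\<mu>. orientation S \<mu>)"

definition orientation_preserving :: "'a topology \<Rightarrow> ('a \<Rightarrow> 'a) \<Rightarrow> bool" where
  "orientation_preserving S f \<longleftrightarrow>
     (\<forall>\<mu>. orientation S \<mu> \<longrightarrow> (\<forall>x\<in>topspace S.
        hom_induced 2 S (topspace S - {x}) S (topspace S - {f x}) f (\<mu> x) = \<mu> (f x)))"

text \<open>A surface of finite type is a connected orientable surface obtained from a closed surface by
  deleting finitely many points (the punctures). There is no loss in taking the closed surface on the
  same type, as it has the same cardinality as \<open>S\<close>.\<close>

definition finite_type_surface :: "'a topology \<Rightarrow> bool" where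
  "finite_type_surface S \<longleftrightarrow> orientable S \<and>
     (\<exists>(M :: 'a topology) P. topological_surface M \<and> compact_space M \<and>
        finite P \<and> P \<subseteq> topspace M \<and>
        S homeomorphic_space subtopology M (topspace M - P))"

definition homeo_plus_group :: "'a topology \<Rightarrow> ('a \<Rightarrow> 'a) monoid" where
  "homeo_plus_group S = BijGroup (topspace S)
     \<lparr>carrier := {f \<in> extensional (topspace S). homeomorphic_map S S f \<and> orientation_preserving S f}\<rparr>"

text \<open>Homotopy through homeomorphisms is isotopy.\<close>

definition isotopic_to_id :: "'a topology \<Rightarrow> ('a \<Rightarrow> 'a) set" where
  "isotopic_to_id S = {f \<in> carrier (homeo_plus_group S).
     homotopic_with (homeomorphic_map S S) S S \<one>\<^bsub>homeo_plus_group S\<^esub> f}"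

definition mapping_class_group :: "'a topology \<Rightarrow> ('a \<Rightarrow> 'a) set monoid" where
  "mapping_class_group S = homeo_plus_group S Mod isotopic_to_id S"

end

(*
The idea is to turn a hierarchically hyperbolic structure into a system of walls that has a coarse
Helly property with constants independent of the number of walls. A wall is the pull-back to G of a
pair of opposite sides {d(.,p) - d(.,q) <= s} and {d(.,p) - d(.,q) >= s + g} in one of the hyperbolic
spaces; such sides are uniformly quasiconvex.

Helly: given pairwise intersecting sets, fix a base point a and take in each hyperbolic space the gate
of a in the hull of a member of the family that is almost farthest from a. This point lies in the hull
of every member, and by maximality the resulting tuple is consistent, so it is realised in G.
Realisation is obtained by improving a family of pairwise orthogonal domains at which the tuple
concentrates: large links yield the next domain, and finite complexity bounds the number of steps.

The maximal length of a chain of nested walls separating two points is then a left-invariant metric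
up to an additive constant. By Helly it is coarsely injective, and since walls exist wherever some
projection distance is large (uniqueness), it is quasi-isometric to the word metric. Retracting
(1-t) D(a,.) + t D(b,.) to the injective hull and going back to G by coarse Helly yields a conical
bicombing. As G acts freely on itself, it suffices to choose the paths issuing from 1.
*)
theory Submission
  imports Defs
begin

section \<open>Gromov products\<close>

text \<open>In a single hyperbolic space the Helly property of quasiconvex sets is classical. The
  difficulty is that different domains may select different members of the family, so nothing forces
  the gates to fit together. What links two domains is a pair of genuine points of the group: the
  base point \<open>a\<close> and a common point of the two selected members, which exists by
  pairwise intersection. Comparing the gates with these points leaves few configurations, and the
  extremal choice of the member excludes the inconsistent ones.

  Walls are counted because passage to the injective hull tolerates only additive errors, whereas
  the hierarchical axioms compare distances up to multiplicative constants. The coarse constants are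
  hidden in the gap between the two sides of a wall. The count, raised by 1, then satisfies the
  triangle inequality exactly and the Helly property up to 3. Multiplicative constants return only
  in the comparison with the word metric.\<close>

lemma mdist_self [simp]: "x \<in> mspace m \<Longrightarrow> mdist m x x = 0"
  by simp

definition gromov_product :: "'c metric \<Rightarrow> 'c \<Rightarrow> 'c \<Rightarrow> 'c \<Rightarrow> real" where
  "gromov_product m x y w = (mdist m x w + mdist m y w - mdist m x y) / 2"

definition four_point_hyperbolic :: "'c metric \<Rightarrow> real \<Rightarrow> bool" where
  "four_point_hyperbolic m \<delta> \<longleftrightarrow>
     (\<forall>w\<in>mspace m. \<forall>x\<in>mspace m. \<forall>y\<in>mspace m. \<forall>z\<in>mspace m.
        min (gromov_product m x y w) (gromov_product m y z w) \<le> gromov_product m x z w + \<delta>)"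

lemma four_point_hyperbolicD:
  assumes "four_point_hyperbolic m \<delta>" "w \<in> mspace m" "x \<in> mspace m" "y \<in> mspace m" "z \<in> mspace m"
  shows "gromov_product m x y w \<le> gromov_product m x z w + \<delta> \<or>
    gromov_product m y z w \<le> gromov_product m x z w + \<delta>"
  using assms unfolding four_point_hyperbolic_def min_le_iff_disj by blast

lemma gromov_product_commute: "gromov_product m x y w = gromov_product m y x w"
  by (simp add: gromov_product_def mdist_commute add.commute)

lemma gromov_product_nonneg:
  "\<lbrakk>x \<in> mspace m; y \<in> mspace m; w \<in> mspace m\<rbrakk> \<Longrightarrow> 0 \<le> gromov_product m x y w"
  using mdist_triangle[of x m w y] by (simp add: gromov_product_def mdist_commute)

lemma gromov_product_le_mdist:
  "\<lbrakk>x \<in> mspace m; y \<in> mspace m; w \<in> mspace m\<rbrakk> \<Longrightarrow> gromov_product m x y w \<le> mdist m x w"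
  using mdist_triangle[of y m x w] by (simp add: gromov_product_def mdist_commute)

lemma gromov_product_base:
  assumes "x \<in> mspace m" "y \<in> mspace m" "w \<in> mspace m"
  shows "gromov_product m x y w = mdist m w y - gromov_product m x w y"
  by (simp add: gromov_product_def mdist_commute field_simps)

lemma geodesic_segment_subset: "geodesic_segment m x y A \<Longrightarrow> A \<subseteq> mspace m"
  unfolding geodesic_segment_def by blast

lemma geodesic_segment_ends:
  assumes "geodesic_segment m x y A"
  shows "x \<in> A" "y \<in> A"
proof -
  obtain p L where "0 \<le> L" "p 0 = x" "p L = y" "A = p ` {0..L::real}"
    using assms unfolding geodesic_segment_def by blast
  then show "x \<in> A" "y \<in> A" by auto
qed

lemma geodesic_segment_split:
  assumes "geodesic_segment m x y A" "n \<in> A"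
  shows "mdist m x n + mdist m n y = mdist m x y"
proof -
  obtain p L where p: "0 \<le> L" "p 0 = x" "p L = y" "A = p ` {0..L}"
    "\<And>s t. s \<in> {0..L} \<Longrightarrow> t \<in> {0..L} \<Longrightarrow> mdist m (p s) (p t) = \<bar>s - t\<bar>"
    using assms(1) unfolding geodesic_segment_def by blast
  obtain s where s: "s \<in> {0..L}" "n = p s" using assms(2) p(4) by blast
  show ?thesis using p(5)[of 0 s] p(5)[of s L] p(5)[of 0 L] p(1-3) s by auto
qed

lemma geodesic_segment_point:
  assumes "geodesic_segment m x y A" "0 \<le> t" "t \<le> mdist m x y"
  obtains n where "n \<in> A" "mdist m x n = t"
proof -
  obtain p L where p: "0 \<le> L" "p 0 = x" "p L = y" "A = p ` {0..L}"
    "\<And>s t. s \<in> {0..L} \<Longrightarrow> t \<in> {0..L} \<Longrightarrow> mdist m (p s) (p t) = \<bar>s - t\<bar>"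
    using assms(1) unfolding geodesic_segment_def by blast
  have "t \<in> {0..L}" using p(5)[of 0 L] p(1-3) assms(2,3) by auto
  then show thesis using that[of "p t"] p(5)[of 0 t] p(1,2,4) by auto
qed

lemma gromov_product_le_mdist_geodesic:
  assumes "geodesic_segment m x y A" "n \<in> A" "w \<in> mspace m" "x \<in> mspace m" "y \<in> mspace m"
  shows "gromov_product m x y w \<le> mdist m w n"
proof -
  have n: "n \<in> mspace m" using geodesic_segment_subset[OF assms(1)] assms(2) by blast
  have "mdist m x w \<le> mdist m x n + mdist m n w" "mdist m y w \<le> mdist m y n + mdist m n w"
    using n assms by (simp_all add: mdist_triangle)
  then show ?thesis using geodesic_segment_split[OF assms(1,2)]
    by (simp add: gromov_product_def mdist_commute)
qed

text \<open>Along the side from \<open>x\<close> to \<open>z\<close>, slimness makes each point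
  close to the side towards \<open>w\<close> from \<open>x\<close> or from \<open>z\<close>. Where
  this changes, a point is close to both, and the two detours through these sides add up to the
  Gromov product.\<close>

lemma slim_hyperbolic_near_point:
  assumes hyp: "slim_hyperbolic m \<delta>" and geo: "geodesic_space m" and \<delta>: "1 \<le> \<delta>"
    and seg: "geodesic_segment m x z A" and "x \<in> mspace m" "z \<in> mspace m" "w \<in> mspace m"
  obtains n where "n \<in> A" "mdist m w n \<le> gromov_product m x z w + 3 * \<delta>"
proof -
  obtain B where B: "geodesic_segment m z w B" using geo assms unfolding geodesic_space_def by blast
  obtain C where C: "geodesic_segment m x w C" using geo assms unfolding geodesic_space_def by blast
  obtain p L where p: "0 \<le> L" "p 0 = x" "p L = z" "A = p ` {0..L}" "p \<in> {0..L} \<rightarrow> mspace m"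
    "\<And>s t. s \<in> {0..L} \<Longrightarrow> t \<in> {0..L} \<Longrightarrow> mdist m (p s) (p t) = \<bar>s - t\<bar>"
    using seg unfolding geodesic_segment_def by blast
  have slim: "\<exists>b\<in>B \<union> C. mdist m (p t) b \<le> \<delta>" if "t \<in> {0..L}" for t
    using hyp seg B C p(4) that unfolding slim_hyperbolic_def by blast
  define T where "T = {t \<in> {0..L}. \<exists>c\<in>C. mdist m (p t) c \<le> \<delta>}"
  have "0 \<in> T" unfolding T_def using geodesic_segment_ends[OF C] p(1,2) assms(5) \<delta>
    by (auto intro!: bexI[of _ x])
  have bdd: "bdd_above T" unfolding T_def by (rule bdd_aboveI[of _ L]) auto
  have supL: "Sup T \<le> L" using \<open>0 \<in> T\<close> by (intro cSup_least) (auto simp: T_def)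
  have sup0: "0 \<le> Sup T" using \<open>0 \<in> T\<close> bdd by (rule cSup_upper)
  \<comment> \<open>The supremum need not belong to \<open>T\<close>, so it is approximated from
    both sides up to 1/2. The resulting jump of at most 1 is absorbed by
    \<open>1 \<le> \<delta>\<close>.\<close>
  obtain t where t: "t \<in> T" "Sup T - 1/2 < t"
    using less_cSup_iff[OF _ bdd, of "Sup T - 1/2"] \<open>0 \<in> T\<close> by auto
  have "t \<le> Sup T" using t(1) bdd by (rule cSup_upper)
  define t' where "t' = min L (Sup T + 1/2)"
  have t': "t' \<in> {0..L}" using sup0 p(1) by (auto simp: t'_def)
  obtain b where b: "b \<in> B" "mdist m (p t') b \<le> \<delta>"
  proof (cases "t' = L")
    case True
    show thesis using that[of z] geodesic_segment_ends[OF B] True p(3) assms(6) \<delta> by auto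
  next
    case False
    then have "t' \<notin> T" using cSup_upper[OF _ bdd, of t'] by (auto simp: t'_def min_def split: if_splits)
    then show thesis using slim[OF t'] t' that unfolding T_def by blast
  qed
  obtain c where c: "c \<in> C" "mdist m (p t) c \<le> \<delta>" using t(1) unfolding T_def by blast
  have tL: "t \<in> {0..L}" using t(1) by (simp add: T_def)
  have "\<bar>t - t'\<bar> \<le> 1" using t(2) \<open>t \<le> Sup T\<close> supL by (auto simp: t'_def min_def)
  then have tt: "mdist m (p t) (p t') \<le> 1" using p(6)[OF tL t'] by simp
  have in_m: "p t \<in> mspace m" "p t' \<in> mspace m" "b \<in> mspace m" "c \<in> mspace m"
    using p(5) tL t' b(1) c(1) geodesic_segment_subset[OF B] geodesic_segment_subset[OF C] by auto
  have A: "p t \<in> A" using p(4) tL by blast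
  note splits = geodesic_segment_split[OF seg A] geodesic_segment_split[OF B b(1)]
    geodesic_segment_split[OF C c(1)]
  have "mdist m (p t) b \<le> mdist m (p t) (p t') + mdist m (p t') b"
    "mdist m w (p t) \<le> mdist m w b + mdist m b (p t)"
    "mdist m w (p t) \<le> mdist m w c + mdist m c (p t)"
    "mdist m x (p t) \<le> mdist m x c + mdist m c (p t)"
    "mdist m (p t) z \<le> mdist m (p t) b + mdist m b z"
    by (simp_all add: mdist_triangle in_m assms(5-7))
  then have "mdist m w (p t) \<le> gromov_product m x z w + 3 * \<delta>"
    using splits tt b(2) c(2) \<delta>
    by (simp add: gromov_product_def mdist_commute field_simps)
  then show thesis using that A by blast
qed

text \<open>The distance from \<open>w\<close> to a geodesic is at least the Gromov product of its
  ends, and on the side from \<open>x\<close> to \<open>z\<close> some point nearly attains it.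
  Slimness moves this point to one of the other sides, whose Gromov product is thereby bounded. The
  near point costs \<open>3 * \<delta>\<close>, slimness one more \<open>\<delta>\<close>.\<close>

lemma slim_hyperbolic_imp_four_point:
  assumes hyp: "slim_hyperbolic m \<delta>" and geo: "geodesic_space m" and \<delta>: "1 \<le> \<delta>"
  shows "four_point_hyperbolic m (4 * \<delta>)"
  unfolding four_point_hyperbolic_def
proof (intro ballI)
  fix w x y z assume in_m: "w \<in> mspace m" "x \<in> mspace m" "y \<in> mspace m" "z \<in> mspace m"
  obtain A where A: "geodesic_segment m x z A" using geo in_m unfolding geodesic_space_def by blast
  obtain B where B: "geodesic_segment m z y B" using geo in_m unfolding geodesic_space_def by blast
  obtain C where C: "geodesic_segment m x y C" using geo in_m unfolding geodesic_space_def by blast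
  obtain n where n: "n \<in> A" "mdist m w n \<le> gromov_product m x z w + 3 * \<delta>"
    using slim_hyperbolic_near_point[OF hyp geo \<delta> A in_m(2,4,1)] .
  obtain b where b: "b \<in> B \<union> C" "mdist m n b \<le> \<delta>"
    using hyp A B C n(1) unfolding slim_hyperbolic_def by blast
  have "n \<in> mspace m" "b \<in> mspace m" using n(1) b(1) geodesic_segment_subset[OF A] geodesic_segment_subset[OF B]
      geodesic_segment_subset[OF C] by blast+
  then have "mdist m w b \<le> gromov_product m x z w + 4 * \<delta>"
    using mdist_triangle[of w m n b] n b in_m by auto
  moreover have "gromov_product m x y w \<le> mdist m w b \<or> gromov_product m y z w \<le> mdist m w b"
    using b(1) gromov_product_le_mdist_geodesic[OF B _ in_m(1,4,3)]
      gromov_product_le_mdist_geodesic[OF C _ in_m(1,2,3)]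
    by (auto simp: gromov_product_commute)
  ultimately show "min (gromov_product m x y w) (gromov_product m y z w)
      \<le> gromov_product m x z w + 4 * \<delta>"
    by auto
qed

lemma gromov_product_ge_diff:
  assumes "x \<in> mspace m" "y \<in> mspace m" "w \<in> mspace m"
  shows "mdist m y w - mdist m x y \<le> gromov_product m x y w"
  using mdist_triangle[of y m x w] assms by (simp add: gromov_product_def mdist_commute field_simps)

lemma mdist_ge_diff:
  assumes "x \<in> mspace m" "y \<in> mspace m" "z \<in> mspace m"
  shows "mdist m x y - mdist m y z \<le> mdist m x z"
  using mdist_triangle[of x m z y] assms by (simp add: mdist_commute)

lemma set_mdist_le_imp_mdist_le:
  assumes "set_mdist m A B \<le> e" "diam_le m A a" "diam_le m B b" "A \<subseteq> mspace m" "B \<subseteq> mspace m"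
    "x \<in> A" "y \<in> B"
  shows "mdist m x y \<le> a + e + b"
proof (rule field_le_epsilon)
  fix \<epsilon> :: real assume "0 < \<epsilon>"
  then have Inf_less: "Inf {mdist m a b |a b. a \<in> A \<and> b \<in> B} < e + \<epsilon>"
    using assms(1) by (simp add: set_mdist_def)
  have "{mdist m a b |a b. a \<in> A \<and> b \<in> B} \<noteq> {}" using assms(6,7) by blast
  from cInf_lessD[OF this Inf_less]
  obtain t where "t \<in> {mdist m a b |a b. a \<in> A \<and> b \<in> B}" "t < e + \<epsilon>" by blast
  then obtain p q where pq: "p \<in> A" "q \<in> B" "mdist m p q < e + \<epsilon>" by blast
  have "mdist m x p \<le> a" "mdist m q y \<le> b" using assms(2,3,6,7) pq(1,2) by (auto simp: diam_le_def)
  moreover have in_m: "x \<in> mspace m" "p \<in> mspace m" "q \<in> mspace m" "y \<in> mspace m"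
    using assms(4-7) pq by auto
  have "mdist m x y \<le> mdist m x p + mdist m p y" "mdist m p y \<le> mdist m p q + mdist m q y"
    by (simp_all add: mdist_triangle in_m)
  ultimately show "mdist m x y \<le> a + e + b + \<epsilon>" using pq(3) by linarith
qed

lemma set_mdist_greaterI:
  assumes "A \<noteq> {}" "B \<noteq> {}" "\<And>a b. a \<in> A \<Longrightarrow> b \<in> B \<Longrightarrow> e \<le> mdist m a b"
  shows "e \<le> set_mdist m A B"
  unfolding set_mdist_def using assms by (intro cInf_greatest) auto

section \<open>Domains of a hierarchically hyperbolic space\<close>

context hierarchically_hyperbolic_space
begin

abbreviation projects :: "'b \<Rightarrow> 'b \<Rightarrow> bool" where
  "projects U V \<equiv> properly_nested U V \<or> transverse U V"

text \<open>One point stands for a set of diameter at most \<open>E\<close>, so that all later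
  estimates are between points; an axiom with bound \<open>E\<close> on a set distance then reads
  \<open>2 * E\<close> or \<open>3 * E\<close>.\<close>

definition rho_pt :: "'b \<Rightarrow> 'b \<Rightarrow> 'c" where
  "rho_pt U V = (SOME p. p \<in> rho U V)"

lemma E_pos: "0 < E" using E_ge_1 by simp

lemma orth_commute: "U \<in> \<SS> \<Longrightarrow> V \<in> \<SS> \<Longrightarrow> orth U V \<longleftrightarrow> orth V U"
  using orth_sym unfolding symp_on_def by blast

lemma transverse_commute: "U \<in> \<SS> \<Longrightarrow> V \<in> \<SS> \<Longrightarrow> transverse U V \<longleftrightarrow> transverse V U"
  using orth_commute by blast

lemma nest_reflD: "U \<in> \<SS> \<Longrightarrow> U \<preceq> U"
  using nest_refl unfolding reflp_on_def by blast

lemma nest_transD: "\<lbrakk>U \<preceq> V; V \<preceq> W; U \<in> \<SS>; V \<in> \<SS>; W \<in> \<SS>\<rbrakk> \<Longrightarrow> U \<preceq> W"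
  using nest_trans unfolding transp_on_def by blast

lemma nest_antisymD: "\<lbrakk>U \<preceq> V; V \<preceq> U; U \<in> \<SS>; V \<in> \<SS>\<rbrakk> \<Longrightarrow> U = V"
  using nest_antisym unfolding antisymp_on_def by blast

lemma rho_pt_in_rho: "\<lbrakk>U \<in> \<SS>; V \<in> \<SS>; projects U V\<rbrakk> \<Longrightarrow> rho_pt U V \<in> rho U V"
  unfolding rho_pt_def using rho_nest[of U V] rho_transverse[of U V] some_in_eq by blast

lemma rho_subset: "\<lbrakk>U \<in> \<SS>; V \<in> \<SS>; projects U V\<rbrakk> \<Longrightarrow> rho U V \<subseteq> mspace (C V)"
  using rho_nest[of U V] rho_transverse[of U V] by blast

lemma rho_diam: "\<lbrakk>U \<in> \<SS>; V \<in> \<SS>; projects U V\<rbrakk> \<Longrightarrow> diam_le (C V) (rho U V) E"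
  using rho_nest[of U V] rho_transverse[of U V] by blast

lemma rho_pt_in: "\<lbrakk>U \<in> \<SS>; V \<in> \<SS>; projects U V\<rbrakk> \<Longrightarrow> rho_pt U V \<in> mspace (C V)"
  using rho_pt_in_rho rho_subset by blast

lemma four_point: "U \<in> \<SS> \<Longrightarrow> four_point_hyperbolic (C U) (4 * E)"
  using slim_hyperbolic_imp_four_point hyperbolic geodesic E_ge_1 by blast

lemma dset_le_imp_mdist_rho_pt:
  assumes "U \<in> \<SS>" "V \<in> \<SS>" "projects U V" "x \<in> mspace M" "dset V x (rho U V) \<le> E"
  shows "mdist (C V) (proj V x) (rho_pt U V) \<le> 2 * E"
  using set_mdist_le_imp_mdist_le[OF assms(5), of 0 E "proj V x" "rho_pt U V"]
    rho_diam[OF assms(1-3)] rho_subset[OF assms(1-3)] rho_pt_in_rho[OF assms(1-3)]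
    proj_in[OF assms(2,4)]
  by (simp add: diam_le_def)

lemma transverse_rho_pt:
  assumes "U \<in> \<SS>" "V \<in> \<SS>" "transverse U V" "x \<in> mspace M"
  shows "mdist (C U) (proj U x) (rho_pt V U) \<le> 2 * E \<or> mdist (C V) (proj V x) (rho_pt U V) \<le> 2 * E"
proof -
  have "transverse V U" using assms transverse_commute by blast
  then show ?thesis using consistency_transverse[OF assms]
      dset_le_imp_mdist_rho_pt[of U V] dset_le_imp_mdist_rho_pt[of V U] assms
    by (auto simp: min_le_iff_disj)
qed

lemma rho_pt_nested:
  assumes "U \<in> \<SS>" "V \<in> \<SS>" "W \<in> \<SS>" "U \<preceq> V" "transverse V W" "\<not> orth W U" "projects U W"
  shows "mdist (C W) (rho_pt U W) (rho_pt V W) \<le> 3 * E"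
proof -
  have "set_mdist (C W) (rho U W) (rho V W) \<le> E"
    using consistency_rho[OF assms(1-4)] assms(5,6) by blast
  from set_mdist_le_imp_mdist_le[OF this rho_diam rho_diam] show ?thesis
    using assms rho_subset rho_pt_in_rho by fastforce
qed

text \<open>If the Gromov product at \<open>rho_pt U V\<close> exceeds \<open>2 * E\<close>, the
  whole geodesic in \<open>C V\<close> stays farther than \<open>E\<close> from
  \<open>rho U V\<close>. Then bounded geodesic image controls the image of the geodesic, and
  consistency identifies the images of its ends with the projections to \<open>C U\<close>, each
  with error \<open>E\<close>. This trades the maps \<open>rhomap\<close> for Gromov
  products.\<close>

lemma bounded_geodesic_image_gromov_product:
  assumes UV: "U \<in> \<SS>" "V \<in> \<SS>" "properly_nested U V" and xy: "x \<in> mspace M" "y \<in> mspace M"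
  shows "gromov_product (C V) (proj V x) (proj V y) (rho_pt U V) \<le> 2 * E \<or> dpts U x y \<le> 3 * E"
proof (rule disjCI)
  assume far: "\<not> dpts U x y \<le> 3 * E"
  show "gromov_product (C V) (proj V x) (proj V y) (rho_pt U V) \<le> 2 * E"
  proof (rule ccontr)
    assume *: "\<not> ?thesis"
    define r where "r = rho_pt U V"
    define g where "g = gromov_product (C V) (proj V x) (proj V y) r"
    have g: "2 * E < g" using * by (simp add: g_def r_def)
    have r: "r \<in> mspace (C V)" "r \<in> rho U V"
      using rho_pt_in rho_pt_in_rho UV by (auto simp: r_def)
    note pV = proj_in[OF UV(2) xy(1)] proj_in[OF UV(2) xy(2)]
    note pU = proj_in[OF UV(1) xy(1)] proj_in[OF UV(1) xy(2)]
    obtain A where A: "geodesic_segment (C V) (proj V x) (proj V y) A"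
      using geodesic[OF UV(2)] pV unfolding geodesic_space_def by blast
    have far_rho: "g - E \<le> mdist (C V) n a" if "n \<in> A" "a \<in> rho U V" for n a
    proof -
      have "n \<in> mspace (C V)" "a \<in> mspace (C V)"
        using that geodesic_segment_subset[OF A] rho_nest[OF UV] by auto
      moreover have "mdist (C V) r a \<le> E" using rho_nest[OF UV] r(2) that(2)
        by (simp add: diam_le_def)
      moreover have "g \<le> mdist (C V) r n"
        unfolding g_def using gromov_product_le_mdist_geodesic[OF A that(1) r(1) pV] .
      ultimately show ?thesis using mdist_triangle[of r "C V" a n] r(1)
        by (simp add: mdist_commute)
    qed
    have "A \<noteq> {}" using geodesic_segment_ends(1)[OF A] by blast
    then have "g - E \<le> set_mdist (C V) A (rho U V)"
      using far_rho r(2) by (intro set_mdist_greaterI) auto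
    then have "diam_le (C U) (rhomap V U ` A) E"
      using bounded_geodesic_image[OF UV A] g by linarith
    then have d1: "mdist (C U) (rhomap V U (proj V x)) (rhomap V U (proj V y)) \<le> E"
      using geodesic_segment_ends[OF A] unfolding diam_le_def by blast
    have near: "mdist (C U) (proj U z) (rhomap V U (proj V z)) \<le> E"
      if z: "z \<in> mspace M" "proj V z \<in> A" for z
    proof -
      have "g - E \<le> dset V z (rho U V)"
        using far_rho z(2) r(2) by (intro set_mdist_greaterI) auto
      then have "\<not> dset V z (rho U V) \<le> E" using g by linarith
      then have "diam_le (C U) {proj U z, rhomap V U (proj V z)} E"
        using consistency_nested[OF UV z(1)] by blast
      then show ?thesis by (simp add: diam_le_def)
    qed
    have in_U: "rhomap V U (proj V x) \<in> mspace (C U)" "rhomap V U (proj V y) \<in> mspace (C U)"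
      using rhomap_in[OF UV] pV by auto
    have "dpts U x y \<le> mdist (C U) (proj U x) (rhomap V U (proj V x)) +
        mdist (C U) (rhomap V U (proj V x)) (proj U y)"
      "mdist (C U) (rhomap V U (proj V x)) (proj U y) \<le>
        mdist (C U) (rhomap V U (proj V x)) (rhomap V U (proj V y)) +
        mdist (C U) (rhomap V U (proj V y)) (proj U y)"
      by (simp_all add: mdist_triangle in_U pU)
    moreover have "mdist (C U) (proj U x) (rhomap V U (proj V x)) \<le> E"
      "mdist (C U) (rhomap V U (proj V y)) (proj U y) \<le> E"
      using near[OF xy(1)] near[OF xy(2)] geodesic_segment_ends[OF A] by (simp_all add: mdist_commute)
    ultimately show False using far d1 by linarith
  qed
qed

lemma partial_realisation_rho_pt:
  assumes "\<U> \<subseteq> \<SS>" "\<And>U V. \<lbrakk>U \<in> \<U>; V \<in> \<U>; U \<noteq> V\<rbrakk> \<Longrightarrow> orth U V" "\<And>U. U \<in> \<SS> \<Longrightarrow> b U \<in> mspace (C U)"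
  obtains x where "x \<in> mspace M" "\<And>U. U \<in> \<U> \<Longrightarrow> mdist (C U) (proj U x) (b U) \<le> E"
    "\<And>U V. \<lbrakk>U \<in> \<U>; V \<in> \<SS>; projects U V\<rbrakk> \<Longrightarrow> mdist (C V) (proj V x) (rho_pt U V) \<le> 2 * E"
proof -
  have "\<exists>x\<in>mspace M. \<forall>U\<in>\<U>. mdist (C U) (proj U x) (b U) \<le> E \<and>
          (\<forall>V\<in>\<SS>. properly_nested U V \<or> transverse U V \<longrightarrow> dset V x (rho U V) \<le> E)"
    using assms by (intro partial_realisation) auto
  then obtain x where x: "x \<in> mspace M" "\<And>U. U \<in> \<U> \<Longrightarrow> mdist (C U) (proj U x) (b U) \<le> E"
    "\<And>U V. \<lbrakk>U \<in> \<U>; V \<in> \<SS>; projects U V\<rbrakk> \<Longrightarrow> dset V x (rho U V) \<le> E" by blast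
  show thesis
  proof (rule that[OF x(1,2)])
    fix U V assume *: "U \<in> \<U>" "V \<in> \<SS>" "projects U V"
    then have "U \<in> \<SS>" using assms(1) by blast
    from dset_le_imp_mdist_rho_pt[OF this *(2,3) x(1) x(3)[OF *]]
    show "mdist (C V) (proj V x) (rho_pt U V) \<le> 2 * E" .
  qed
qed

subsection \<open>Depth\<close>

definition chain_above :: "'b \<Rightarrow> 'b set \<Rightarrow> bool" where
  "chain_above U \<C> \<longleftrightarrow> \<C> \<subseteq> \<SS> \<and> (\<forall>V\<in>\<C>. \<forall>W\<in>\<C>. V \<preceq> W \<or> W \<preceq> V) \<and> (\<forall>V\<in>\<C>. U \<preceq> V)"

text \<open>Depth is counted from the top: the maximal domain has depth 1, and passing to a properly
  nested domain increases it.\<close>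

definition depth :: "'b \<Rightarrow> nat" where
  "depth U = Max (card ` {\<C>. chain_above U \<C>})"

abbreviation complexity :: nat where
  "complexity \<equiv> nat \<lfloor>E\<rfloor>"

lemma chain_above_bound:
  assumes "chain_above U \<C>" shows "finite \<C>" "card \<C> \<le> complexity"
proof -
  have *: "finite \<C> \<and> real (card \<C>) \<le> E"
    using assms by (intro finite_complexity) (auto simp: chain_above_def)
  then show "finite \<C>" by blast
  show "card \<C> \<le> complexity" using * by (simp add: le_nat_floor)
qed

lemma finite_card_chains: "finite (card ` {\<C>. chain_above U \<C>})"
  by (rule finite_subset[of _ "{..complexity}"]) (use chain_above_bound in auto)

lemma card_chain_le_depth: "chain_above U \<C> \<Longrightarrow> card \<C> \<le> depth U"
  unfolding depth_def using finite_card_chains by (intro Max_ge) auto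

lemma depth_attained: obtains \<C> where "chain_above U \<C>" "card \<C> = depth U"
proof -
  have "chain_above U {}" by (simp add: chain_above_def)
  then have "card ` {\<C>. chain_above U \<C>} \<noteq> {}" by blast
  from Max_in[OF finite_card_chains this] show thesis using that unfolding depth_def by auto
qed

lemma depth_le_complexity: "depth U \<le> complexity"
  using depth_attained[of U] chain_above_bound(2) by metis

lemma depth_ge_1: "U \<in> \<SS> \<Longrightarrow> 1 \<le> depth U"
  using card_chain_le_depth[of U "{U}"] nest_reflD by (simp add: chain_above_def)

lemma depth_less:
  assumes "V \<in> \<SS>" "U \<in> \<SS>" "properly_nested V U"
  shows "depth U < depth V"
proof -
  obtain \<C> where \<C>: "chain_above U \<C>" "card \<C> = depth U" by (rule depth_attained)
  have "V \<notin> \<C>" using \<C>(1) assms nest_antisymD unfolding chain_above_def by blast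
  moreover have "chain_above V (insert V \<C>)"
    using \<C>(1) assms nest_reflD nest_transD[of V U] unfolding chain_above_def by blast
  ultimately show ?thesis using card_chain_le_depth[of V "insert V \<C>"] \<C> chain_above_bound(1) by simp
qed

lemma exists_nest_maximal:
  assumes "\<B> \<subseteq> \<SS>" "\<B> \<noteq> {}"
  obtains V where "V \<in> \<B>" "\<And>W. \<lbrakk>W \<in> \<B>; V \<preceq> W\<rbrakk> \<Longrightarrow> W = V"
proof -
  obtain V where V: "V \<in> \<B>" "\<And>W. W \<in> \<B> \<Longrightarrow> depth V \<le> depth W"
    using assms(2) ex_has_least_nat[of "\<lambda>V. V \<in> \<B>" _ depth] by blast
  show thesis
  proof (rule that[OF V(1)])
    fix W assume "W \<in> \<B>" "V \<preceq> W"
    then show "W = V" using V(1) V(2)[of W] depth_less[of V W] assms(1) by (metis leD subsetD)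
  qed
qed

text \<open>Every domain lies below one that is maximal for nesting, since depth is bounded; by
  uniqueness of the maximal element this is always the same one.\<close>

lemma exists_top:
  assumes "\<SS> \<noteq> {}"
  obtains S where "S \<in> \<SS>" "\<And>V. V \<in> \<SS> \<Longrightarrow> V \<preceq> S"
proof -
  obtain S where S: "S \<in> \<SS>" "\<And>T. \<lbrakk>T \<in> \<SS>; \<forall>V\<in>\<SS>. T \<preceq> V \<longrightarrow> V = T\<rbrakk> \<Longrightarrow> T = S"
    using nest_maximal[OF assms] by blast
  show thesis
  proof (rule that[OF S(1)])
    fix V assume V: "V \<in> \<SS>"
    have "{W \<in> \<SS>. V \<preceq> W} \<noteq> {}" using V nest_reflD by blast
    then obtain W where W: "W \<in> {W \<in> \<SS>. V \<preceq> W}" "\<And>T. \<lbrakk>T \<in> {W \<in> \<SS>. V \<preceq> W}; W \<preceq> T\<rbrakk> \<Longrightarrow> T = W"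
      using exists_nest_maximal[of "{W \<in> \<SS>. V \<preceq> W}"] by blast
    have "T = W" if "T \<in> \<SS>" "W \<preceq> T" for T
      using W that V nest_transD[of V W T] by blast
    then show "V \<preceq> S" using S(2)[of W] W(1) by blast
  qed
qed

text \<open>The members orthogonal to a chosen \<open>U\<close> all lie in a container properly
  nested in \<open>T\<close>. Removing one member is thus paid for by at least one level of
  depth.\<close>

lemma card_orthogonal_plus_depth:
  assumes "finite \<U>" "\<U> \<subseteq> \<SS>" "\<And>U V. \<lbrakk>U \<in> \<U>; V \<in> \<U>; U \<noteq> V\<rbrakk> \<Longrightarrow> orth U V"
    "T \<in> \<SS>" "\<And>U. U \<in> \<U> \<Longrightarrow> U \<preceq> T"
  shows "card \<U> + depth T \<le> complexity + 1"
  using assms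
proof (induction arbitrary: T rule: finite_induct)
  case empty
  then show ?case using depth_le_complexity[of T] by simp
next
  case (insert U \<U>)
  show ?case
  proof (cases "\<U> = {}")
    case True
    then show ?thesis using depth_le_complexity[of T] by simp
  next
    case False
    then obtain V where V: "V \<in> \<U>" by blast
    have "orth V U" using insert.prems(2)[of V U] V insert.hyps by blast
    then have ex: "\<exists>V\<in>\<SS>. V \<preceq> T \<and> orth V U" using V insert.prems(1,4) by blast
    obtain W where W: "W \<in> \<SS>" "properly_nested W T" "\<And>V. \<lbrakk>V \<in> \<SS>; V \<preceq> T; orth V U\<rbrakk> \<Longrightarrow> V \<preceq> W"
      using orth_container[OF insert.prems(3) _ _ ex] insert.prems(1,4) by blast
    have "card \<U> + depth W \<le> complexity + 1"
    proof (rule insert.IH)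
      show "U' \<preceq> W" if "U' \<in> \<U>" for U'
      proof (rule W(3))
        show "orth U' U" using insert.prems(2)[of U' U] that insert.hyps by blast
      qed (use that insert.prems in auto)
    qed (use insert.prems W in auto)
    moreover have "depth T < depth W" using depth_less[of W T] W insert.prems by blast
    ultimately show ?thesis using insert.hyps by simp
  qed
qed

lemma card_orthogonal:
  assumes "finite \<U>" "\<U> \<subseteq> \<SS>" "\<And>U V. \<lbrakk>U \<in> \<U>; V \<in> \<U>; U \<noteq> V\<rbrakk> \<Longrightarrow> orth U V"
  shows "card \<U> \<le> complexity"
proof (cases "\<SS> = {}")
  case True
  then show ?thesis using assms by simp
next
  case False
  then obtain S where S: "S \<in> \<SS>" "\<And>V. V \<in> \<SS> \<Longrightarrow> V \<preceq> S" using exists_top by blast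
  have "card \<U> + depth S \<le> complexity + 1"
    by (rule card_orthogonal_plus_depth[OF assms S(1)]) (use S(2) assms(2) in auto)
  then show ?thesis using depth_ge_1[OF S(1)] by simp
qed

text \<open>Large links applied to \<open>W\<close> put every member strictly below \<open>W\<close>
  under one of boundedly many domains \<open>T\<close> properly nested in \<open>W\<close>. The
  axiom gives a uniform number because a domain strictly above a member has
  \<open>dpts W y z \<le> K\<close>. Iterating stops after \<open>complexity - depth W\<close>
  levels, which is the exponent.\<close>

lemma card_incomparable_le:
  assumes yz: "y \<in> mspace M" "z \<in> mspace M" and \<V>: "\<V> \<subseteq> \<SS>" "finite \<V>"
    and incomp: "\<And>V W. \<lbrakk>V \<in> \<V>; W \<in> \<V>; V \<preceq> W\<rbrakk> \<Longrightarrow> V = W"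
    and large: "\<And>V. V \<in> \<V> \<Longrightarrow> E \<le> dpts V y z"
    and small: "\<And>V W. \<lbrakk>V \<in> \<V>; W \<in> \<SS>; properly_nested V W\<rbrakk> \<Longrightarrow> dpts W y z \<le> K" and K: "0 \<le> K"
    and W: "W \<in> \<SS>"
  shows "card {V \<in> \<V>. V \<preceq> W} \<le> nat \<lfloor>E * K + E\<rfloor> ^ (complexity - depth W)"
  using W
proof (induction "complexity - depth W" arbitrary: W rule: less_induct)
  case less
  let ?m = "nat \<lfloor>E * K + E\<rfloor>"
  have m: "1 \<le> ?m" using K E_ge_1 by (simp add: le_nat_iff le_floor_iff add_increasing)
  show ?case
  proof (cases "W \<in> \<V> \<or> {V \<in> \<V>. V \<preceq> W} = {}")
    case True
    then have "{V \<in> \<V>. V \<preceq> W} \<subseteq> {W}" using incomp by blast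
    then have "card {V \<in> \<V>. V \<preceq> W} \<le> 1" using card_mono[of "{W}"] by simp
    also have "1 \<le> ?m ^ (complexity - depth W)" using m by (rule one_le_power)
    finally show ?thesis .
  next
    case False
    then obtain V where V: "V \<in> \<V>" "properly_nested V W" by blast
    have dW: "dpts W y z \<le> K" using small[OF V(1) less.prems V(2)] .
    obtain \<T> where \<T>: "finite \<T>" "int (card \<T>) \<le> \<lfloor>E * dpts W y z + E\<rfloor>"
      "\<And>T. T \<in> \<T> \<Longrightarrow> T \<in> \<SS> \<and> properly_nested T W"
      "\<And>T. T \<in> \<SS> \<Longrightarrow> properly_nested T W \<Longrightarrow> (\<exists>T'\<in>\<T>. T \<preceq> T') \<or> dpts T y z < E"
      using large_links[OF less.prems yz refl] by blast
    have "\<lfloor>E * dpts W y z + E\<rfloor> \<le> \<lfloor>E * K + E\<rfloor>"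
      using dW E_pos by (intro floor_mono) simp
    then have card_\<T>: "card \<T> \<le> ?m" using \<T>(2) by linarith
    have sub: "{V \<in> \<V>. V \<preceq> W} \<subseteq> (\<Union>T\<in>\<T>. {V \<in> \<V>. V \<preceq> T})"
    proof
      fix V' assume V': "V' \<in> {V \<in> \<V>. V \<preceq> W}"
      then have "V' \<in> \<SS>" "properly_nested V' W" "\<not> dpts V' y z < E" using \<V>(1) False large[of V'] by auto
      then show "V' \<in> (\<Union>T\<in>\<T>. {V \<in> \<V>. V \<preceq> T})" using \<T>(4)[of V'] V' by blast
    qed
    have each: "card {V \<in> \<V>. V \<preceq> T} \<le> ?m ^ (complexity - depth W - 1)" if "T \<in> \<T>" for T
    proof -
      have "depth W < depth T" using depth_less[of T W] \<T>(3)[OF that] less.prems by blast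
      then have "complexity - depth T < complexity - depth W"
        using depth_le_complexity[of T] by linarith
      then have "card {V \<in> \<V>. V \<preceq> T} \<le> ?m ^ (complexity - depth T)"
        using less.hyps \<T>(3)[OF that] by blast
      also have "\<dots> \<le> ?m ^ (complexity - depth W - 1)"
        using \<open>depth W < depth T\<close> by (intro power_increasing m) auto
      finally show ?thesis .
    qed
    have "\<T> \<noteq> {}" using sub V by blast
    then obtain T where "T \<in> \<T>" by blast
    then have "depth W < complexity"
      using depth_less[of T W] \<T>(3) less.prems depth_le_complexity[of T] by (meson order_less_le_trans)
    have "card {V \<in> \<V>. V \<preceq> W} \<le> card (\<Union>T\<in>\<T>. {V \<in> \<V>. V \<preceq> T})"
      using sub \<T>(1) \<V>(2) by (intro card_mono) auto
    also have "\<dots> \<le> (\<Sum>T\<in>\<T>. card {V \<in> \<V>. V \<preceq> T})" using \<T>(1) by (rule card_UN_le)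
    also have "\<dots> \<le> card \<T> * ?m ^ (complexity - depth W - 1)"
      using sum_mono[of \<T> "\<lambda>T. card {V \<in> \<V>. V \<preceq> T}" "\<lambda>T. ?m ^ (complexity - depth W - 1)"] each
      by simp
    also have "\<dots> \<le> ?m * ?m ^ (complexity - depth W - 1)" using card_\<T> by (rule mult_right_mono) simp
    also have "\<dots> = ?m ^ (complexity - depth W)"
      using \<open>depth W < complexity\<close> by (metis Suc_diff_Suc diff_Suc_1 minus_nat.simps(1) power_Suc diff_diff_left Suc_eq_plus1)
    finally show ?thesis .
  qed
qed

end

section \<open>Realisation of consistent tuples\<close>

context hierarchically_hyperbolic_space
begin

text \<open>The clause for nested domains demands of the tuple what
  \<open>bounded_geodesic_image_gromov_product\<close> proves for a point of the space, tested
  against all points \<open>z\<close>. In this form it can be checked for gates by Gromov product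
  estimates alone.\<close>

definition consistent_tuple :: "real \<Rightarrow> ('b \<Rightarrow> 'c) \<Rightarrow> bool" where
  "consistent_tuple \<kappa> b \<longleftrightarrow>
     (\<forall>U\<in>\<SS>. b U \<in> mspace (C U)) \<and>
     (\<forall>U\<in>\<SS>. \<forall>V\<in>\<SS>. transverse U V \<longrightarrow>
        mdist (C U) (b U) (rho_pt V U) \<le> \<kappa> \<or> mdist (C V) (b V) (rho_pt U V) \<le> \<kappa>) \<and>
     (\<forall>U\<in>\<SS>. \<forall>V\<in>\<SS>. properly_nested U V \<longrightarrow> (\<forall>z\<in>mspace M.
        gromov_product (C V) (proj V z) (b V) (rho_pt U V) \<le> \<kappa> \<or> mdist (C U) (proj U z) (b U) \<le> \<kappa>))"

text \<open>A domain is active if the tuple looks, from every larger or transverse domain, as if it were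
  located at that domain. A realisation point of a family of pairwise orthogonal active domains can
  be wrong only in the domains nested in a member of the family or orthogonal to all of them.\<close>

definition active :: "real \<Rightarrow> ('b \<Rightarrow> 'c) \<Rightarrow> 'b \<Rightarrow> bool" where
  "active c b U \<longleftrightarrow> U \<in> \<SS> \<and>
     (\<forall>V\<in>\<SS>. projects U V \<longrightarrow> mdist (C V) (b V) (rho_pt U V) \<le> c)"

context
  fixes \<kappa> :: real and b :: "'b \<Rightarrow> 'c"
  assumes consistent: "consistent_tuple \<kappa> b"
begin

lemma tuple_in: "U \<in> \<SS> \<Longrightarrow> b U \<in> mspace (C U)"
  using consistent by (simp add: consistent_tuple_def)

lemma tuple_transverse:
  "\<lbrakk>U \<in> \<SS>; V \<in> \<SS>; transverse U V\<rbrakk> \<Longrightarrow>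
     mdist (C U) (b U) (rho_pt V U) \<le> \<kappa> \<or> mdist (C V) (b V) (rho_pt U V) \<le> \<kappa>"
  using consistent unfolding consistent_tuple_def by blast

lemma tuple_nested:
  "\<lbrakk>U \<in> \<SS>; V \<in> \<SS>; properly_nested U V; z \<in> mspace M\<rbrakk> \<Longrightarrow>
     gromov_product (C V) (proj V z) (b V) (rho_pt U V) \<le> \<kappa> \<or> mdist (C U) (proj U z) (b U) \<le> \<kappa>"
  using consistent unfolding consistent_tuple_def by blast

lemma tuple_nested_mdist:
  assumes "U \<in> \<SS>" "V \<in> \<SS>" "properly_nested U V" "z \<in> mspace M"
    "\<kappa> < mdist (C U) (proj U z) (b U)"
  shows "mdist (C V) (b V) (rho_pt U V) \<le> \<kappa> + mdist (C V) (proj V z) (b V)"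
proof -
  have "gromov_product (C V) (proj V z) (b V) (rho_pt U V) \<le> \<kappa>"
    using tuple_nested[OF assms(1-4)] assms(5) by linarith
  moreover have "mdist (C V) (b V) (rho_pt U V) - mdist (C V) (proj V z) (b V)
      \<le> gromov_product (C V) (proj V z) (b V) (rho_pt U V)"
    using assms by (intro gromov_product_ge_diff proj_in tuple_in rho_pt_in) auto
  ultimately show ?thesis by linarith
qed

lemma transverse_far:
  assumes "U \<in> \<SS>" "V \<in> \<SS>" "transverse U V" "z \<in> mspace M"
    "mdist (C U) (b U) (rho_pt V U) + 2 * E < mdist (C U) (proj U z) (b U)"
  shows "mdist (C V) (proj V z) (rho_pt U V) \<le> 2 * E"
proof -
  have "transverse V U" using assms(1-3) transverse_commute by blast
  then have "mdist (C U) (proj U z) (b U) - mdist (C U) (b U) (rho_pt V U)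
      \<le> mdist (C U) (proj U z) (rho_pt V U)"
    using assms by (intro mdist_ge_diff proj_in tuple_in rho_pt_in) auto
  then show ?thesis using transverse_rho_pt[OF assms(1-4)] assms(5) by linarith
qed

section \<open>Domains in which a point disagrees with the tuple\<close>

definition bad :: "'a \<Rightarrow> real \<Rightarrow> 'b set" where
  "bad y K = {V \<in> \<SS>. K < mdist (C V) (proj V y) (b V)}"

definition maximal_bad :: "'a \<Rightarrow> real \<Rightarrow> 'b set" where
  "maximal_bad y K = {V \<in> bad y K. \<forall>W\<in>bad y K. V \<preceq> W \<longrightarrow> W = V}"

lemma badD:
  assumes "V \<in> bad y K"
  shows "V \<in> \<SS>" "K < mdist (C V) (proj V y) (b V)"
  using assms by (auto simp: bad_def)

lemma maximal_badD:
  assumes "V \<in> maximal_bad y K"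
  shows "V \<in> \<SS>" "K < mdist (C V) (proj V y) (b V)"
    "\<And>W. \<lbrakk>W \<in> \<SS>; properly_nested V W\<rbrakk> \<Longrightarrow> mdist (C W) (proj W y) (b W) \<le> K"
    "\<And>W. \<lbrakk>W \<in> maximal_bad y K; V \<preceq> W\<rbrakk> \<Longrightarrow> W = V"
  using assms unfolding maximal_bad_def bad_def by (auto simp: not_le[symmetric])

lemma maximal_bad_above:
  assumes "V \<in> bad y K"
  obtains W where "W \<in> maximal_bad y K" "V \<preceq> W"
proof -
  have ne: "{W \<in> bad y K. V \<preceq> W} \<noteq> {}" using assms nest_reflD badD by blast
  have sub: "{W \<in> bad y K. V \<preceq> W} \<subseteq> \<SS>" by (auto simp: bad_def)
  obtain W where W_in: "W \<in> {W \<in> bad y K. V \<preceq> W}" and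
    W_max: "\<And>T. \<lbrakk>T \<in> {W \<in> bad y K. V \<preceq> W}; W \<preceq> T\<rbrakk> \<Longrightarrow> T = W"
    by (rule exists_nest_maximal[OF sub ne]) blast
  then have W: "W \<in> bad y K" "V \<preceq> W" by auto
  have "T = W" if "T \<in> bad y K" "W \<preceq> T" for T
    using W_max[of T] nest_transD[of V W T] that W(1,2) badD[OF assms] badD[OF W(1)] badD[OF that(1)]
    by blast
  then show thesis using that W(1,2) unfolding maximal_bad_def by blast
qed

text \<open>The sequence is ordered as if travelling from \<open>y\<close> to the tuple: in
  \<open>V i\<close> the tuple sits at the projection of \<open>V (Suc i)\<close>, and since
  \<open>y\<close> is far from it there, \<open>y\<close> sits in \<open>V (Suc i)\<close> at the
  projection of \<open>V i\<close>. The aim is to refute the existence of such an infinite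
  sequence.\<close>

context
  fixes y :: 'a and K :: real and V :: "nat \<Rightarrow> 'b"
  assumes y: "y \<in> mspace M" and K: "\<kappa> + 6 * E \<le> K"
    and V: "\<And>i. V i \<in> maximal_bad y K"
    and V_transverse: "\<And>i. transverse (V i) (V (Suc i))"
    and V_order: "\<And>i. mdist (C (V i)) (b (V i)) (rho_pt (V (Suc i)) (V i)) \<le> \<kappa>"
begin

lemma V_in: "V i \<in> \<SS>" and V_bad: "K < mdist (C (V i)) (proj (V i) y) (b (V i))"
  using maximal_badD(1,2) V by blast+

text \<open>Closeness to the tuple propagates from \<open>V (Suc i)\<close> to \<open>V i\<close>.
  In \<open>V (Suc i)\<close> the point \<open>y\<close> is within \<open>2 * E\<close> of the
  projection of \<open>V i\<close> but more than \<open>K\<close> from the tuple, so a point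
  \<open>z\<close> within \<open>\<kappa> + 2 * E\<close> of the tuple is farther than
  \<open>2 * E\<close> from that projection; this is where \<open>\<kappa> + 6 * E \<le> K\<close>
  comes from. Transversality then places \<open>z\<close> in \<open>V i\<close> at the projection of
  \<open>V (Suc i)\<close>, next to the tuple.\<close>

lemma chain_step:
  assumes z: "z \<in> mspace M" and near: "mdist (C (V (Suc i))) (proj (V (Suc i)) z) (b (V (Suc i))) \<le> \<kappa> + 2 * E"
  shows "2 * E < mdist (C (V (Suc i))) (proj (V (Suc i)) z) (rho_pt (V i) (V (Suc i)))"
    and "mdist (C (V i)) (proj (V i) z) (b (V i)) \<le> \<kappa> + 2 * E"
proof -
  let ?U = "V i" and ?W = "V (Suc i)"
  have tr: "transverse ?W ?U" using V_transverse transverse_commute V_in by blast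
  note r = rho_pt_in[OF V_in[of i] V_in[of "Suc i"] disjI2, OF V_transverse]
    rho_pt_in[OF V_in[of "Suc i"] V_in[of i] disjI2, OF tr]
  note in_m = r proj_in[OF V_in z] proj_in[OF V_in y] tuple_in[OF V_in]
  have y_W: "mdist (C ?W) (proj ?W y) (rho_pt ?U ?W) \<le> 2 * E"
    by (rule transverse_far) (use V_in V_transverse y V_order[of i] V_bad[of i] K E_pos in auto)
  have "mdist (C ?W) (proj ?W y) (b ?W) \<le>
      mdist (C ?W) (proj ?W y) (rho_pt ?U ?W) + mdist (C ?W) (rho_pt ?U ?W) (b ?W)"
    "mdist (C ?W) (rho_pt ?U ?W) (b ?W) \<le>
      mdist (C ?W) (rho_pt ?U ?W) (proj ?W z) + mdist (C ?W) (proj ?W z) (b ?W)"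
    by (simp_all add: mdist_triangle in_m)
  then show far: "2 * E < mdist (C ?W) (proj ?W z) (rho_pt ?U ?W)"
    using V_bad[of "Suc i"] y_W near K E_pos by (simp add: mdist_commute)
  then have "mdist (C ?U) (proj ?U z) (rho_pt ?W ?U) \<le> 2 * E"
    using transverse_rho_pt[OF V_in[of i] V_in[of "Suc i"] V_transverse z] by linarith
  moreover have "mdist (C ?U) (proj ?U z) (b ?U) \<le>
      mdist (C ?U) (proj ?U z) (rho_pt ?W ?U) + mdist (C ?U) (rho_pt ?W ?U) (b ?U)"
    by (simp add: mdist_triangle in_m)
  ultimately show "mdist (C ?U) (proj ?U z) (b ?U) \<le> \<kappa> + 2 * E"
    using V_order[of i] by (simp add: mdist_commute)
qed

lemma chain_near:
  assumes "z \<in> mspace M" "mdist (C (V k)) (proj (V k) z) (b (V k)) \<le> \<kappa> + 2 * E" "i \<le> k"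
  shows "mdist (C (V i)) (proj (V i) z) (b (V i)) \<le> \<kappa> + 2 * E"
  using assms(3)
proof (induction rule: inc_induct)
  case base
  then show ?case using assms(2) .
next
  case (step n)
  then show ?case using chain_step(2)[OF assms(1)] by blast
qed

lemma \<kappa>_nonneg: "0 \<le> \<kappa>"
  using V_order[of 0] mdist_nonneg[of "C (V 0)" "b (V 0)" "rho_pt (V (Suc 0)) (V 0)"] by linarith

text \<open>If two members were equal or orthogonal, partial realisation would give one point
  \<open>z\<close> adapted to both. Being close to the tuple in \<open>V k\<close>, it would be far
  from the projection of \<open>V i\<close> in \<open>V (Suc i)\<close> by propagation, yet partial
  realisation puts it there. Comparable distinct members are excluded by maximality.\<close>

lemma chain_transverse:
  assumes "i < k" shows "transverse (V i) (V k)"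
proof -
  have "\<not> (V i = V k \<or> orth (V i) (V k))"
  proof
    assume *: "V i = V k \<or> orth (V i) (V k)"
    obtain z where z: "z \<in> mspace M" "\<And>U. U \<in> {V i, V k} \<Longrightarrow> mdist (C U) (proj U z) (b U) \<le> E"
      "\<And>U W. \<lbrakk>U \<in> {V i, V k}; W \<in> \<SS>; projects U W\<rbrakk> \<Longrightarrow> mdist (C W) (proj W z) (rho_pt U W) \<le> 2 * E"
      by (rule partial_realisation_rho_pt[of "{V i, V k}" b])
        (use V_in * orth_commute tuple_in in auto)
    have "mdist (C (V k)) (proj (V k) z) (b (V k)) \<le> \<kappa> + 2 * E" using z(2)[of "V k"] \<kappa>_nonneg E_pos by simp
    from chain_step(1)[OF z(1) chain_near[OF z(1) this, of "Suc i"]] assms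
    have "2 * E < mdist (C (V (Suc i))) (proj (V (Suc i)) z) (rho_pt (V i) (V (Suc i)))" by simp
    moreover have "\<dots> \<le> 2 * E" using z(3)[of "V i" "V (Suc i)"] V_in V_transverse by blast
    ultimately show False by linarith
  qed
  then show ?thesis using maximal_badD(4)[OF V V] by metis
qed

lemma chain_inj: "inj_on V {..k}"
proof (rule inj_onI)
  fix i j assume "V i = V j"
  then show "i = j" using chain_transverse[of i j] chain_transverse[of j i] nest_reflD[OF V_in]
    by (metis linorder_neqE_nat)
qed

text \<open>The point realising only the last member of a finite chain agrees with the tuple in the whole
  chain, and is close to \<open>y\<close> in all domains properly above it. By large links this bounds the length
  of the chain.\<close>

lemma chain_above_close:
  assumes z: "z \<in> mspace M" "mdist (C (V k)) (proj (V k) z) (b (V k)) \<le> E"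
    "\<And>W. \<lbrakk>W \<in> \<SS>; projects (V k) W\<rbrakk> \<Longrightarrow> mdist (C W) (proj W z) (rho_pt (V k) W) \<le> 2 * E"
    and i: "i \<le> k" and W: "W \<in> \<SS>" "properly_nested (V i) W"
  shows "dpts W y z \<le> 2 * K + \<kappa> + 2 * E"
proof -
  have y_W: "mdist (C W) (proj W y) (b W) \<le> K" using maximal_badD(3)[OF V[of i] W] .
  have K_pos: "0 \<le> K" using y_W mdist_nonneg[of "C W" "proj W y" "b W"] by linarith
  have not_nested: "\<not> W \<preceq> V k"
  proof
    assume "W \<preceq> V k"
    then have "V i \<preceq> V k" using nest_transD W V_in by blast
    then have "V k = V i" using maximal_badD(4)[OF V V] by blast
    then show False using W \<open>W \<preceq> V k\<close> nest_antisymD V_in by metis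
  qed
  have not_orth: "\<not> orth (V k) W"
  proof
    assume "orth (V k) W"
    then have "orth W (V k)" using orth_commute V_in W by blast
    then have *: "orth (V i) (V k)" using orth_nest[of "V i" W "V k"] W V_in by blast
    show False
    proof (cases "i = k")
      case True
      then show ?thesis using * orth_irrefl V_in[of k] unfolding irreflp_on_def by blast
    next
      case False
      then show ?thesis using chain_transverse[of i k] i * by simp
    qed
  qed
  have proj_W: "projects (V k) W" using not_nested not_orth nest_reflD[OF W(1)] by metis
  have b_W: "mdist (C W) (b W) (rho_pt (V k) W) \<le> \<kappa> + K"
  proof (cases "properly_nested (V k) W")
    case True
    have "\<kappa> < mdist (C (V k)) (proj (V k) y) (b (V k))" using V_bad[of k] K E_pos by linarith
    then show ?thesis using tuple_nested_mdist[OF V_in W(1) True y] y_W by linarith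
  next
    case False
    \<comment> \<open>Since \<open>V i\<close> is nested in \<open>W\<close>, both have nearly the
      same projection to \<open>V k\<close>. There \<open>y\<close> is near it and the tuple far
      from \<open>y\<close>, hence the tuple is far from the projection of \<open>W\<close>;
      consistency of the tuple decides in favour of \<open>W\<close>.\<close>
    then have tr: "transverse (V k) W" using proj_W by blast
    then have tr': "transverse W (V k)" using transverse_commute[OF V_in W(1)] by blast
    have "i \<noteq> k" using False W by blast
    then have ik: "transverse (V i) (V k)" using chain_transverse i by simp
    then have ki: "transverse (V k) (V i)" using transverse_commute[OF V_in V_in] by blast
    note in_i = proj_in[OF V_in[of i] z(1)] proj_in[OF V_in[of i] y] tuple_in[OF V_in[of i]]
      rho_pt_in[OF V_in V_in disjI2, OF ki]
    note in_k = proj_in[OF V_in[of k] z(1)] proj_in[OF V_in[of k] y] tuple_in[OF V_in[of k]]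
      rho_pt_in[OF V_in V_in disjI2, OF ik] rho_pt_in[OF W(1) V_in disjI2, OF tr']
    have "mdist (C (V i)) (proj (V i) z) (b (V i)) \<le> \<kappa> + 2 * E"
      using chain_near[OF z(1) _ i] z(2) \<kappa>_nonneg E_pos by simp
    moreover have "mdist (C (V i)) (proj (V i) z) (rho_pt (V k) (V i)) \<le> 2 * E"
      using z(3) V_in ki by blast
    moreover have "mdist (C (V i)) (b (V i)) (rho_pt (V k) (V i)) \<le>
        mdist (C (V i)) (b (V i)) (proj (V i) z) + mdist (C (V i)) (proj (V i) z) (rho_pt (V k) (V i))"
      by (simp add: mdist_triangle in_i)
    ultimately have "mdist (C (V i)) (b (V i)) (rho_pt (V k) (V i)) \<le> \<kappa> + 4 * E"
      by (simp add: mdist_commute)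
    moreover have "mdist (C (V i)) (proj (V i) y) (b (V i)) - mdist (C (V i)) (b (V i)) (rho_pt (V k) (V i))
        \<le> mdist (C (V i)) (proj (V i) y) (rho_pt (V k) (V i))"
      by (simp add: mdist_ge_diff in_i)
    ultimately have "mdist (C (V k)) (proj (V k) y) (rho_pt (V i) (V k)) \<le> 2 * E"
      using transverse_rho_pt[OF V_in V_in ik y] V_bad[of i] K by linarith
    moreover have "mdist (C (V k)) (rho_pt (V i) (V k)) (rho_pt W (V k)) \<le> 3 * E"
      using rho_pt_nested[OF V_in W(1) V_in _ tr' _ disjI2, OF _ _ ik] W ki by blast
    moreover have "mdist (C (V k)) (proj (V k) y) (b (V k)) \<le>
        mdist (C (V k)) (proj (V k) y) (rho_pt (V i) (V k)) + mdist (C (V k)) (rho_pt (V i) (V k)) (b (V k))"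
      "mdist (C (V k)) (rho_pt (V i) (V k)) (b (V k)) \<le>
        mdist (C (V k)) (rho_pt (V i) (V k)) (rho_pt W (V k)) + mdist (C (V k)) (rho_pt W (V k)) (b (V k))"
      by (simp_all add: mdist_triangle in_k)
    ultimately have "\<kappa> < mdist (C (V k)) (b (V k)) (rho_pt W (V k))"
      using V_bad[of k] K E_pos by (simp add: mdist_commute)
    then show ?thesis using tuple_transverse[OF V_in W(1) tr] K_pos by linarith
  qed
  have z_W: "mdist (C W) (proj W z) (rho_pt (V k) W) \<le> 2 * E" using z(3)[OF W(1) proj_W] .
  note in_W = proj_in[OF W(1) z(1)] proj_in[OF W(1) y] tuple_in[OF W(1)] rho_pt_in[OF V_in W(1) proj_W]
  have "dpts W y z \<le> mdist (C W) (proj W y) (b W) + mdist (C W) (b W) (proj W z)"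
    "mdist (C W) (b W) (proj W z) \<le>
      mdist (C W) (b W) (rho_pt (V k) W) + mdist (C W) (rho_pt (V k) W) (proj W z)"
    by (simp_all add: mdist_triangle in_W)
  then show ?thesis using y_W b_W z_W by (simp add: mdist_commute)
qed

lemma no_infinite_chain: False
proof -
  obtain S where S: "S \<in> \<SS>" "\<And>U. U \<in> \<SS> \<Longrightarrow> U \<preceq> S" using exists_top V_in by (metis empty_iff)
  define K' where "K' = 2 * K + \<kappa> + 2 * E"
  \<comment> \<open>This is the bound from \<open>card_incomparable_le\<close>; the indices up to
    \<open>k\<close> give \<open>k + 1\<close> distinct domains, one too many.\<close>
  define k where "k = nat \<lfloor>E * K' + E\<rfloor> ^ (complexity - depth S)"
  obtain z where z: "z \<in> mspace M" "\<And>U. U \<in> {V k} \<Longrightarrow> mdist (C U) (proj U z) (b U) \<le> E"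
    "\<And>U W. \<lbrakk>U \<in> {V k}; W \<in> \<SS>; projects U W\<rbrakk> \<Longrightarrow> mdist (C W) (proj W z) (rho_pt U W) \<le> 2 * E"
    by (rule partial_realisation_rho_pt[of "{V k}" b]) (use V_in tuple_in in auto)
  have z_k: "mdist (C (V k)) (proj (V k) z) (b (V k)) \<le> E" using z(2) by simp
  have "card {U \<in> V ` {..k}. U \<preceq> S} \<le> k"
    unfolding k_def
  proof (rule card_incomparable_le[OF y z(1) _ _ _ _ _ _ S(1)])
    show "E \<le> dpts U y z" if "U \<in> V ` {..nat \<lfloor>E * K' + E\<rfloor> ^ (complexity - depth S)}" for U
    proof -
      have "U \<in> V ` {..k}" using that by (simp add: k_def)
      then obtain i where i: "i \<le> k" "U = V i" by auto
      have "mdist (C (V i)) (proj (V i) z) (b (V i)) \<le> \<kappa> + 2 * E"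
        using chain_near[OF z(1) _ i(1)] z_k \<kappa>_nonneg E_pos by simp
      moreover have "mdist (C (V i)) (proj (V i) y) (b (V i)) \<le>
          dpts (V i) y z + mdist (C (V i)) (proj (V i) z) (b (V i))"
        by (simp add: mdist_triangle proj_in V_in y z(1) tuple_in)
      ultimately show ?thesis using V_bad[of i] K E_pos i(2) by simp
    qed
    show "dpts W y z \<le> K'"
      if "U \<in> V ` {..nat \<lfloor>E * K' + E\<rfloor> ^ (complexity - depth S)}" "W \<in> \<SS>" "properly_nested U W" for U W
    proof -
      have "U \<in> V ` {..k}" using that(1) by (simp add: k_def)
      then obtain i where i: "i \<le> k" "U = V i" by auto
      show ?thesis unfolding K'_def
        by (rule chain_above_close[OF z(1) z_k _ i(1) that(2)]) (use z(3) i(2) that(3) in auto)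
    qed
    show "0 \<le> K'" using K \<kappa>_nonneg E_pos by (simp add: K'_def)
    show "U = W" if "U \<in> V ` {..nat \<lfloor>E * K' + E\<rfloor> ^ (complexity - depth S)}"
      "W \<in> V ` {..nat \<lfloor>E * K' + E\<rfloor> ^ (complexity - depth S)}" "U \<preceq> W" for U W
    proof -
      have "U \<in> maximal_bad y K" "W \<in> maximal_bad y K" using that(1,2) V by auto
      from maximal_badD(4)[OF this that(3)] show ?thesis by simp
    qed
  qed (use V_in in auto)
  moreover have "{U \<in> V ` {..k}. U \<preceq> S} = V ` {..k}" using S V_in by auto
  ultimately show False using card_image[OF chain_inj, of k] by simp
qed

end

text \<open>Otherwise every maximal bad domain has a transverse successor in which the tuple is far
  from its projection. Consistency of the tuple turns this into the ordering required of an infinite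
  chain.\<close>

lemma exists_terminal_bad:
  assumes "y \<in> mspace M" "\<kappa> + 6 * E \<le> K" "bad y K \<noteq> {}"
  obtains V where "V \<in> maximal_bad y K"
    "\<And>W. \<lbrakk>W \<in> maximal_bad y K; transverse V W\<rbrakk> \<Longrightarrow> mdist (C W) (b W) (rho_pt V W) \<le> \<kappa>"
proof (rule ccontr)
  assume "\<not> thesis"
  then have "\<forall>V. \<exists>W. V \<in> maximal_bad y K \<longrightarrow> W \<in> maximal_bad y K \<and> transverse V W \<and>
      \<not> mdist (C W) (b W) (rho_pt V W) \<le> \<kappa>" using that by blast
  then obtain f where f: "\<And>V. V \<in> maximal_bad y K \<Longrightarrow> f V \<in> maximal_bad y K \<and> transverse V (f V) \<and>
      \<not> mdist (C (f V)) (b (f V)) (rho_pt V (f V)) \<le> \<kappa>" by metis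
  obtain V0 where V0: "V0 \<in> maximal_bad y K" using assms(3) maximal_bad_above by blast
  define V where "V i = (f ^^ i) V0" for i
  have V: "V i \<in> maximal_bad y K" for i by (induction i) (use V0 f in \<open>auto simp: V_def\<close>)
  have V_Suc: "V (Suc i) = f (V i)" for i by (simp add: V_def)
  have tr: "transverse (V i) (V (Suc i))" for i using f[OF V] by (simp add: V_Suc)
  have "mdist (C (V i)) (b (V i)) (rho_pt (V (Suc i)) (V i)) \<le> \<kappa>" for i
    using tuple_transverse[OF maximal_badD(1)[OF V] maximal_badD(1)[OF V] tr[of i]] f[OF V, of i]
    by (simp add: V_Suc)
  from no_infinite_chain[OF assms(1,2), of V, OF V tr this] show False .
qed

text \<open>Domains above \<open>V\<close> are controlled by maximality. If a transverse
  \<open>W\<close> violated activity, the tuple would be near the projection of \<open>W\<close> in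
  \<open>V\<close>, which places \<open>y\<close> in \<open>W\<close> near the projection of
  \<open>V\<close> and makes \<open>W\<close> bad. A maximal bad \<open>W'\<close> above
  \<open>W\<close> has nearly the same projection to \<open>V\<close>, so the same argument places
  \<open>y\<close> in \<open>W'\<close> near the projection of \<open>V\<close>; by terminality the
  tuple is there too, contradicting that \<open>W'\<close> is bad.\<close>

lemma terminal_bad_active:
  assumes y: "y \<in> mspace M" and K: "\<kappa> + 6 * E \<le> K" "0 \<le> \<kappa>" and V: "V \<in> maximal_bad y K"
    and terminal: "\<And>W. \<lbrakk>W \<in> maximal_bad y K; transverse V W\<rbrakk> \<Longrightarrow> mdist (C W) (b W) (rho_pt V W) \<le> \<kappa>"
  shows "active (K + \<kappa> + 2 * E) b V"
  unfolding active_def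
proof (intro conjI ballI impI)
  note V_in = maximal_badD(1)[OF V] and V_bad = maximal_badD(2)[OF V]
  show "V \<in> \<SS>" using V_in .
  fix W assume W: "W \<in> \<SS>" "projects V W"
  show "mdist (C W) (b W) (rho_pt V W) \<le> K + \<kappa> + 2 * E"
  proof (cases "properly_nested V W")
    case True
    have "\<kappa> < mdist (C V) (proj V y) (b V)" using V_bad K E_pos by linarith
    then show ?thesis
      using tuple_nested_mdist[OF V_in W(1) True y] maximal_badD(3)[OF V W(1) True] E_pos by linarith
  next
    case False
    then have tr: "transverse V W" using W by blast
    then have tr': "transverse W V" using transverse_commute[OF V_in W(1)] by blast
    show ?thesis
    proof (rule ccontr)
      assume neg: "\<not> ?thesis"
      then have near: "mdist (C V) (b V) (rho_pt W V) \<le> \<kappa>"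
        using tuple_transverse[OF V_in W(1) tr] K E_pos by linarith
      have "mdist (C W) (proj W y) (rho_pt V W) \<le> 2 * E"
        by (rule transverse_far[OF V_in W(1) tr y]) (use near V_bad K E_pos in linarith)
      moreover have "mdist (C W) (b W) (rho_pt V W) \<le>
          mdist (C W) (b W) (proj W y) + mdist (C W) (proj W y) (rho_pt V W)"
        by (simp add: mdist_triangle proj_in tuple_in rho_pt_in[OF V_in W] W y)
      ultimately have "W \<in> bad y K" using neg K W(1) by (simp add: bad_def mdist_commute)
      then obtain W' where W': "W' \<in> maximal_bad y K" "W \<preceq> W'" by (rule maximal_bad_above)
      note W'_in = maximal_badD(1)[OF W'(1)]
      have "transverse V W'"
      proof (intro conjI notI)
        assume "orth V W'"
        then have "orth W V" using orth_nest[of W W' V] orth_commute W' W'_in W(1) V_in by blast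
        then show False using tr' by blast
      next
        assume "V \<preceq> W'"
        then have "W' = V" using maximal_badD(4)[OF V W'(1)] by blast
        then show False using tr W' by blast
      next
        assume "W' \<preceq> V"
        then show False using tr nest_transD[of W W' V] W' W'_in W(1) V_in by blast
      qed
      then have W'V: "transverse W' V" using transverse_commute[OF V_in W'_in] by blast
      have b_W': "mdist (C W') (b W') (rho_pt V W') \<le> \<kappa>" using terminal[OF W'(1) \<open>transverse V W'\<close>] .
      have "mdist (C V) (rho_pt W V) (rho_pt W' V) \<le> 3 * E"
        using rho_pt_nested[OF W(1) W'_in V_in W'(2) W'V _ disjI2, OF _ tr'] tr by blast
      moreover have in_V: "proj V y \<in> mspace (C V)" "b V \<in> mspace (C V)" "rho_pt W V \<in> mspace (C V)"
        "rho_pt W' V \<in> mspace (C V)"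
        using proj_in[OF V_in y] tuple_in[OF V_in] rho_pt_in[OF W(1) V_in disjI2, OF tr']
          rho_pt_in[OF W'_in V_in disjI2, OF W'V] by auto
      moreover have "mdist (C V) (proj V y) (b V) \<le> mdist (C V) (proj V y) (rho_pt W' V) + mdist (C V) (rho_pt W' V) (b V)"
        "mdist (C V) (rho_pt W' V) (b V) \<le> mdist (C V) (rho_pt W' V) (rho_pt W V) + mdist (C V) (rho_pt W V) (b V)"
        by (simp_all add: mdist_triangle in_V)
      ultimately have "2 * E < mdist (C V) (proj V y) (rho_pt W' V)"
        using near V_bad K E_pos by (simp add: mdist_commute)
      then have "mdist (C W') (proj W' y) (rho_pt V W') \<le> 2 * E"
        using transverse_rho_pt[OF V_in W'_in \<open>transverse V W'\<close> y] by linarith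
      moreover have "mdist (C W') (proj W' y) (b W') \<le>
          mdist (C W') (proj W' y) (rho_pt V W') + mdist (C W') (rho_pt V W') (b W')"
        by (simp add: mdist_triangle proj_in tuple_in rho_pt_in[OF V_in W'_in disjI2, OF \<open>transverse V W'\<close>] W'_in y)
      ultimately show False using maximal_badD(2)[OF W'(1)] b_W' K E_pos by (simp add: mdist_commute)
    qed
  qed
qed

text \<open>The family is realised by \<open>y\<close>; a terminal bad domain \<open>V\<close> for
  \<open>y\<close> is then exchanged against the member containing it, or added when it is
  orthogonal to all. The progress measure is the sum of the depths.\<close>

lemma active_family_step:
  assumes fin: "finite \<U>" and act: "\<And>U. U \<in> \<U> \<Longrightarrow> active c b U"
    and orth_\<U>: "\<And>U V. \<lbrakk>U \<in> \<U>; V \<in> \<U>; U \<noteq> V\<rbrakk> \<Longrightarrow> orth U V"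
    and c: "\<kappa> + 4 * E \<le> c" and \<kappa>: "0 \<le> \<kappa>"
  obtains (realised) y where "y \<in> mspace M" "\<forall>V\<in>\<SS>. mdist (C V) (proj V y) (b V) \<le> c + 2 * E"
  | (improved) \<U>' where "finite \<U>'" "\<And>U. U \<in> \<U>' \<Longrightarrow> active (c + (\<kappa> + 4 * E)) b U"
    "\<And>U V. \<lbrakk>U \<in> \<U>'; V \<in> \<U>'; U \<noteq> V\<rbrakk> \<Longrightarrow> orth U V" "(\<Sum>U\<in>\<U>. depth U) < (\<Sum>U\<in>\<U>'. depth U)"
proof -
  have sub: "\<U> \<subseteq> \<SS>" using act unfolding active_def by blast
  obtain y where y: "y \<in> mspace M" "\<And>U. U \<in> \<U> \<Longrightarrow> mdist (C U) (proj U y) (b U) \<le> E"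
    "\<And>U W. \<lbrakk>U \<in> \<U>; W \<in> \<SS>; projects U W\<rbrakk> \<Longrightarrow> mdist (C W) (proj W y) (rho_pt U W) \<le> 2 * E"
    by (rule partial_realisation_rho_pt[OF sub orth_\<U> tuple_in]) blast+
  define K where "K = c + 2 * E"
  show thesis
  proof (cases "bad y K = {}")
    case True
    show thesis by (rule realised[OF y(1)]) (use True in \<open>auto simp: bad_def K_def not_less\<close>)
  next
    case False
    have K: "\<kappa> + 6 * E \<le> K" using c by (simp add: K_def)
    obtain V where V: "V \<in> maximal_bad y K"
      "\<And>W. \<lbrakk>W \<in> maximal_bad y K; transverse V W\<rbrakk> \<Longrightarrow> mdist (C W) (b W) (rho_pt V W) \<le> \<kappa>"
      using exists_terminal_bad[OF y(1) K False] by blast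
    note V_in = maximal_badD(1)[OF V(1)] and V_bad = maximal_badD(2)[OF V(1)]
    have act_V: "active (c + (\<kappa> + 4 * E)) b V"
      using terminal_bad_active[OF y(1) K \<kappa> V] by (simp add: K_def algebra_simps)
    \<comment> \<open>In any other position the member \<open>U\<close> projects to
      \<open>V\<close>, and both \<open>y\<close> and the tuple are near this projection, within
      \<open>2 * E\<close> and \<open>c\<close>. This is why the threshold is
      \<open>K = c + 2 * E\<close>.\<close>
    have V_rel: "orth V U \<or> properly_nested V U" if U: "U \<in> \<U>" for U
    proof (rule ccontr)
      assume neg: "\<not> ?thesis"
      have U_in: "U \<in> \<SS>" using sub U by blast
      have "V \<noteq> U" using y(2)[OF U] V_bad c E_pos \<kappa> by (auto simp: K_def)
      then have pr: "projects U V" using neg orth_commute[OF U_in V_in] by blast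
      have "mdist (C V) (b V) (rho_pt U V) \<le> c" using act[OF U] V_in pr unfolding active_def by blast
      moreover have "mdist (C V) (proj V y) (rho_pt U V) \<le> 2 * E" using y(3)[OF U V_in pr] .
      moreover have "mdist (C V) (proj V y) (b V) \<le>
          mdist (C V) (proj V y) (rho_pt U V) + mdist (C V) (rho_pt U V) (b V)"
        by (simp add: mdist_triangle proj_in tuple_in rho_pt_in[OF U_in V_in pr] V_in y(1))
      ultimately show False using V_bad by (simp add: K_def mdist_commute)
    qed
    define \<U>' where "\<U>' = insert V {U \<in> \<U>. orth V U}"
    have V_not_orth: "\<not> orth V V" using orth_irrefl V_in unfolding irreflp_on_def by blast
    have sum': "(\<Sum>U\<in>\<U>'. depth U) = depth V + (\<Sum>U\<in>{U \<in> \<U>. orth V U}. depth U)"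
      unfolding \<U>'_def using fin V_not_orth by (subst sum.insert) auto
    show thesis
    proof (rule improved[of \<U>'])
      show "finite \<U>'" using fin by (simp add: \<U>'_def)
      show "active (c + (\<kappa> + 4 * E)) b U" if "U \<in> \<U>'" for U
      proof (cases "U = V")
        case False
        then have "active c b U" using that act by (auto simp: \<U>'_def)
        then show ?thesis using \<kappa> E_pos unfolding active_def by force
      qed (use act_V in simp)
      show "orth U W" if "U \<in> \<U>'" "W \<in> \<U>'" "U \<noteq> W" for U W
        using that orth_\<U> orth_commute V_in sub unfolding \<U>'_def by blast
      show "(\<Sum>U\<in>\<U>. depth U) < (\<Sum>U\<in>\<U>'. depth U)"
      \<comment> \<open>A domain nested in \<open>U0\<close> is orthogonal to all other members, so
        exactly \<open>U0\<close> is replaced, by a deeper domain; otherwise nothing is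
        discarded.\<close>
      proof (cases "\<exists>U0\<in>\<U>. properly_nested V U0")
        case True
        then obtain U0 where U0: "U0 \<in> \<U>" "properly_nested V U0" by blast
        have "orth V U" if "U \<in> \<U>" "U \<noteq> U0" for U
          using orth_nest[of V U0 U] orth_\<U>[OF U0(1) that(1)] that U0 sub V_in by blast
        moreover have "\<not> orth V U0" using orth_incomparable[of V U0] U0 sub V_in by blast
        ultimately have eq: "{U \<in> \<U>. orth V U} = \<U> - {U0}" by blast
        have "(\<Sum>U\<in>\<U>. depth U) = depth U0 + (\<Sum>U\<in>\<U> - {U0}. depth U)"
          using fin U0(1) by (rule sum.remove)
        then show ?thesis using sum' eq depth_less[of V U0] U0 sub V_in by auto
      next
        case False
        then have "{U \<in> \<U>. orth V U} = \<U>" using V_rel by blast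
        then show ?thesis using sum' depth_ge_1[OF V_in] by simp
      qed
    qed
  qed
qed

text \<open>Pairwise orthogonal families have at most \<open>complexity\<close> members, each of
  depth at most \<open>complexity\<close>, so the measure never exceeds the square. Here
  \<open>n\<close> counts the improvements still possible, each of which worsens the constant by
  \<open>\<kappa> + 4 * E\<close>.\<close>

lemma realise_from_active_family:
  assumes "finite \<U>" "\<And>U. U \<in> \<U> \<Longrightarrow> active c b U" "\<And>U V. \<lbrakk>U \<in> \<U>; V \<in> \<U>; U \<noteq> V\<rbrakk> \<Longrightarrow> orth U V"
    "\<kappa> + 4 * E \<le> c" "0 \<le> \<kappa>" "complexity * complexity \<le> (\<Sum>U\<in>\<U>. depth U) + n"
  shows "\<exists>x\<in>mspace M. \<forall>V\<in>\<SS>. mdist (C V) (proj V x) (b V) \<le> c + 2 * E + real n * (\<kappa> + 4 * E)"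
  using assms
proof (induction n arbitrary: \<U> c)
  case 0
  note prems = 0
  show ?case
  proof (rule active_family_step[OF prems(1-5)])
    show "\<exists>x\<in>mspace M. \<forall>V\<in>\<SS>. mdist (C V) (proj V x) (b V) \<le> c + 2 * E + real 0 * (\<kappa> + 4 * E)"
      if "y \<in> mspace M" "\<forall>V\<in>\<SS>. mdist (C V) (proj V y) (b V) \<le> c + 2 * E" for y
      using that by auto
  next
    fix \<U>' assume \<U>': "finite \<U>'" "\<And>U. U \<in> \<U>' \<Longrightarrow> active (c + (\<kappa> + 4 * E)) b U"
      "\<And>U V. \<lbrakk>U \<in> \<U>'; V \<in> \<U>'; U \<noteq> V\<rbrakk> \<Longrightarrow> orth U V" "(\<Sum>U\<in>\<U>. depth U) < (\<Sum>U\<in>\<U>'. depth U)"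
    have "\<U>' \<subseteq> \<SS>" using \<U>'(2) unfolding active_def by blast
    then have "card \<U>' \<le> complexity" using card_orthogonal \<U>'(1,3) by blast
    then have "(\<Sum>U\<in>\<U>'. depth U) \<le> complexity * complexity"
      using sum_bounded_above[of \<U>' depth complexity] depth_le_complexity
      by (metis mult_le_mono1 of_nat_id order_trans)
    then show "\<exists>x\<in>mspace M. \<forall>V\<in>\<SS>. mdist (C V) (proj V x) (b V) \<le> c + 2 * E + real 0 * (\<kappa> + 4 * E)"
      using \<U>'(4) prems(6) by simp
  qed
next
  case (Suc n)
  note IH = Suc.IH and prems = Suc.prems
  show ?case
  proof (rule active_family_step[OF prems(1-5)])
    show "\<exists>x\<in>mspace M. \<forall>V\<in>\<SS>. mdist (C V) (proj V x) (b V) \<le> c + 2 * E + real (Suc n) * (\<kappa> + 4 * E)"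
      if "y \<in> mspace M" "\<forall>V\<in>\<SS>. mdist (C V) (proj V y) (b V) \<le> c + 2 * E" for y
    proof (intro bexI[OF _ that(1)] ballI)
      fix V assume "V \<in> \<SS>"
      moreover have "0 \<le> real (Suc n) * (\<kappa> + 4 * E)" using prems(5) E_pos by simp
      ultimately show "mdist (C V) (proj V y) (b V) \<le> c + 2 * E + real (Suc n) * (\<kappa> + 4 * E)"
        using that(2) by fastforce
    qed
  next
    fix \<U>' assume \<U>': "finite \<U>'" "\<And>U. U \<in> \<U>' \<Longrightarrow> active (c + (\<kappa> + 4 * E)) b U"
      "\<And>U V. \<lbrakk>U \<in> \<U>'; V \<in> \<U>'; U \<noteq> V\<rbrakk> \<Longrightarrow> orth U V" "(\<Sum>U\<in>\<U>. depth U) < (\<Sum>U\<in>\<U>'. depth U)"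
    have "\<kappa> + 4 * E \<le> c + (\<kappa> + 4 * E)" "complexity * complexity \<le> (\<Sum>U\<in>\<U>'. depth U) + n"
      using prems(4-6) \<U>'(4) E_pos by simp_all
    from IH[OF \<U>'(1-3) this(1) prems(5) this(2)]
    show "\<exists>x\<in>mspace M. \<forall>V\<in>\<SS>. mdist (C V) (proj V x) (b V) \<le> c + 2 * E + real (Suc n) * (\<kappa> + 4 * E)"
      by (simp add: algebra_simps)
  qed
qed

end

theorem realisation:
  assumes "0 \<le> \<kappa>"
  obtains \<theta> where "\<And>b. consistent_tuple \<kappa> b \<Longrightarrow>
    \<exists>x\<in>mspace M. \<forall>V\<in>\<SS>. mdist (C V) (proj V x) (b V) \<le> \<theta>"
proof -
  let ?\<theta> = "(\<kappa> + 4 * E) + 2 * E + real (complexity * complexity) * (\<kappa> + 4 * E)"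
  have "\<exists>x\<in>mspace M. \<forall>V\<in>\<SS>. mdist (C V) (proj V x) (b V) \<le> ?\<theta>" if "consistent_tuple \<kappa> b" for b
    using realise_from_active_family[OF that, of "{}" "\<kappa> + 4 * E" "complexity * complexity"] assms
    by simp
  then show thesis using that by blast
qed

end

section \<open>The Helly property\<close>

lemma gromov_product_self: "w \<in> mspace m \<Longrightarrow> x \<in> mspace m \<Longrightarrow> gromov_product m x x w = mdist m x w"
  by (simp add: gromov_product_def)

text \<open>The point \<open>p\<close> is almost on a geodesic from \<open>a\<close> to
  \<open>v\<close>, and the geodesics from \<open>a\<close> to \<open>x\<close> and to
  \<open>v\<close> have separated by the time they reach \<open>p\<close>. Hence the geodesic from
  \<open>x\<close> to \<open>v\<close> passes near \<open>p\<close>.\<close>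

lemma gromov_product_between:
  assumes hyp: "four_point_hyperbolic m \<delta>" and "0 \<le> \<delta>"
    and in_m: "a \<in> mspace m" "p \<in> mspace m" "v \<in> mspace m" "x \<in> mspace m"
    and xv: "gromov_product m x v a \<le> mdist m a p + t" and av: "gromov_product m a v p \<le> \<delta>"
    and "0 \<le> t"
  shows "gromov_product m x v p \<le> 3 * \<delta> + t"
proof -
  have "gromov_product m a x p \<le> 2 * \<delta> \<or> gromov_product m x v p \<le> 2 * \<delta>"
    using four_point_hyperbolicD[OF hyp in_m(2,1,4,3)] av by linarith
  then show ?thesis
  proof
    assume "gromov_product m a x p \<le> 2 * \<delta>"
    moreover have "gromov_product m x v p =
        gromov_product m a x p + gromov_product m a v p + gromov_product m x v a - mdist m a p"
      by (simp add: gromov_product_def mdist_commute field_simps)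
    ultimately show ?thesis using xv av by linarith
  qed (use assms in linarith)
qed

text \<open>The point is the gate, in the quasiconvex hull of a member of the family which is almost as far
  from \<open>a\<close> as possible.\<close>

lemma exists_farthest_gate:
  assumes hyp: "four_point_hyperbolic m \<delta>" and geo: "geodesic_space m"
    and a: "a \<in> mspace m" and I: "I \<noteq> {}" and sub: "\<And>i. i \<in> I \<Longrightarrow> f i \<subseteq> mspace m"
    and bound: "\<And>i. i \<in> I \<Longrightarrow> \<exists>x\<in>f i. mdist m a x \<le> R"
  obtains i p where "i \<in> I" "p \<in> mspace m"
    "\<And>x. x \<in> f i \<Longrightarrow> gromov_product m a x p \<le> \<delta>"
    "\<And>x y. x \<in> f i \<Longrightarrow> y \<in> f i \<Longrightarrow> mdist m a p \<le> gromov_product m x y a"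
    "\<And>j. j \<in> I \<Longrightarrow> \<exists>x\<in>f j. \<exists>y\<in>f j. gromov_product m x y a \<le> mdist m a p + 2"
proof -
  define G where "G i = (\<lambda>(x, y). gromov_product m x y a) ` (f i \<times> f i)" for i
  \<comment> \<open>Up to the hyperbolicity constant, \<open>D i\<close> is the distance from
    \<open>a\<close> to the hull of \<open>f i\<close>.\<close>
  define D where "D i = Inf (G i)" for i
  have bdd: "bdd_below (G i)" if "i \<in> I" for i
    using sub[OF that] a
    by (intro bdd_belowI[of _ 0]) (auto simp: G_def intro!: gromov_product_nonneg)
  have ne: "G i \<noteq> {}" if "i \<in> I" for i using bound[OF that] by (auto simp: G_def)
  have D_le: "D i \<le> gromov_product m x y a" if "i \<in> I" "x \<in> f i" "y \<in> f i" for i x y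
    unfolding D_def using that by (intro cInf_lower bdd) (auto simp: G_def)
  have D_attained: "\<exists>x\<in>f i. \<exists>y\<in>f i. gromov_product m x y a < D i + 1" if "i \<in> I" for i
    using cInf_lessD[OF ne[OF that], of "D i + 1"] by (auto simp: D_def G_def)
  have D_nonneg: "0 \<le> D i" if "i \<in> I" for i
    unfolding D_def using sub[OF that] a
    by (intro cInf_greatest ne that) (auto simp: G_def intro!: gromov_product_nonneg)
  have "D i \<le> R" if i: "i \<in> I" for i
  proof -
    obtain x where "x \<in> f i" "mdist m a x \<le> R" using bound i by blast
    then show ?thesis using D_le[OF i, of x x] gromov_product_self[OF a, of x] sub[OF i]
      by (auto simp: mdist_commute)
  qed
  then have bddD: "bdd_above (D ` I)" by (intro bdd_aboveI[of _ R]) auto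
  \<comment> \<open>Neither this supremum nor the infima \<open>D j\<close> need be attained. Each
    costs 1, which gives the slack 2 in the conclusion.\<close>
  then obtain i where i: "i \<in> I" "Sup (D ` I) - 1 < D i"
    using less_cSup_iff[of "D ` I" "Sup (D ` I) - 1"] I by auto
  have D_max: "D j \<le> D i + 1" if "j \<in> I" for j
    using cSup_upper[of "D j" "D ` I"] bddD that i by fastforce
  obtain x where x: "x \<in> f i" using bound[OF i(1)] by blast
  have x_in: "x \<in> mspace m" using sub[OF i(1)] x by blast
  obtain A where A: "geodesic_segment m a x A" using geo a x_in unfolding geodesic_space_def by blast
  have "D i \<le> mdist m a x" using D_le[OF i(1) x x] gromov_product_self[OF a x_in]
    by (simp add: mdist_commute)
  then obtain p where p: "p \<in> A" "mdist m a p = D i"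
    using geodesic_segment_point[OF A D_nonneg[OF i(1)]] by blast
  have p_in: "p \<in> mspace m" using p(1) geodesic_segment_subset[OF A] by blast
  have split: "mdist m a p + mdist m p x = mdist m a x" using geodesic_segment_split[OF A p(1)] .
  show thesis
  proof (rule that[OF i(1) p_in])
    fix y assume y: "y \<in> f i"
    have y_in: "y \<in> mspace m" using sub[OF i(1)] y by blast
    have "gromov_product m y x a \<le> gromov_product m y p a + \<delta> \<or>
        gromov_product m x p a \<le> gromov_product m y p a + \<delta>"
      using four_point_hyperbolicD[OF hyp a y_in x_in p_in] .
    moreover have "gromov_product m x p a = mdist m a p"
      using split by (simp add: gromov_product_def mdist_commute field_simps)
    moreover have "mdist m a p \<le> gromov_product m y x a" using D_le[OF i(1) y x] p(2) by simp
    moreover have "gromov_product m a y p = mdist m a p - gromov_product m y p a"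
      by (simp add: gromov_product_def mdist_commute field_simps)
    ultimately show "gromov_product m a y p \<le> \<delta>" by linarith
  next
    fix x y assume "x \<in> f i" "y \<in> f i"
    then show "mdist m a p \<le> gromov_product m x y a" using D_le[OF i(1)] p(2) by simp
  next
    fix j assume j: "j \<in> I"
    obtain x y where "x \<in> f j" "y \<in> f j" "gromov_product m x y a < D j + 1"
      using D_attained[OF j] by blast
    moreover from this have "gromov_product m x y a \<le> mdist m a p + 2"
      using D_max[OF j] p(2) by linarith
    ultimately show "\<exists>x\<in>f j. \<exists>y\<in>f j. gromov_product m x y a \<le> mdist m a p + 2" by blast
  qed
qed

context hierarchically_hyperbolic_space
begin

section \<open>Consistency of the gates chosen in the different domains\<close>

context
  fixes \<L> :: "'a set set" and a :: 'a and p :: "'b \<Rightarrow> 'c" and L :: "'b \<Rightarrow> 'a set"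
  assumes a: "a \<in> mspace M"
    and \<L>_sub: "\<And>A. A \<in> \<L> \<Longrightarrow> A \<subseteq> mspace M"
    and \<L>_meet: "\<And>A B. \<lbrakk>A \<in> \<L>; B \<in> \<L>\<rbrakk> \<Longrightarrow> A \<inter> B \<noteq> {}"
    and L: "\<And>U. U \<in> \<SS> \<Longrightarrow> L U \<in> \<L>" and p: "\<And>U. U \<in> \<SS> \<Longrightarrow> p U \<in> mspace (C U)"
    and gate: "\<And>U x. \<lbrakk>U \<in> \<SS>; x \<in> L U\<rbrakk> \<Longrightarrow>
      gromov_product (C U) (proj U a) (proj U x) (p U) \<le> 4 * E"
    and gate_nearest: "\<And>U x y. \<lbrakk>U \<in> \<SS>; x \<in> L U; y \<in> L U\<rbrakk> \<Longrightarrow>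
      mdist (C U) (proj U a) (p U) \<le> gromov_product (C U) (proj U x) (proj U y) (proj U a)"
    and gate_farthest: "\<And>U A. \<lbrakk>U \<in> \<SS>; A \<in> \<L>\<rbrakk> \<Longrightarrow>
      \<exists>x\<in>A. \<exists>y\<in>A. gromov_product (C U) (proj U x) (proj U y) (proj U a)
        \<le> mdist (C U) (proj U a) (p U) + 2"
begin

lemma L_in: "U \<in> \<SS> \<Longrightarrow> x \<in> L U \<Longrightarrow> x \<in> mspace M"
  using L \<L>_sub by blast

lemma gate_le_mdist: "\<lbrakk>U \<in> \<SS>; x \<in> L U\<rbrakk> \<Longrightarrow> mdist (C U) (proj U a) (p U) \<le> dpts U a x"
  using gate_nearest[of U x x] gromov_product_self[of "proj U a" "C U" "proj U x"]
  by (simp add: proj_in a L_in mdist_commute)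

lemma gate_between:
  "\<lbrakk>U \<in> \<SS>; x \<in> L U\<rbrakk> \<Longrightarrow>
     mdist (C U) (proj U a) (p U) + mdist (C U) (p U) (proj U x) \<le> dpts U a x + 8 * E"
  using gate[of U x] by (simp add: gromov_product_def mdist_commute)

text \<open>This is how maximality is used: a member whose projection is concentrated at
  \<open>q\<close> has its hull near \<open>q\<close>, and no hull is much farther from
  \<open>a\<close> than the gate.\<close>

lemma gate_reach:
  assumes U: "U \<in> \<SS>" and A: "A \<in> \<L>" and q: "q \<in> mspace (C U)"
    and near: "\<And>x. x \<in> A \<Longrightarrow> mdist (C U) (proj U x) q \<le> \<epsilon>"
  shows "mdist (C U) (proj U a) q \<le> mdist (C U) (proj U a) (p U) + 2 + 2 * \<epsilon>"
proof -
  obtain x y where xy: "x \<in> A" "y \<in> A"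
    "gromov_product (C U) (proj U x) (proj U y) (proj U a) \<le> mdist (C U) (proj U a) (p U) + 2"
    using gate_farthest[OF U A] by blast
  have in_U: "proj U x \<in> mspace (C U)" "proj U y \<in> mspace (C U)" "proj U a \<in> mspace (C U)"
    using proj_in[OF U] \<L>_sub[OF A] xy a by blast+
  have "mdist (C U) (proj U a) q \<le> dpts U a x + mdist (C U) (proj U x) q"
    "mdist (C U) (proj U a) q \<le> dpts U a y + mdist (C U) (proj U y) q"
    "dpts U x y \<le> mdist (C U) (proj U x) q + mdist (C U) q (proj U y)"
    by (simp_all add: mdist_triangle in_U q)
  then show ?thesis using near[OF xy(1)] near[OF xy(2)] xy(3)
    by (simp add: gromov_product_def mdist_commute field_simps)
qed

text \<open>If \<open>p U\<close> is far from the projection of \<open>V\<close>, then no point of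
  \<open>L U\<close> is near that projection, since all of \<open>L U\<close> is at least as far
  from \<open>a\<close> as the gate. So all of \<open>L U\<close> sits in \<open>V\<close> at the
  projection of \<open>U\<close>, and \<open>gate_reach\<close> shows that this projection is not
  much farther from \<open>a\<close> than \<open>p V\<close>. As \<open>p V\<close> lies between
  \<open>a\<close> and \<open>v\<close>, which is at the projection too, it is near it.\<close>

lemma gates_transverse_aux:
  assumes UV: "U \<in> \<SS>" "V \<in> \<SS>" "transverse U V" and v: "v \<in> L U \<inter> L V"
    and near: "mdist (C U) (proj U a) (rho_pt V U) \<le> 2 * E" "mdist (C V) (proj V v) (rho_pt U V) \<le> 2 * E"
  shows "mdist (C U) (p U) (rho_pt V U) \<le> 60 * E \<or> mdist (C V) (p V) (rho_pt U V) \<le> 60 * E"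
proof (rule disjCI)
  assume "\<not> mdist (C V) (p V) (rho_pt U V) \<le> 60 * E"
  then have far: "60 * E < mdist (C V) (p V) (rho_pt U V)" by simp
  have tr: "transverse V U" using transverse_commute UV by blast
  note rU = rho_pt_in[OF UV(2,1) disjI2, OF tr] and rV = rho_pt_in[OF UV(1,2) disjI2, OF UV(3)]
  show "mdist (C U) (p U) (rho_pt V U) \<le> 60 * E"
  proof (rule ccontr)
    assume far_U: "\<not> ?thesis"
    have "mdist (C V) (proj V x) (rho_pt U V) \<le> 2 * E" if x: "x \<in> L U" for x
    proof (rule ccontr)
      assume "\<not> ?thesis"
      then have "mdist (C U) (proj U x) (rho_pt V U) \<le> 2 * E"
        using transverse_rho_pt[OF UV L_in[OF UV(1) x]] by blast
      moreover have "dpts U a x \<le> mdist (C U) (proj U a) (rho_pt V U) + mdist (C U) (rho_pt V U) (proj U x)"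
        "mdist (C U) (p U) (rho_pt V U) \<le> mdist (C U) (p U) (proj U a) + mdist (C U) (proj U a) (rho_pt V U)"
        by (simp_all add: mdist_triangle proj_in UV a L_in[OF UV(1) x] rU p)
      ultimately show False using gate_le_mdist[OF UV(1) x] near(1) far_U E_pos
        by (simp add: mdist_commute)
    qed
    from gate_reach[OF UV(2) L[OF UV(1)] rV this]
    have reach: "mdist (C V) (proj V a) (rho_pt U V) \<le> mdist (C V) (proj V a) (p V) + 2 + 2 * (2 * E)" .
    have v_in: "v \<in> mspace M" using v L_in UV by blast
    have btw: "mdist (C V) (proj V a) (p V) + mdist (C V) (p V) (proj V v) \<le> dpts V a v + 8 * E"
      using gate_between[OF UV(2)] v by blast
    have "dpts V a v \<le> mdist (C V) (proj V a) (rho_pt U V) + mdist (C V) (rho_pt U V) (proj V v)"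
      "mdist (C V) (p V) (rho_pt U V) \<le> mdist (C V) (p V) (proj V v) + mdist (C V) (proj V v) (rho_pt U V)"
      by (simp_all add: mdist_triangle proj_in UV a v_in rV p)
    then show False using reach btw near(2) far E_ge_1 by (simp add: mdist_commute)
  qed
qed

text \<open>Each of the points \<open>a\<close> and \<open>v\<close> satisfies one of two
  alternatives. If both choose the same domain, \<open>a\<close> and \<open>v\<close> are close
  there and squeeze the gate between them; the mixed cases are those of
  \<open>gates_transverse_aux\<close>.\<close>

lemma gates_transverse:
  assumes UV: "U \<in> \<SS>" "V \<in> \<SS>" "transverse U V"
  shows "mdist (C U) (p U) (rho_pt V U) \<le> 60 * E \<or> mdist (C V) (p V) (rho_pt U V) \<le> 60 * E"
proof -
  have tr: "transverse V U" using transverse_commute UV by blast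
  obtain v where v: "v \<in> L U \<inter> L V" using \<L>_meet[OF L L] UV by blast
  have v_in: "v \<in> mspace M" using v L_in UV by blast
  have same: "mdist (C W) (p W) r \<le> 60 * E"
    if W: "W \<in> \<SS>" "v \<in> L W" "r \<in> mspace (C W)"
      "mdist (C W) (proj W a) r \<le> 2 * E" "mdist (C W) (proj W v) r \<le> 2 * E" for W r
  proof -
    have "dpts W a v \<le> mdist (C W) (proj W a) r + mdist (C W) r (proj W v)"
      "mdist (C W) (p W) r \<le> mdist (C W) (p W) (proj W a) + mdist (C W) (proj W a) r"
      by (simp_all add: mdist_triangle proj_in W v_in a p)
    then show ?thesis using gate_le_mdist[OF W(1,2)] W(4,5) E_pos by (simp add: mdist_commute)
  qed
  note rU = rho_pt_in[OF UV(2,1) disjI2, OF tr] and rV = rho_pt_in[OF UV(1,2) disjI2, OF UV(3)]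
  from transverse_rho_pt[OF UV a] transverse_rho_pt[OF UV v_in]
  consider "mdist (C U) (proj U a) (rho_pt V U) \<le> 2 * E" "mdist (C U) (proj U v) (rho_pt V U) \<le> 2 * E"
    | "mdist (C U) (proj U a) (rho_pt V U) \<le> 2 * E" "mdist (C V) (proj V v) (rho_pt U V) \<le> 2 * E"
    | "mdist (C V) (proj V a) (rho_pt U V) \<le> 2 * E" "mdist (C U) (proj U v) (rho_pt V U) \<le> 2 * E"
    | "mdist (C V) (proj V a) (rho_pt U V) \<le> 2 * E" "mdist (C V) (proj V v) (rho_pt U V) \<le> 2 * E"
    by linarith
  then show ?thesis
  proof cases
    case 1
    then show ?thesis using same[OF UV(1) _ rU] v by blast
  next
    case 2
    then show ?thesis using gates_transverse_aux[OF UV v] by blast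
  next
    case 3
    then show ?thesis using gates_transverse_aux[OF UV(2,1) tr, of v] v by blast
  next
    case 4
    then show ?thesis using same[OF UV(2) _ rV] v by blast
  qed
qed

lemma gates_nested:
  assumes UV: "U \<in> \<SS>" "V \<in> \<SS>" "properly_nested U V" and z: "z \<in> mspace M"
  shows "gromov_product (C V) (proj V z) (p V) (rho_pt U V) \<le> 60 * E \<or>
    mdist (C U) (proj U z) (p U) \<le> 60 * E"
proof (rule disjCI)
  assume far_z: "\<not> mdist (C U) (proj U z) (p U) \<le> 60 * E"
  define r where "r = rho_pt U V"
  note rV = rho_pt_in[OF UV(1,2) disjI1, OF UV(3), folded r_def]
  note bgi = bounded_geodesic_image_gromov_product[OF UV, folded r_def]
  note hyp = four_point_hyperbolicD[OF four_point[OF UV(2)]]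
  note base = gromov_product_def mdist_commute
  let ?g = "gromov_product (C V)" and ?d = "mdist (C V)"
  obtain v where v: "v \<in> L U" "v \<in> L V" using \<L>_meet[OF L L] UV by blast
  have v_in: "v \<in> mspace M" using v L_in UV by blast
  note in_V = proj_in[OF UV(2) a] proj_in[OF UV(2) z] proj_in[OF UV(2) v_in] p[OF UV(2)] rV
  note in_U = proj_in[OF UV(1) a] proj_in[OF UV(1) z] proj_in[OF UV(1) v_in] p[OF UV(1)]
  show "?g (proj V z) (p V) (rho_pt U V) \<le> 60 * E"
  proof (rule ccontr)
    assume "\<not> ?thesis"
    then have far: "60 * E < ?g (proj V z) (p V) r" by (simp add: r_def)
    show False
    proof (cases "20 * E < ?g (proj V a) (p V) r")
      case True
      \<comment> \<open>The way from \<open>a\<close> to \<open>p V\<close> avoids \<open>r\<close>.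
        Then \<open>z\<close> is close to \<open>a\<close> in \<open>U\<close>, and every point of
        \<open>L U\<close> must lie behind \<open>r\<close> as seen from \<open>a\<close>, since
        otherwise the gate \<open>p U\<close> would be close to \<open>a\<close> and hence to
        \<open>z\<close>. By maximality \<open>p V\<close> is almost as far from \<open>a\<close> as
        \<open>r\<close>; both lie near the way from \<open>a\<close> to \<open>v\<close>, so the
        way to \<open>p V\<close> does pass near \<open>r\<close>.\<close>
      have "16 * E < ?g (proj V z) (proj V a) r"
        using hyp[OF in_V(5,2,4,1)] far True E_pos
        by (simp add: gromov_product_commute) linarith
      then have z_a: "dpts U z a \<le> 3 * E" using bgi[OF z a] E_pos by linarith
      have "?g (proj V a) (proj V x) r \<le> 2 * E" if x: "x \<in> L U" for x
      proof (rule ccontr)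
        assume "\<not> ?thesis"
        then have "dpts U a x \<le> 3 * E" using bgi[OF a L_in[OF UV(1) x]] by blast
        then have "mdist (C U) (proj U a) (p U) \<le> 3 * E" using gate_le_mdist[OF UV(1) x] by linarith
        moreover have "mdist (C U) (proj U z) (p U) \<le> dpts U z a + mdist (C U) (proj U a) (p U)"
          by (simp add: mdist_triangle in_U)
        ultimately show False using z_a far_z E_pos by linarith
      qed
      then have r_near: "?d (proj V a) r - 2 * E \<le> ?g (proj V x) r (proj V a)" if "x \<in> L U" for x
        using that gromov_product_base[of "proj V x" "C V" r "proj V a"] gromov_product_commute
          L_in[OF UV(1) that] in_V proj_in[OF UV(2)] by (metis diff_left_mono)
      obtain x y where xy: "x \<in> L U" "y \<in> L U"
        "?g (proj V x) (proj V y) (proj V a) \<le> ?d (proj V a) (p V) + 2"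
        using gate_farthest[OF UV(2) L[OF UV(1)]] by blast
      have xy_in: "proj V x \<in> mspace (C V)" "proj V y \<in> mspace (C V)"
        using proj_in[OF UV(2)] L_in[OF UV(1)] xy by blast+
      have "?d (proj V a) r - 6 * E \<le> ?d (proj V a) (p V) + 2"
        using hyp[OF in_V(1) xy_in(1) in_V(5) xy_in(2)] r_near[OF xy(1)] r_near[OF xy(2)] xy(3)
        by (simp add: gromov_product_commute) linarith
      moreover have "?g (p V) (proj V v) (proj V a) \<ge> ?d (proj V a) (p V) - 4 * E"
        using gate[OF UV(2) v(2)] by (simp add: base field_simps)
      moreover have "?g (proj V v) r (proj V a) \<ge> ?d (proj V a) r - 2 * E" using r_near[OF v(1)] .
      ultimately have "?d (proj V a) r - 14 * E - 2 \<le> ?g (p V) r (proj V a)"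
        using hyp[OF in_V(1,4,3,5)] E_pos by linarith
      then have "?g (proj V a) (p V) r \<le> 14 * E + 2" by (simp add: base field_simps)
      then show False using True E_ge_1 by linarith
    next
      case False
      \<comment> \<open>The way from \<open>a\<close> to \<open>p V\<close> passes near
        \<open>r\<close>, so all of \<open>L V\<close>, lying beyond \<open>p V\<close>, is on the
        same side of \<open>r\<close> as \<open>z\<close>. Hence \<open>L V\<close> concentrates
        near \<open>z\<close> in \<open>U\<close>; \<open>gate_reach\<close> and the common point
        \<open>v\<close> force \<open>p U\<close> to be near \<open>z\<close>.\<close>
      have near_x: "dpts U x z \<le> 3 * E" if x: "x \<in> L V" for x
      proof -
        have x_in: "x \<in> mspace M" using L_in[OF UV(2) x] .
        note xV = proj_in[OF UV(2) x_in]
        have "60 * E < ?d (p V) r"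
          using far gromov_product_le_mdist[of "p V" "C V" "proj V z" r] in_V
          by (simp add: gromov_product_commute)
        then have "40 * E < ?g (proj V a) r (p V)" using False by (simp add: base field_simps)
        then have "?g r (proj V x) (p V) \<le> 8 * E"
          using hyp[OF in_V(4,1,5) xV] gate[OF UV(2) x] E_pos by linarith
        then have "52 * E \<le> ?g (p V) (proj V x) r" using \<open>60 * E < ?d (p V) r\<close>
          by (simp add: base field_simps)
        then have "48 * E \<le> ?g (proj V z) (proj V x) r"
          using hyp[OF in_V(5,2,4) xV] far E_pos by linarith
        then show ?thesis using bgi[OF z x_in] E_pos by (simp add: mdist_commute)
      qed
      have "mdist (C U) (proj U a) (proj U z) \<le> mdist (C U) (proj U a) (p U) + 2 + 2 * (3 * E)"
        using gate_reach[OF UV(1) L[OF UV(2)] in_U(2) near_x] .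
      moreover have "mdist (C U) (proj U a) (p U) + mdist (C U) (p U) (proj U v) \<le> dpts U a v + 8 * E"
        using gate_between[OF UV(1) v(1)] .
      moreover have "dpts U a v \<le> dpts U a z + dpts U z v"
        "mdist (C U) (proj U z) (p U) \<le> dpts U z v + mdist (C U) (proj U v) (p U)"
        by (simp_all add: mdist_triangle in_U)
      ultimately show False using near_x[OF v(2)] far_z E_ge_1 by (simp add: mdist_commute)
    qed
  qed
qed

lemma gates_consistent: "consistent_tuple (60 * E) p"
  unfolding consistent_tuple_def using p gates_transverse gates_nested by blast

text \<open>Let \<open>v\<close> be common to \<open>A\<close> and \<open>L U\<close>; the gate is
  almost on the way from \<open>a\<close> to \<open>v\<close>. Two points of \<open>A\<close>
  separate, seen from \<open>a\<close>, not much later than the gate, so one of them separates from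
  \<open>v\<close> in time and \<open>gromov_product_between\<close> applies.\<close>

lemma gate_in_hull:
  assumes U: "U \<in> \<SS>" and A: "A \<in> \<L>"
  shows "\<exists>x\<in>A. \<exists>y\<in>A. gromov_product (C U) (proj U x) (proj U y) (p U) \<le> 18 * E"
proof -
  obtain v where v: "v \<in> L U" "v \<in> A" using \<L>_meet[OF L[OF U] A] by blast
  obtain x y where xy: "x \<in> A" "y \<in> A"
    "gromov_product (C U) (proj U x) (proj U y) (proj U a) \<le> mdist (C U) (proj U a) (p U) + 2"
    using gate_farthest[OF U A] by blast
  have in_U: "proj U x \<in> mspace (C U)" "proj U y \<in> mspace (C U)" "proj U a \<in> mspace (C U)"
    "proj U v \<in> mspace (C U)"
    using proj_in[OF U] \<L>_sub[OF A] xy v a by blast+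
  have *: ?thesis if w: "w \<in> A" "proj U w \<in> mspace (C U)"
    "gromov_product (C U) (proj U w) (proj U v) (proj U a) \<le> mdist (C U) (proj U a) (p U) + (2 + 4 * E)" for w
  proof -
    have "gromov_product (C U) (proj U w) (proj U v) (p U) \<le> 3 * (4 * E) + (2 + 4 * E)"
      using gromov_product_between[OF four_point[OF U] _ in_U(3) p[OF U] in_U(4) w(2,3) gate[OF U v(1)]]
        E_pos by simp
    then have "gromov_product (C U) (proj U w) (proj U v) (p U) \<le> 18 * E" using E_ge_1 by linarith
    then show ?thesis using w(1) v(2) by blast
  qed
  from four_point_hyperbolicD[OF four_point[OF U] in_U(3,1,4,2)] show ?thesis
  proof
    assume "gromov_product (C U) (proj U x) (proj U v) (proj U a)
        \<le> gromov_product (C U) (proj U x) (proj U y) (proj U a) + 4 * E"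
    then show ?thesis using *[OF xy(1) in_U(1)] xy(3) by linarith
  next
    assume "gromov_product (C U) (proj U v) (proj U y) (proj U a)
        \<le> gromov_product (C U) (proj U x) (proj U y) (proj U a) + 4 * E"
    then show ?thesis using *[OF xy(2) in_U(2)] xy(3) by (simp add: gromov_product_commute)
  qed
qed

end

text \<open>The family may be infinite. The finite set \<open>P\<close> meeting all members serves
  only to bound the distances of the members from \<open>a\<close> in each single domain, so that a
  farthest hull makes sense; \<open>\<kappa>\<close> does not depend on it.\<close>

theorem helly:
  obtains \<kappa> where "0 \<le> \<kappa>" "\<And>\<L> P. \<lbrakk>\<L> \<noteq> {}; \<And>A. A \<in> \<L> \<Longrightarrow> A \<subseteq> mspace M;
      \<And>A B. \<lbrakk>A \<in> \<L>; B \<in> \<L>\<rbrakk> \<Longrightarrow> A \<inter> B \<noteq> {};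
      finite P; \<And>A. A \<in> \<L> \<Longrightarrow> A \<inter> P \<noteq> {}\<rbrakk> \<Longrightarrow>
    \<exists>z\<in>mspace M. \<forall>U\<in>\<SS>. \<forall>A\<in>\<L>. \<exists>x\<in>A. \<exists>y\<in>A.
      gromov_product (C U) (proj U x) (proj U y) (proj U z) \<le> \<kappa>"
proof -
  obtain \<theta> where \<theta>: "\<And>b. consistent_tuple (60 * E) b \<Longrightarrow>
      \<exists>x\<in>mspace M. \<forall>V\<in>\<SS>. mdist (C V) (proj V x) (b V) \<le> \<theta>"
    using realisation[of "60 * E"] E_pos by auto
  show thesis
  proof (rule that[of "18 * E + max \<theta> 0"])
    show "0 \<le> 18 * E + max \<theta> 0" using E_pos by simp
    fix \<L> P
    assume \<L>: "\<L> \<noteq> {}" "\<And>A. A \<in> \<L> \<Longrightarrow> A \<subseteq> mspace M"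
        "\<And>A B. \<lbrakk>A \<in> \<L>; B \<in> \<L>\<rbrakk> \<Longrightarrow> A \<inter> B \<noteq> {}"
      and P: "finite P" "\<And>A. A \<in> \<L> \<Longrightarrow> A \<inter> P \<noteq> {}"
    obtain A0 where A0: "A0 \<in> \<L>" using \<L>(1) by blast
    obtain a where a: "a \<in> mspace M" using \<L>(2)[OF A0] P(2)[OF A0] by blast
    define centre where "centre U A q \<longleftrightarrow> A \<in> \<L> \<and> q \<in> mspace (C U) \<and>
        (\<forall>x\<in>A. gromov_product (C U) (proj U a) (proj U x) q \<le> 4 * E) \<and>
        (\<forall>x\<in>A. \<forall>y\<in>A. mdist (C U) (proj U a) q \<le> gromov_product (C U) (proj U x) (proj U y) (proj U a)) \<and>
        (\<forall>B\<in>\<L>. \<exists>x\<in>B. \<exists>y\<in>B. gromov_product (C U) (proj U x) (proj U y) (proj U a)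
          \<le> mdist (C U) (proj U a) q + 2)" for U A q
    have "\<exists>A q. centre U A q" if U: "U \<in> \<SS>" for U
    proof -
      have bound: "\<exists>x\<in>proj U ` A. mdist (C U) (proj U a) x \<le> (\<Sum>x\<in>P. dpts U a x)" if A: "A \<in> \<L>" for A
      proof -
        obtain x where "x \<in> A" "x \<in> P" using P(2)[OF A] by blast
        moreover from this have "dpts U a x \<le> (\<Sum>x\<in>P. dpts U a x)"
          using P(1) by (intro member_le_sum) auto
        ultimately show ?thesis by blast
      qed
      have sub: "proj U ` A \<subseteq> mspace (C U)" if "A \<in> \<L>" for A
        using \<L>(2)[OF that] proj_in[OF U] by blast
      obtain A q where "A \<in> \<L>" "q \<in> mspace (C U)"
        "\<And>x. x \<in> proj U ` A \<Longrightarrow> gromov_product (C U) (proj U a) x q \<le> 4 * E"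
        "\<And>x y. x \<in> proj U ` A \<Longrightarrow> y \<in> proj U ` A \<Longrightarrow>
          mdist (C U) (proj U a) q \<le> gromov_product (C U) x y (proj U a)"
        "\<And>B. B \<in> \<L> \<Longrightarrow> \<exists>x\<in>proj U ` B. \<exists>y\<in>proj U ` B.
          gromov_product (C U) x y (proj U a) \<le> mdist (C U) (proj U a) q + 2"
        by (rule exists_farthest_gate[where f = "\<lambda>A. proj U ` A",
              OF four_point[OF U] geodesic[OF U] proj_in[OF U a] \<L>(1) sub bound]) blast+
      then have "centre U A q" unfolding centre_def by blast
      then show ?thesis by blast
    qed
    then obtain L p where Lp: "\<And>U. U \<in> \<SS> \<Longrightarrow> centre U (L U) (p U)" by metis
    note facts = a \<L>(2,3)
    have centre_facts: "\<And>U. U \<in> \<SS> \<Longrightarrow> L U \<in> \<L>" "\<And>U. U \<in> \<SS> \<Longrightarrow> p U \<in> mspace (C U)"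
      "\<And>U x. \<lbrakk>U \<in> \<SS>; x \<in> L U\<rbrakk> \<Longrightarrow> gromov_product (C U) (proj U a) (proj U x) (p U) \<le> 4 * E"
      "\<And>U x y. \<lbrakk>U \<in> \<SS>; x \<in> L U; y \<in> L U\<rbrakk> \<Longrightarrow>
        mdist (C U) (proj U a) (p U) \<le> gromov_product (C U) (proj U x) (proj U y) (proj U a)"
      "\<And>U A. \<lbrakk>U \<in> \<SS>; A \<in> \<L>\<rbrakk> \<Longrightarrow>
        \<exists>x\<in>A. \<exists>y\<in>A. gromov_product (C U) (proj U x) (proj U y) (proj U a)
          \<le> mdist (C U) (proj U a) (p U) + 2"
      using Lp unfolding centre_def by simp_all
    have "consistent_tuple (60 * E) p"
      by (rule gates_consistent[where \<L> = \<L> and a = a and p = p and L = L])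
        (fact facts centre_facts)+
    then obtain z where z: "z \<in> mspace M" "\<And>V. V \<in> \<SS> \<Longrightarrow> mdist (C V) (proj V z) (p V) \<le> \<theta>"
      using \<theta> by blast
    have hull: "\<exists>x\<in>A. \<exists>y\<in>A. gromov_product (C U) (proj U x) (proj U y) (p U) \<le> 18 * E"
      if "U \<in> \<SS>" "A \<in> \<L>" for U A
      by (rule gate_in_hull[where \<L> = \<L> and a = a and p = p and L = L])
        (fact facts centre_facts that)+
    show "\<exists>z\<in>mspace M. \<forall>U\<in>\<SS>. \<forall>A\<in>\<L>. \<exists>x\<in>A. \<exists>y\<in>A.
      gromov_product (C U) (proj U x) (proj U y) (proj U z) \<le> 18 * E + max \<theta> 0"
    proof (intro bexI[OF _ z(1)] ballI)
      fix U A assume U: "U \<in> \<SS>" and A: "A \<in> \<L>"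
      obtain x y where xy: "x \<in> A" "y \<in> A" "gromov_product (C U) (proj U x) (proj U y) (p U) \<le> 18 * E"
        using hull[OF U A] by blast
      have xy_in: "x \<in> mspace M" "y \<in> mspace M" using xy \<L>(2)[OF A] by auto
      have "mdist (C U) (proj U x) (proj U z) \<le> mdist (C U) (proj U x) (p U) + mdist (C U) (p U) (proj U z)"
        "mdist (C U) (proj U y) (proj U z) \<le> mdist (C U) (proj U y) (p U) + mdist (C U) (p U) (proj U z)"
        by (simp_all add: mdist_triangle proj_in U xy_in z(1) centre_facts(2))
      then have "gromov_product (C U) (proj U x) (proj U y) (proj U z) \<le> 18 * E + max \<theta> 0"
        using xy(3) z(2)[OF U] by (simp add: gromov_product_def mdist_commute field_simps)
      then show "\<exists>x\<in>A. \<exists>y\<in>A. gromov_product (C U) (proj U x) (proj U y) (proj U z) \<le> 18 * E + max \<theta> 0"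
        using xy(1,2) by blast
    qed
  qed
qed

end

section \<open>Spaces with walls\<close>

text \<open>A wall is a pair of disjoint sides which need not cover the space. Consecutive walls of a chain
  are required to overlap so much that the far side of one and the near side of the next cover the
  space.\<close>

locale wall_space =
  fixes \<Omega> :: "'x set" and walls :: "('x set \<times> 'x set) set"
  assumes wall_subset: "(A, B) \<in> walls \<Longrightarrow> A \<subseteq> \<Omega>"
    and wall_disjoint: "(A, B) \<in> walls \<Longrightarrow> A \<inter> B = {}"
    and wall_swap: "(A, B) \<in> walls \<Longrightarrow> (B, A) \<in> walls"
begin

inductive chain :: "'x \<Rightarrow> nat \<Rightarrow> 'x set \<Rightarrow> 'x set \<Rightarrow> bool" for x where
  single: "(A, B) \<in> walls \<Longrightarrow> x \<in> A \<Longrightarrow> chain x 1 A B"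
| step: "chain x n A B \<Longrightarrow> (A', B') \<in> walls \<Longrightarrow> \<Omega> \<subseteq> B \<union> A' \<Longrightarrow> chain x (Suc n) A' B'"

definition separated :: "nat \<Rightarrow> 'x \<Rightarrow> 'x \<Rightarrow> bool" where
  "separated n x y \<longleftrightarrow> n = 0 \<or> (\<exists>A B. chain x n A B \<and> y \<in> B)"

lemma chain_wall: "chain x n A B \<Longrightarrow> (A, B) \<in> walls"
  by (induction rule: chain.induct) auto

lemma chain_start: "chain x n A B \<Longrightarrow> x \<in> \<Omega> \<Longrightarrow> x \<in> A"
  by (induction rule: chain.induct) (use wall_disjoint chain_wall in blast)+

text \<open>The walls of the chain issuing from \<open>y\<close> are swapped and appended one at a
  time, starting with its last wall.\<close>

lemma chain_join:
  assumes "chain y k A' B'" "chain x m A B" "\<Omega> \<subseteq> B \<union> B'"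
  shows "separated (m + k) x y"
  using assms
proof (induction arbitrary: m A B rule: chain.induct)
  case (single A' B')
  have "chain x (Suc m) B' A'"
    using chain.step[OF single(3) wall_swap[OF single(1)] single(4)] .
  then show ?case using single(2) by (auto simp: separated_def)
next
  case (step n A'' B'' A' B')
  have "chain x (Suc m) B' A'"
    using chain.step[OF step.prems(1) wall_swap[OF step.hyps(2)] step.prems(2)] .
  from step.IH[OF this] step.hyps(3) show ?case by (simp add: Un_commute)
qed

text \<open>The far sides of the last walls need not cover the space, but those of the walls before
  them do. Dropping the last wall of each chain makes the two fit together.\<close>

lemma separated_if_disjoint:
  assumes "chain x (Suc (Suc m)) A B" "chain y (Suc (Suc k)) A' B'" "A \<inter> A' = {}"
  shows "separated (Suc m + Suc k) x y"
proof -
  obtain A0 B0 where 0: "chain x (Suc m) A0 B0" "\<Omega> \<subseteq> B0 \<union> A"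
    using assms(1) by (cases rule: chain.cases) auto
  obtain A1 B1 where 1: "chain y (Suc k) A1 B1" "\<Omega> \<subseteq> B1 \<union> A'"
    using assms(2) by (cases rule: chain.cases) auto
  have "\<Omega> \<subseteq> B0 \<union> B1" using 0(2) 1(2) assms(3) by blast
  from chain_join[OF 1(1) 0(1) this] show ?thesis .
qed

lemma separated_sym:
  assumes "separated n x y" shows "separated n y x"
proof (cases "n = 0")
  case False
  then obtain A B where AB: "chain x n A B" "y \<in> B" using assms by (auto simp: separated_def)
  have y: "chain y 1 B A" using chain.single[OF wall_swap[OF chain_wall[OF AB(1)]] AB(2)] .
  show ?thesis using AB(1)
  proof (cases rule: chain.cases)
    case single
    then show ?thesis using y by (auto simp: separated_def)
  next
    case (step m A0 B0)
    have "\<Omega> \<subseteq> A \<union> B0" using step by blast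
    from chain_join[OF step(2) y this] show ?thesis using step(1) by simp
  qed
qed (simp add: separated_def)

lemma separated_self: "\<lbrakk>separated n x x; x \<in> \<Omega>\<rbrakk> \<Longrightarrow> n = 0"
  unfolding separated_def using chain_start chain_wall wall_disjoint by blast

text \<open>Following the chain, a point lies beyond a wall or else on the near side of the next
  one. Only one wall can be lost, the one in whose gap \<open>y\<close> may lie.\<close>

lemma chain_split:
  assumes "chain x n A B" "y \<in> \<Omega>"
  shows "\<exists>i j. separated i x y \<and> (j = 0 \<or> chain y j A B) \<and> n \<le> i + j + 1"
  using assms(1)
proof (induction rule: chain.induct)
  case (single A B)
  show ?case by (rule exI[of _ 0], rule exI[of _ 0]) (simp add: separated_def)
next
  case (step n A B A' B')
  show ?case
  proof (cases "y \<in> B")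
    case True
    then have "separated n x y" using step.hyps(1) by (auto simp: separated_def)
    then show ?thesis by (intro exI[of _ n] exI[of _ 0]) simp
  next
    case False
    then have y: "y \<in> A'" using step.hyps(3) assms(2) by blast
    obtain i j where ij: "separated i x y" "j = 0 \<or> chain y j A B" "n \<le> i + j + 1"
      using step.IH by blast
    have "chain y (Suc j) A' B'"
      using ij(2) chain.single[OF step.hyps(2) y] chain.step[OF _ step.hyps(2,3), of y j] by auto
    then show ?thesis using ij(1,3) by (intro exI[of _ i] exI[of _ "Suc j"]) simp
  qed
qed

lemma separated_split:
  assumes "separated n x z" "y \<in> \<Omega>"
  shows "\<exists>i j. separated i x y \<and> separated j y z \<and> n \<le> i + j + 1"
proof (cases "n = 0")
  case True
  then show ?thesis by (intro exI[of _ 0]) (simp add: separated_def)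
next
  case False
  then obtain A B where AB: "chain x n A B" "z \<in> B" using assms(1) by (auto simp: separated_def)
  from chain_split[OF this(1) assms(2)] obtain i j where
    ij: "separated i x y" "j = 0 \<or> chain y j A B" "n \<le> i + j + 1" by blast
  then have "separated j y z" using AB(2) by (auto simp: separated_def)
  then show ?thesis using ij by blast
qed

text \<open>Going backwards from the far side of a wall, one step leaves this side without reaching
  the near side, hence stays on the far side of the previous wall. So each wall costs at least one
  step.\<close>

lemma chain_le_path_length:
  assumes "chain x n A B" "x \<in> \<Omega>" and path: "f 0 = x" "\<And>i. f i \<in> \<Omega>"
    and no_jump: "\<And>i A B. (A, B) \<in> walls \<Longrightarrow> f i \<in> A \<Longrightarrow> f (Suc i) \<notin> B" and "f k \<in> B"
  shows "n \<le> k"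
  using assms(1,6)
proof (induction arbitrary: k rule: chain.induct)
  case (single A B)
  then have "f k \<noteq> x" using wall_disjoint by blast
  then show ?case using path(1) by (cases k) auto
next
  case (step n A B A' B')
  have "x \<in> A'" using chain_start[OF chain.step[OF step.hyps] assms(2)] .
  then have "f k \<noteq> x" using wall_disjoint[OF step.hyps(2)] step.prems by blast
  then obtain l where l: "k = Suc l" using path(1) by (cases k) auto
  then have "f l \<notin> A'" using no_jump[OF step.hyps(2), of l] step.prems by blast
  then have "f l \<in> B" using step.hyps(3) path(2) by blast
  then show ?case using step.IH l by simp
qed

end

text \<open>The common point is only required to avoid the far sides: a point in the coarse hull of
  a near side may overrun it, and the gap of the wall has to absorb this.\<close>

locale helly_wall_space = wall_space +
  assumes separated_bounded: "x \<in> \<Omega> \<Longrightarrow> y \<in> \<Omega> \<Longrightarrow> \<exists>m. \<forall>n. separated n x y \<longrightarrow> n \<le> m"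
    and helly_walls: "\<lbrakk>\<F> \<subseteq> walls; \<F> \<noteq> {}; \<And>A B A' B'. \<lbrakk>(A, B) \<in> \<F>; (A', B') \<in> \<F>\<rbrakk> \<Longrightarrow> A \<inter> A' \<noteq> {};
        finite P; \<And>A B. (A, B) \<in> \<F> \<Longrightarrow> A \<inter> P \<noteq> {}\<rbrakk> \<Longrightarrow> \<exists>z\<in>\<Omega>. \<forall>(A, B)\<in>\<F>. z \<notin> B"
begin

definition wall_number :: "'a \<Rightarrow> 'a \<Rightarrow> nat" where
  "wall_number x y = Max {n. separated n x y}"

text \<open>The summand 1 makes the triangle inequality hold exactly; in exchange the distance of a
  point to itself is 1.\<close>

definition wall_dist :: "'a \<Rightarrow> 'a \<Rightarrow> real" where
  "wall_dist x y = real (wall_number x y) + 1"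

lemma finite_separated: "x \<in> \<Omega> \<Longrightarrow> y \<in> \<Omega> \<Longrightarrow> finite {n. separated n x y}"
  using separated_bounded[of x y] finite_nat_set_iff_bounded_le[of "{n. separated n x y}"] by blast

lemma le_wall_number: "\<lbrakk>x \<in> \<Omega>; y \<in> \<Omega>; separated n x y\<rbrakk> \<Longrightarrow> n \<le> wall_number x y"
  unfolding wall_number_def using finite_separated by (intro Max_ge) auto

lemma separated_wall_number:
  assumes "x \<in> \<Omega>" "y \<in> \<Omega>" shows "separated (wall_number x y) x y"
proof -
  have "separated 0 x y" by (simp add: separated_def)
  then have "{n. separated n x y} \<noteq> {}" by blast
  from Max_in[OF finite_separated[OF assms] this] show ?thesis by (simp add: wall_number_def)
qed

lemma wall_dist_sym: "\<lbrakk>x \<in> \<Omega>; y \<in> \<Omega>\<rbrakk> \<Longrightarrow> wall_dist x y = wall_dist y x"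
  using separated_sym by (simp add: wall_dist_def wall_number_def) metis

lemma wall_dist_self: "x \<in> \<Omega> \<Longrightarrow> wall_dist x x = 1"
  using separated_self[OF separated_wall_number] by (simp add: wall_dist_def)

lemma wall_dist_nonneg: "0 \<le> wall_dist x y"
  by (simp add: wall_dist_def)

lemma wall_dist_triangle:
  assumes "x \<in> \<Omega>" "y \<in> \<Omega>" "z \<in> \<Omega>"
  shows "wall_dist x z \<le> wall_dist x y + wall_dist y z"
proof -
  obtain i j where "separated i x y" "separated j y z" "wall_number x z \<le> i + j + 1"
    using separated_split[OF separated_wall_number[OF assms(1,3)] assms(2)] by blast
  then show ?thesis using le_wall_number[of x y i] le_wall_number[of y z j] assms
    by (simp add: wall_dist_def)
qed

text \<open>The ball about \<open>x\<close> is encoded by the near sides of all chains of length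
  \<open>l x + 2\<close> from \<open>x\<close>. Disjoint near sides for \<open>x\<close> and
  \<open>y\<close> would give \<open>l x + l y + 2\<close> separating walls, hence a distance above
  \<open>r x + r y\<close>. A point avoiding the far sides is separated from \<open>x\<close> by at
  most \<open>l x + 1\<close> walls; the summand 1 in \<open>wall_dist\<close> and the rounding in
  \<open>l\<close> make up the 3.\<close>

lemma wall_dist_helly:
  assumes P: "finite P" "P \<subseteq> \<Omega>" "P \<noteq> {}"
    and r: "\<And>x y. \<lbrakk>x \<in> P; y \<in> P\<rbrakk> \<Longrightarrow> wall_dist x y \<le> r x + r y"
  shows "\<exists>z\<in>\<Omega>. \<forall>x\<in>P. wall_dist z x \<le> r x + 3"
proof -
  define l where "l x = nat \<lceil>r x\<rceil>" for x
  define \<F> where "\<F> = {(A, B). \<exists>x\<in>P. chain x (Suc (Suc (l x))) A B}"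
  have r_nonneg: "0 \<le> r x" if "x \<in> P" for x
    using r[OF that that] wall_dist_nonneg[of x x] by simp
  have r_le: "r x \<le> real (l x)" "real (l x) \<le> r x + 1" if "x \<in> P" for x
    using r_nonneg[OF that] unfolding l_def by linarith+
  have "\<exists>z\<in>\<Omega>. \<forall>(A, B)\<in>\<F>. z \<notin> B"
  proof (cases "\<F> = {}")
    case True
    then show ?thesis using P by blast
  next
    case False
    show ?thesis
    proof (rule helly_walls[OF _ False _ P(1)])
      show "\<F> \<subseteq> walls" using chain_wall by (auto simp: \<F>_def)
      show "A \<inter> P \<noteq> {}" if "(A, B) \<in> \<F>" for A B
        using that chain_start P(2) unfolding \<F>_def by blast
      show "A \<inter> A' \<noteq> {}" if AB: "(A, B) \<in> \<F>" "(A', B') \<in> \<F>" for A B A' B'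
      proof
        assume disj: "A \<inter> A' = {}"
        obtain x y where xy: "x \<in> P" "y \<in> P" "chain x (Suc (Suc (l x))) A B"
          "chain y (Suc (Suc (l y))) A' B'" using AB by (auto simp: \<F>_def)
        have "Suc (l x) + Suc (l y) \<le> wall_number x y"
          using le_wall_number[OF _ _ separated_if_disjoint[OF xy(3,4) disj]] xy P(2) by blast
        then have "real (l x) + real (l y) + 3 \<le> wall_dist x y"
          unfolding wall_dist_def by linarith
        then show False using r[OF xy(1,2)] r_le[OF xy(1)] r_le[OF xy(2)] by linarith
      qed
    qed
  qed
  then obtain z where z: "z \<in> \<Omega>" "\<And>A B. (A, B) \<in> \<F> \<Longrightarrow> z \<notin> B" by blast
  have "wall_dist z x \<le> r x + 3" if x: "x \<in> P" for x
  proof -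
    have xX: "x \<in> \<Omega>" using x P(2) by blast
    have "wall_number x z < Suc (Suc (l x))"
    proof (rule ccontr)
      assume "\<not> ?thesis"
      then obtain k where k: "wall_number x z = Suc (Suc (l x)) + k"
        by (metis le_add_diff_inverse not_less)
      \<comment> \<open>Truncation: a point beyond the last wall is not on its near side, so it is
        beyond the previous wall.\<close>
      have *: "chain x (Suc m + k) A B \<Longrightarrow> w \<in> B \<Longrightarrow> w \<in> \<Omega> \<Longrightarrow> \<exists>A B. chain x (Suc m) A B \<and> w \<in> B"
        for m A B w
      proof (induction k arbitrary: A B)
        case (Suc k)
        obtain A0 B0 where "chain x (Suc m + k) A0 B0" "\<Omega> \<subseteq> B0 \<union> A" "(A, B) \<in> walls"
          using Suc.prems(1) by (cases rule: chain.cases) auto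
        then show ?case using Suc.IH[of A0 B0] Suc.prems(2,3) wall_disjoint by blast
      qed auto
      obtain A B where "chain x (Suc (Suc (l x)) + k) A B" "z \<in> B"
        using separated_wall_number[OF xX z(1)] k by (auto simp: separated_def)
      then have "\<exists>A B. chain x (Suc (Suc (l x))) A B \<and> z \<in> B" using * z(1) by blast
      then show False using z(2) x by (auto simp: \<F>_def)
    qed
    then have "wall_dist x z \<le> real (l x) + 2" by (simp add: wall_dist_def)
    then show ?thesis using r_le[OF x] wall_dist_sym[OF z(1) xX] by linarith
  qed
  then show ?thesis using z(1) by blast
qed

end

section \<open>Coarse injectivity and the injective hull\<close>

locale coarsely_injective =
  fixes \<Omega> :: "'x set" and D :: "'x \<Rightarrow> 'x \<Rightarrow> real"
  assumes D_nonneg: "0 \<le> D x y" and D_self: "x \<in> \<Omega> \<Longrightarrow> D x x \<le> 1"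
    and D_sym: "x \<in> \<Omega> \<Longrightarrow> y \<in> \<Omega> \<Longrightarrow> D x y = D y x"
    and D_triangle: "x \<in> \<Omega> \<Longrightarrow> y \<in> \<Omega> \<Longrightarrow> z \<in> \<Omega> \<Longrightarrow> D x z \<le> D x y + D y z"
    and finite_balls: "x \<in> \<Omega> \<Longrightarrow> finite {y \<in> \<Omega>. D x y \<le> R}"
    and finite_helly: "\<lbrakk>finite P; P \<subseteq> \<Omega>; P \<noteq> {}; \<And>x y. \<lbrakk>x \<in> P; y \<in> P\<rbrakk> \<Longrightarrow> D x y \<le> r x + r y\<rbrakk> \<Longrightarrow>
      \<exists>z\<in>\<Omega>. \<forall>x\<in>P. D z x \<le> r x + 3"
begin

definition radius_function :: "('x \<Rightarrow> real) \<Rightarrow> bool" where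
  "radius_function f \<longleftrightarrow> (\<forall>x\<in>\<Omega>. \<forall>y\<in>\<Omega>. D x y \<le> f x + f y)"

text \<open>For a metric, the radius functions equal to their conjugate are the extremal ones, i.e.
  the points of the injective hull.\<close>

definition conj_fun :: "('x \<Rightarrow> real) \<Rightarrow> 'x \<Rightarrow> real" where
  "conj_fun f x = (SUP y\<in>\<Omega>. D x y - f y)"

definition mid_fun :: "('x \<Rightarrow> real) \<Rightarrow> 'x \<Rightarrow> real" where
  "mid_fun f x = (f x + conj_fun f x) / 2"

text \<open>The canonical 1-Lipschitz retraction of the radius functions onto the extremal ones,
  i.e. onto the injective hull.\<close>

definition hull_fun :: "('x \<Rightarrow> real) \<Rightarrow> 'x \<Rightarrow> real" where
  "hull_fun f x = lim (\<lambda>n. (mid_fun ^^ n) f x)"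

lemma radius_functionD: "radius_function f \<Longrightarrow> x \<in> \<Omega> \<Longrightarrow> y \<in> \<Omega> \<Longrightarrow> D x y \<le> f x + f y"
  by (simp add: radius_function_def)

lemma radius_function_nonneg: "radius_function f \<Longrightarrow> x \<in> \<Omega> \<Longrightarrow> 0 \<le> f x"
  using radius_functionD[of f x x] D_nonneg[of x x] by simp

lemma bdd_conj: "radius_function f \<Longrightarrow> x \<in> \<Omega> \<Longrightarrow> bdd_above ((\<lambda>y. D x y - f y) ` \<Omega>)"
  using radius_functionD[of f x] by (intro bdd_aboveI[of _ "f x"]) (auto simp: algebra_simps)

lemma conj_fun_ge: "\<lbrakk>radius_function f; x \<in> \<Omega>; y \<in> \<Omega>\<rbrakk> \<Longrightarrow> D x y - f y \<le> conj_fun f x"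
  unfolding conj_fun_def using bdd_conj by (intro cSup_upper) auto

lemma conj_fun_leI: "\<lbrakk>x \<in> \<Omega>; \<And>y. y \<in> \<Omega> \<Longrightarrow> D x y - f y \<le> c\<rbrakk> \<Longrightarrow> conj_fun f x \<le> c"
  unfolding conj_fun_def by (intro cSup_least) auto

lemma conj_fun_le: "radius_function f \<Longrightarrow> x \<in> \<Omega> \<Longrightarrow> conj_fun f x \<le> f x"
  using radius_functionD[of f x] by (intro conj_fun_leI) (auto simp: algebra_simps)

lemma mid_fun_le: "radius_function f \<Longrightarrow> x \<in> \<Omega> \<Longrightarrow> mid_fun f x \<le> f x"
  using conj_fun_le[of f x] by (simp add: mid_fun_def)

text \<open>The conjugate alone may fail to be a radius function, but \<open>f\<close> at one point
  and the conjugate at the other always dominate the distance; the two such inequalities are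
  averaged.\<close>

lemma radius_function_mid: "radius_function f \<Longrightarrow> radius_function (mid_fun f)"
  unfolding radius_function_def[of "mid_fun f"]
proof (intro ballI)
  fix x y assume "radius_function f" "x \<in> \<Omega>" "y \<in> \<Omega>"
  then show "D x y \<le> mid_fun f x + mid_fun f y"
    using conj_fun_ge[of f x y] conj_fun_ge[of f y x] D_sym[of x y]
    by (simp add: mid_fun_def field_simps)
qed

lemma radius_function_iter: "radius_function f \<Longrightarrow> radius_function ((mid_fun ^^ n) f)"
  by (induction n) (auto intro: radius_function_mid)

lemma conj_fun_mono_add:
  assumes "radius_function g" "x \<in> \<Omega>" "\<And>y. y \<in> \<Omega> \<Longrightarrow> g y \<le> f y + c"
  shows "conj_fun f x \<le> conj_fun g x + c"
proof (rule conj_fun_leI[OF assms(2)])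
  fix y assume y: "y \<in> \<Omega>"
  show "D x y - f y \<le> conj_fun g x + c"
    using conj_fun_ge[OF assms(1,2) y] assms(3)[OF y] by linarith
qed

lemma mid_fun_Lipschitz:
  assumes "radius_function f" "radius_function g" "\<And>y. y \<in> \<Omega> \<Longrightarrow> \<bar>f y - g y\<bar> \<le> c" "x \<in> \<Omega>"
  shows "\<bar>mid_fun f x - mid_fun g x\<bar> \<le> c"
proof -
  have "f y \<le> g y + c \<and> g y \<le> f y + c" if "y \<in> \<Omega>" for y using assms(3)[OF that] by linarith
  then have "conj_fun f x \<le> conj_fun g x + c" "conj_fun g x \<le> conj_fun f x + c"
    using conj_fun_mono_add[OF assms(2,4)] conj_fun_mono_add[OF assms(1,4)] by blast+
  then show ?thesis using assms(3)[OF assms(4)] by (simp add: mid_fun_def abs_le_iff field_simps)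
qed

lemma iter_Lipschitz:
  assumes "radius_function f" "radius_function g" "\<And>y. y \<in> \<Omega> \<Longrightarrow> \<bar>f y - g y\<bar> \<le> c" "x \<in> \<Omega>"
  shows "\<bar>(mid_fun ^^ n) f x - (mid_fun ^^ n) g x\<bar> \<le> c"
  using assms(4)
proof (induction n arbitrary: x)
  case (Suc n)
  then show ?case
    using mid_fun_Lipschitz[OF radius_function_iter[OF assms(1)] radius_function_iter[OF assms(2)]]
    by simp
qed (use assms(3) in simp)

text \<open>Conjugation reverses order, so lowering \<open>f\<close> raises its conjugate, and
  averaging at least halves the gap between them.\<close>

lemma iter_gap:
  assumes "radius_function f" "x \<in> \<Omega>"
  shows "(mid_fun ^^ n) f x - conj_fun ((mid_fun ^^ n) f) x \<le> (f x - conj_fun f x) / 2 ^ n"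
proof (induction n)
  case (Suc n)
  let ?g = "(mid_fun ^^ n) f"
  note g = radius_function_iter[OF assms(1), of n]
  have "conj_fun ?g x \<le> conj_fun (mid_fun ?g) x"
    using conj_fun_mono_add[OF radius_function_mid[OF g] assms(2), of ?g 0] mid_fun_le[OF g] by simp
  then have "mid_fun ?g x - conj_fun (mid_fun ?g) x \<le> (?g x - conj_fun ?g x) / 2"
    by (simp add: mid_fun_def field_simps)
  also have "\<dots> \<le> (f x - conj_fun f x) / 2 ^ n / 2" using Suc by (rule divide_right_mono) simp
  also have "\<dots> = (f x - conj_fun f x) / 2 ^ Suc n" by simp
  finally show ?case by simp
qed simp

lemma decseq_iter: "radius_function f \<Longrightarrow> x \<in> \<Omega> \<Longrightarrow> decseq (\<lambda>n. (mid_fun ^^ n) f x)"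
  using mid_fun_le[OF radius_function_iter] by (intro decseq_SucI) simp

lemma iter_LIMSEQ:
  assumes "radius_function f" "x \<in> \<Omega>"
  shows "(\<lambda>n. (mid_fun ^^ n) f x) \<longlonglongrightarrow> hull_fun f x"
proof -
  have "\<forall>n. 0 \<le> (mid_fun ^^ n) f x" using radius_function_nonneg[OF radius_function_iter] assms by blast
  then have "convergent (\<lambda>n. (mid_fun ^^ n) f x)"
    using decseq_convergent[OF decseq_iter[OF assms]] by (metis convergentI)
  then show ?thesis by (simp add: hull_fun_def convergent_LIMSEQ_iff)
qed

lemma hull_le_iter: "radius_function f \<Longrightarrow> x \<in> \<Omega> \<Longrightarrow> hull_fun f x \<le> (mid_fun ^^ n) f x"
  using decseq_ge[OF decseq_iter iter_LIMSEQ] .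

lemma hull_le: "radius_function f \<Longrightarrow> x \<in> \<Omega> \<Longrightarrow> hull_fun f x \<le> f x"
  using hull_le_iter[of f x 0] by simp

lemma radius_function_hull: "radius_function f \<Longrightarrow> radius_function (hull_fun f)"
  unfolding radius_function_def[of "hull_fun f"]
proof (intro ballI)
  fix x y assume *: "radius_function f" "x \<in> \<Omega>" "y \<in> \<Omega>"
  show "D x y \<le> hull_fun f x + hull_fun f y"
    by (rule LIMSEQ_le_const[OF tendsto_add[OF iter_LIMSEQ iter_LIMSEQ]])
      (use * radius_functionD[OF radius_function_iter] in auto)
qed

lemma hull_Lipschitz:
  assumes "radius_function f" "radius_function g" "\<And>y. y \<in> \<Omega> \<Longrightarrow> \<bar>f y - g y\<bar> \<le> c" "x \<in> \<Omega>"
  shows "\<bar>hull_fun f x - hull_fun g x\<bar> \<le> c"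
  by (rule LIMSEQ_le_const2[OF tendsto_rabs[OF tendsto_diff[OF iter_LIMSEQ iter_LIMSEQ]]])
    (use assms iter_Lipschitz[OF assms(1-3)] in auto)

lemma hull_extremal:
  assumes f: "radius_function f" "x \<in> \<Omega>" and \<epsilon>: "0 < \<epsilon>"
  shows "\<exists>y\<in>\<Omega>. hull_fun f x + hull_fun f y \<le> D x y + \<epsilon>"
proof -
  obtain n where n: "(f x - conj_fun f x) / 2 ^ n < \<epsilon> / 2"
    using real_arch_pow[of 2 "(f x - conj_fun f x) / (\<epsilon> / 2)"] \<epsilon> by (auto simp: field_simps)
  let ?g = "(mid_fun ^^ n) f"
  note g = radius_function_iter[OF f(1), of n]
  have "(\<lambda>y. D x y - ?g y) ` \<Omega> \<noteq> {}" using f(2) by blast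
  from less_cSup_iff[OF this bdd_conj[OF g f(2)], of "conj_fun ?g x - \<epsilon> / 2"]
  obtain y where y: "y \<in> \<Omega>" "conj_fun ?g x - \<epsilon> / 2 < D x y - ?g y"
    using \<epsilon> by (auto simp: conj_fun_def)
  have "?g x - conj_fun ?g x < \<epsilon> / 2" using iter_gap[OF f, of n] n by linarith
  then have "?g x + ?g y \<le> D x y + \<epsilon>" using y(2) by linarith
  then show ?thesis using hull_le_iter[OF f(1) f(2), of n] hull_le_iter[OF f(1) y(1), of n] y(1)
    by (intro bexI[of _ y]) linarith+
qed

definition coarse_centre :: "('x \<Rightarrow> real) \<Rightarrow> 'x \<Rightarrow> bool" where
  "coarse_centre f z \<longleftrightarrow> z \<in> \<Omega> \<and> (\<forall>x\<in>\<Omega>. D z x \<le> hull_fun f x + 3)"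

text \<open>Finiteness of balls upgrades the finite Helly property. Candidates lie in a finite ball
  about \<open>a\<close>; if each failed at some point \<open>h z\<close>, then applying the finite
  property to \<open>a\<close> and these points would produce a candidate that does not
  fail.\<close>

lemma exists_coarse_centre:
  assumes f: "radius_function f" and "\<Omega> \<noteq> {}"
  shows "\<exists>z. coarse_centre f z"
proof (rule ccontr)
  assume none: "\<nexists>z. coarse_centre f z"
  let ?r = "hull_fun f"
  note r = radius_function_hull[OF f]
  obtain a where a: "a \<in> \<Omega>" using assms(2) by blast
  let ?Z = "{z \<in> \<Omega>. D a z \<le> ?r a + 3}"
  have "\<forall>z\<in>\<Omega>. \<exists>x\<in>\<Omega>. \<not> D z x \<le> ?r x + 3" using none by (auto simp: coarse_centre_def)
  then obtain h where h: "\<And>z. z \<in> \<Omega> \<Longrightarrow> h z \<in> \<Omega> \<and> \<not> D z (h z) \<le> ?r (h z) + 3" by metis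
  have "\<exists>z\<in>\<Omega>. \<forall>x\<in>insert a (h ` ?Z). D z x \<le> ?r x + 3"
    using finite_balls[OF a] h a radius_functionD[OF r] by (intro finite_helly) auto
  then obtain z where z: "z \<in> \<Omega>" "D z a \<le> ?r a + 3" "\<And>x. x \<in> ?Z \<Longrightarrow> D z (h x) \<le> ?r (h x) + 3" by auto
  then have "z \<in> ?Z" using D_sym[OF z(1) a] by simp
  then show False using z(3)[of z] h[of z] by blast
qed

text \<open>Extremality makes the hull function small at its own centre: an almost extremal partner
  \<open>y\<close> of \<open>z'\<close> gives the bound 3 above \<open>D z' z'\<close>. With the 3
  for \<open>z\<close> and \<open>D z' z' \<le> 1\<close> the error is 7. In particular the choice
  of a centre matters only up to 7.\<close>

lemma coarse_centre_dist:
  assumes f: "radius_function f" "radius_function g" "\<And>y. y \<in> \<Omega> \<Longrightarrow> \<bar>f y - g y\<bar> \<le> c"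
    and z: "coarse_centre f z" "coarse_centre g z'"
  shows "D z z' \<le> c + 7"
proof -
  have in_X: "z \<in> \<Omega>" "z' \<in> \<Omega>" using z by (auto simp: coarse_centre_def)
  have "hull_fun g z' \<le> D z' z' + 3"
  proof (rule field_le_epsilon)
    fix \<epsilon> :: real assume "0 < \<epsilon>"
    from hull_extremal[OF f(2) in_X(2) this] obtain y where
      y: "y \<in> \<Omega>" "hull_fun g z' + hull_fun g y \<le> D z' y + \<epsilon>" by blast
    have "D z' y \<le> hull_fun g y + 3" using z(2) y(1) by (simp add: coarse_centre_def)
    then show "hull_fun g z' \<le> D z' z' + 3 + \<epsilon>" using y(2) D_nonneg[of z' z'] by linarith
  qed
  moreover have "D z z' \<le> hull_fun f z' + 3" using z(1) in_X(2) by (simp add: coarse_centre_def)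
  moreover have "hull_fun f z' \<le> hull_fun g z' + c" using hull_Lipschitz[OF f in_X(2)] by linarith
  ultimately show ?thesis using D_self[OF in_X(2)] by linarith
qed

section \<open>Paths of coarse centres\<close>

definition seg_fun :: "'x \<Rightarrow> 'x \<Rightarrow> real \<Rightarrow> 'x \<Rightarrow> real" where
  "seg_fun a b t x = (1 - t) * D a x + t * D b x"

lemma radius_function_seg:
  assumes "a \<in> \<Omega>" "b \<in> \<Omega>" "t \<in> {0..1}"
  shows "radius_function (seg_fun a b t)"
  unfolding radius_function_def
proof (intro ballI)
  fix x y assume xy: "x \<in> \<Omega>" "y \<in> \<Omega>"
  have "(1 - t) * D x y \<le> (1 - t) * (D a x + D a y)" "t * D x y \<le> t * (D b x + D b y)"
    using D_triangle[OF xy(1) assms(1) xy(2)] D_triangle[OF xy(1) assms(2) xy(2)]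
      D_sym[OF xy(1)] assms by (auto intro!: mult_left_mono)
  then show "D x y \<le> seg_fun a b t x + seg_fun a b t y"
    by (simp add: seg_fun_def algebra_simps)
qed

lemma D_diff: "\<lbrakk>a \<in> \<Omega>; b \<in> \<Omega>; x \<in> \<Omega>\<rbrakk> \<Longrightarrow> \<bar>D a x - D b x\<bar> \<le> D a b"
  using D_triangle[of a b x] D_triangle[of b a x] D_sym[of a b] by (simp add: abs_le_iff)

lemma seg_fun_diff_time:
  assumes "a \<in> \<Omega>" "b \<in> \<Omega>" "x \<in> \<Omega>"
  shows "\<bar>seg_fun a b s x - seg_fun a b t x\<bar> \<le> \<bar>s - t\<bar> * D a b"
proof -
  have "seg_fun a b s x - seg_fun a b t x = (t - s) * (D a x - D b x)"
    by (simp add: seg_fun_def algebra_simps)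
  then show ?thesis using D_diff[OF assms] by (simp add: abs_mult abs_minus_commute mult_left_mono)
qed

lemma seg_fun_diff_ends:
  assumes "a \<in> \<Omega>" "b \<in> \<Omega>" "a' \<in> \<Omega>" "b' \<in> \<Omega>" "t \<in> {0..1}" "x \<in> \<Omega>"
  shows "\<bar>seg_fun a b t x - seg_fun a' b' t x\<bar> \<le> max (D a a') (D b b')"
proof -
  let ?m = "max (D a a') (D b b')"
  have "\<bar>D a x - D a' x\<bar> \<le> ?m" "\<bar>D b x - D b' x\<bar> \<le> ?m"
    using D_diff[of a a' x] D_diff[of b b' x] assms by auto
  then have *: "\<bar>(1 - t) * (D a x - D a' x)\<bar> \<le> (1 - t) * ?m" "\<bar>t * (D b x - D b' x)\<bar> \<le> t * ?m"
    using assms(5) by (simp_all only: abs_mult) (auto intro!: mult_mono)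
  have "seg_fun a b t x - seg_fun a' b' t x = (1 - t) * (D a x - D a' x) + t * (D b x - D b' x)"
    by (simp add: seg_fun_def algebra_simps)
  moreover have "(1 - t) * ?m + t * ?m = ?m" by (simp add: algebra_simps)
  ultimately show ?thesis using * abs_triangle_ineq[of "(1 - t) * (D a x - D a' x)" "t * (D b x - D b' x)"]
    by linarith
qed

lemma coarse_centre_start: "a \<in> \<Omega> \<Longrightarrow> b \<in> \<Omega> \<Longrightarrow> coarse_centre (seg_fun a b 0) a"
  unfolding coarse_centre_def
proof (intro conjI ballI)
  fix x assume *: "a \<in> \<Omega>" "b \<in> \<Omega>" "x \<in> \<Omega>"
  note f = radius_function_seg[of a b 0, OF *(1,2)]
  have "D a x \<le> hull_fun (seg_fun a b 0) a + hull_fun (seg_fun a b 0) x"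
    using radius_functionD[OF radius_function_hull[OF f]] * by simp
  moreover have "hull_fun (seg_fun a b 0) a \<le> 1"
    using hull_le[OF f *(1)] D_self[OF *(1)] by (simp add: seg_fun_def)
  ultimately show "D a x \<le> hull_fun (seg_fun a b 0) x + 3" by linarith
qed

lemma coarse_centre_end: "a \<in> \<Omega> \<Longrightarrow> b \<in> \<Omega> \<Longrightarrow> coarse_centre (seg_fun a b 1) b"
  using coarse_centre_start[of b a] by (simp add: seg_fun_def[abs_def])

lemma coarse_centre_Lipschitz:
  assumes "a \<in> \<Omega>" "b \<in> \<Omega>" "s \<in> {0..1}" "t \<in> {0..1}"
    "coarse_centre (seg_fun a b s) z" "coarse_centre (seg_fun a b t) z'"
  shows "D z z' \<le> \<bar>s - t\<bar> * D a b + 7"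
  using coarse_centre_dist[OF radius_function_seg radius_function_seg seg_fun_diff_time] assms by blast

text \<open>The upper bounds from \<open>a\<close> to the first point and from the second point to
  \<open>b\<close> leave no more room: they are subtracted from \<open>D a b\<close>, at the cost of
  7 each.\<close>

lemma coarse_centre_coLipschitz:
  assumes ab: "a \<in> \<Omega>" "b \<in> \<Omega>" and st: "s \<in> {0..1}" "t \<in> {0..1}"
    and z: "coarse_centre (seg_fun a b s) z" "coarse_centre (seg_fun a b t) z'"
  shows "\<bar>s - t\<bar> * D a b - 14 \<le> D z z'"
proof -
  have *: "(t - s) * D a b - 14 \<le> D z z'"
    if st: "s \<in> {0..1}" "t \<in> {0..1}"
      and z: "coarse_centre (seg_fun a b s) z" "coarse_centre (seg_fun a b t) z'" for s t z z'
  proof -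
    have in_X: "z \<in> \<Omega>" "z' \<in> \<Omega>" using z by (auto simp: coarse_centre_def)
    have "D a z \<le> \<bar>0 - s\<bar> * D a b + 7"
      using coarse_centre_Lipschitz[OF ab _ st(1) coarse_centre_start[OF ab] z(1)] by simp
    moreover have "D z' b \<le> \<bar>t - 1\<bar> * D a b + 7"
      using coarse_centre_Lipschitz[OF ab st(2) _ z(2) coarse_centre_end[OF ab]] by simp
    moreover have "D a b \<le> D a z + D z b" "D z b \<le> D z z' + D z' b"
      using D_triangle in_X ab by blast+
    ultimately show ?thesis using st by (simp add: algebra_simps)
  qed
  have "D z z' = D z' z" using z D_sym by (auto simp: coarse_centre_def)
  then show ?thesis using *[OF st z] *[OF st(2,1) z(2,1)] by (cases "s \<le> t") auto
qed

lemma coarse_centre_bounded: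
  assumes "a \<in> \<Omega>" "b \<in> \<Omega>" "a' \<in> \<Omega>" "b' \<in> \<Omega>" "t \<in> {0..1}"
    "coarse_centre (seg_fun a b t) z" "coarse_centre (seg_fun a' b' t) z'"
  shows "D z z' \<le> max (D a a') (D b b') + 7"
  using coarse_centre_dist[OF radius_function_seg radius_function_seg seg_fun_diff_ends] assms by blast

lemma exists_centre_path:
  assumes "a \<in> \<Omega>" "b \<in> \<Omega>"
  obtains \<beta> where "\<beta> 0 = a" "\<beta> 1 = b" "\<And>t. t \<in> {0..1} \<Longrightarrow> coarse_centre (seg_fun a b t) (\<beta> t)"
proof -
  have "\<exists>z. coarse_centre (seg_fun a b t) z" if "t \<in> {0..1}" for t
    using exists_coarse_centre[OF radius_function_seg[OF assms that]] assms by blast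
  then obtain \<beta>' where \<beta>': "\<And>t. t \<in> {0..1} \<Longrightarrow> coarse_centre (seg_fun a b t) (\<beta>' t)" by metis
  show thesis
    by (rule that[of "\<lambda>t. if t = 0 then a else if t = 1 then b else \<beta>' t"])
      (use \<beta>' coarse_centre_start[OF assms] coarse_centre_end[OF assms] in auto)
qed

lemma coarse_centre_isometry:
  assumes g: "bij_betw g \<Omega> \<Omega>" "\<And>x y. x \<in> \<Omega> \<Longrightarrow> y \<in> \<Omega> \<Longrightarrow> D (g x) (g y) = D x y"
    and ab: "a \<in> \<Omega>" "b \<in> \<Omega>" "t \<in> {0..1}" and z: "coarse_centre (seg_fun a b t) z"
  shows "coarse_centre (seg_fun (g a) (g b) t) (g z)"
proof -
  have g_in: "g x \<in> \<Omega>" if "x \<in> \<Omega>" for x using g(1) that by (auto simp: bij_betw_def)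
  have g_im: "g ` \<Omega> = \<Omega>" using g(1) by (simp add: bij_betw_def)
  have conj: "conj_fun f (g x) = conj_fun h x"
    if "x \<in> \<Omega>" "\<And>y. y \<in> \<Omega> \<Longrightarrow> f (g y) = h y" for f h x
  proof -
    have "(\<lambda>y. D (g x) y - f y) ` \<Omega> = (\<lambda>y. D (g x) y - f y) ` g ` \<Omega>" by (simp add: g_im)
    also have "\<dots> = (\<lambda>y. D x y - h y) ` \<Omega>" using that g(2) by (simp add: image_image)
    finally show ?thesis by (simp add: conj_fun_def)
  qed
  have iter: "(mid_fun ^^ n) (seg_fun (g a) (g b) t) (g x) = (mid_fun ^^ n) (seg_fun a b t) x"
    if "x \<in> \<Omega>" for n x using that
  proof (induction n arbitrary: x)
    case 0
    then show ?case using g(2) ab by (simp add: seg_fun_def)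
  next
    case (Suc n)
    then show ?case using conj[OF Suc.prems] by (simp add: mid_fun_def)
  qed
  have hull: "hull_fun (seg_fun (g a) (g b) t) (g x) = hull_fun (seg_fun a b t) x" if "x \<in> \<Omega>" for x
    using iter[OF that] by (simp add: hull_fun_def)
  have "D (g z) y \<le> hull_fun (seg_fun (g a) (g b) t) y + 3" if y: "y \<in> \<Omega>" for y
  proof -
    obtain x where "x \<in> \<Omega>" "y = g x" using y g_im by blast
    then show ?thesis using z hull g(2) by (simp add: coarse_centre_def)
  qed
  then show ?thesis using z g_in by (simp add: coarse_centre_def)
qed

end

section \<open>Word metrics\<close>

context group
begin

lemma inv_cancel:
  assumes "h \<in> carrier G" "x \<in> carrier G"
  shows "inv h \<otimes> (h \<otimes> x) = x" "h \<otimes> (inv h \<otimes> x) = x"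
  using assms by (metis inv_closed l_inv r_inv l_one m_assoc)+

lemma inv_mult_translate:
  assumes "h \<in> carrier G" "x \<in> carrier G" "y \<in> carrier G"
  shows "inv (h \<otimes> x) \<otimes> (h \<otimes> y) = inv x \<otimes> y"
  using assms by (simp add: inv_mult_group m_assoc inv_cancel)

lemma word_dist_edge:
  assumes "S \<subseteq> carrier G" "x \<in> carrier G" "s \<in> S \<union> (\<lambda>s. inv s) ` S"
  shows "word_dist G S x (x \<otimes> s) \<le> 1"
proof -
  have s: "s \<in> carrier G" using assms by auto
  have "inv x \<otimes> (x \<otimes> s) = s" using assms(2) s by (simp add: inv_cancel)
  moreover have "word_length G S s \<le> length [s]" using assms(3) s by (intro word_length_le) auto
  ultimately show ?thesis using assms(2) s by (simp add: word_dist_def)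
qed

lemma word_path:
  assumes gen: "finite_generating_set G S" and xy: "x \<in> carrier G" "y \<in> carrier G"
  obtains f where "f 0 = x" "f (word_length G S (inv x \<otimes> y)) = y" "\<And>i. f i \<in> carrier G"
    "\<And>i. word_dist G S (f i) (f (Suc i)) \<le> 1"
proof -
  have S: "S \<subseteq> carrier G" using gen by (simp add: finite_generating_set_def)
  have "inv x \<otimes> y \<in> carrier G" using xy by simp
  from word_length_word[OF gen this] obtain ws where
    ws: "length ws = word_length G S (inv x \<otimes> y)" "set ws \<subseteq> S \<union> (\<lambda>s. inv s) ` S"
    "foldr (\<lambda>s y. s \<otimes> y) ws \<one> = inv x \<otimes> y" by blast
  have ws_in: "set ws \<subseteq> carrier G" using ws(2) S by auto
  define f where "f i = x \<otimes> foldr (\<lambda>s y. s \<otimes> y) (take i ws) \<one>" for i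
  have take_in: "set (take i ws) \<subseteq> carrier G" for i using ws_in set_take_subset by fast
  have f_in: "f i \<in> carrier G" for i unfolding f_def using xy foldr_closed[OF take_in] by simp
  show thesis
  proof (rule that[of f])
    show "f 0 = x" using xy by (simp add: f_def)
    show "f (word_length G S (inv x \<otimes> y)) = y" using ws xy by (simp add: f_def inv_cancel)
    show "f i \<in> carrier G" for i by (rule f_in)
    show "word_dist G S (f i) (f (Suc i)) \<le> 1" for i
    proof (cases "i < length ws")
      case True
      then have s: "ws ! i \<in> set ws" by simp
      then have s_in: "ws ! i \<in> carrier G" using ws_in by blast
      have "f (Suc i) = f i \<otimes> ws ! i"
        using foldr_append[OF take_in[of i], of "[ws ! i]"] s_in xy foldr_closed[OF take_in[of i]] True
        by (simp add: f_def take_Suc_conv_app_nth m_assoc del: foldr_append)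
      then show ?thesis using word_dist_edge[OF S f_in] s ws(2) by auto
    next
      case False
      then have "f (Suc i) = f i" by (simp add: f_def)
      then show ?thesis
        using Metric_space.mdist_zero[OF Metric_space_word_dist[OF gen] f_in[of i]] by simp
    qed
  qed
qed

lemma finite_word_balls:
  assumes gen: "finite_generating_set G S" and x: "x \<in> carrier G"
  shows "finite {y \<in> carrier G. word_dist G S x y \<le> R}"
proof (rule finite_subset)
  let ?W = "{ws. set ws \<subseteq> S \<union> (\<lambda>s. inv s) ` S \<and> length ws \<le> nat \<lfloor>R\<rfloor>}"
  show "{y \<in> carrier G. word_dist G S x y \<le> R} \<subseteq> (\<lambda>ws. x \<otimes> foldr (\<lambda>s y. s \<otimes> y) ws \<one>) ` ?W"
  proof
    fix y assume "y \<in> {y \<in> carrier G. word_dist G S x y \<le> R}"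
    then have y: "y \<in> carrier G" "real (word_length G S (inv x \<otimes> y)) \<le> R"
      using x by (auto simp: word_dist_def)
    have "inv x \<otimes> y \<in> carrier G" using x y by simp
    from word_length_word[OF gen this] obtain ws where
      ws: "length ws = word_length G S (inv x \<otimes> y)" "set ws \<subseteq> S \<union> (\<lambda>s. inv s) ` S"
      "foldr (\<lambda>s y. s \<otimes> y) ws \<one> = inv x \<otimes> y" by blast
    have "length ws \<le> nat \<lfloor>R\<rfloor>" using ws(1) y(2) by (simp add: le_nat_floor)
    moreover have "y = x \<otimes> foldr (\<lambda>s y. s \<otimes> y) ws \<one>" using ws(3) x y by (simp add: inv_cancel)
    ultimately show "y \<in> (\<lambda>ws. x \<otimes> foldr (\<lambda>s y. s \<otimes> y) ws \<one>) ` ?W" using ws(2) by blast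
  qed
  have "finite (S \<union> (\<lambda>s. inv s) ` S)" using gen by (simp add: finite_generating_set_def)
  then show "finite ((\<lambda>ws. x \<otimes> foldr (\<lambda>s y. s \<otimes> y) ws \<one>) ` ?W)"
    by (intro finite_imageI finite_lists_length_le)
qed

end

section \<open>Semihyperbolicity from an invariant coarsely injective metric\<close>

locale coarsely_injective_group = group G + coarsely_injective "carrier G" D
  for G :: "('g, 'm) monoid_scheme" (structure) and D :: "'g \<Rightarrow> 'g \<Rightarrow> real" +
  fixes S :: "'g set"
  assumes generating_set: "finite_generating_set G S"
    and D_translate: "\<lbrakk>h \<in> carrier G; x \<in> carrier G; y \<in> carrier G\<rbrakk> \<Longrightarrow> D (h \<otimes> x) (h \<otimes> y) = D x y"
    and D_le_word_dist: "\<lbrakk>x \<in> carrier G; y \<in> carrier G\<rbrakk> \<Longrightarrow> D x y \<le> word_dist G S x y + 1"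
    and word_dist_bounded: "\<exists>\<kappa>. \<forall>x\<in>carrier G. \<forall>y\<in>carrier G. D x y \<le> R \<longrightarrow> word_dist G S x y \<le> \<kappa>"
begin

lemmas word_dist_triangle = Metric_space.triangle[OF Metric_space_word_dist[OF generating_set]]

text \<open>\<open>word_dist_bounded\<close> has no linear rate, but the space is coarsely geodesic
  for \<open>D\<close>. The path of centres is cut into about \<open>D x y\<close> steps of
  \<open>D\<close>-length at most \<open>1 + 7 = 8\<close>, each of bounded word length.\<close>

lemma word_dist_le_D:
  obtains K where "1 \<le> K" "\<And>x y. \<lbrakk>x \<in> carrier G; y \<in> carrier G\<rbrakk> \<Longrightarrow> word_dist G S x y \<le> K * D x y + K"
proof -
  obtain \<kappa> where \<kappa>: "\<And>x y. \<lbrakk>x \<in> carrier G; y \<in> carrier G; D x y \<le> 8\<rbrakk> \<Longrightarrow> word_dist G S x y \<le> \<kappa>"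
    using word_dist_bounded by blast
  have "word_dist G S x y \<le> max 1 (2 * \<kappa>) * D x y + max 1 (2 * \<kappa>)"
    if xy: "x \<in> carrier G" "y \<in> carrier G" for x y
  proof -
    obtain \<beta> where \<beta>: "\<beta> 0 = x" "\<beta> 1 = y" "\<And>t. t \<in> {0..1} \<Longrightarrow> coarse_centre (seg_fun x y t) (\<beta> t)"
      using exists_centre_path[OF xy] by metis
    have \<beta>_in: "\<beta> t \<in> carrier G" if "t \<in> {0..1}" for t
      using \<beta>(3)[OF that] by (simp add: coarse_centre_def)
    define n where "n = nat \<lceil>D x y\<rceil> + 1"
    have n: "0 < n" "D x y \<le> real n" "real n \<le> D x y + 2"
      using D_nonneg[of x y] unfolding n_def by linarith+
    have \<kappa>0: "0 \<le> \<kappa>" using \<kappa>[OF xy(1,1)] D_self[OF xy(1)] by (simp add: word_dist_def split: if_splits)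
    have "k \<le> n \<Longrightarrow> word_dist G S x (\<beta> (real k / real n)) \<le> real k * \<kappa>" for k
    proof (induction k)
      case 0
      show ?case using \<beta>(1) xy Metric_space.mdist_zero[OF Metric_space_word_dist[OF generating_set]]
        by simp
    next
      case (Suc k)
      let ?s = "real k / real n" and ?t = "real (Suc k) / real n"
      have st: "?s \<in> {0..1}" "?t \<in> {0..1}" using Suc.prems n(1) by auto
      have "D (\<beta> ?s) (\<beta> ?t) \<le> \<bar>?s - ?t\<bar> * D x y + 7"
        using coarse_centre_Lipschitz[OF xy st \<beta>(3)[OF st(1)] \<beta>(3)[OF st(2)]] .
      also have "\<bar>?s - ?t\<bar> = 1 / real n" using n(1) by (simp add: field_simps)
      also have "1 / real n * D x y \<le> 1" using n by (simp add: field_simps)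
      finally have "word_dist G S (\<beta> ?s) (\<beta> ?t) \<le> \<kappa>" using \<kappa> \<beta>_in st by simp
      moreover have "word_dist G S x (\<beta> ?t) \<le> word_dist G S x (\<beta> ?s) + word_dist G S (\<beta> ?s) (\<beta> ?t)"
        using word_dist_triangle xy \<beta>_in st by blast
      ultimately show ?case using Suc by (simp add: algebra_simps)
    qed
    from this[of n] have "word_dist G S x y \<le> real n * \<kappa>" using n(1) \<beta>(2) by simp
    also have "\<dots> \<le> (D x y + 2) * \<kappa>" using n(3) \<kappa>0 by (rule mult_right_mono)
    also have "\<dots> = \<kappa> * D x y + 2 * \<kappa>" by (simp add: algebra_simps)
    also have "\<dots> \<le> max 1 (2 * \<kappa>) * D x y + max 1 (2 * \<kappa>)"
      using \<kappa>0 D_nonneg by (intro add_mono mult_right_mono) auto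
    finally show ?thesis .
  qed
  then show thesis using that[of "max 1 (2 * \<kappa>)"] by simp
qed

lemma translate_bij: "h \<in> carrier G \<Longrightarrow> bij_betw (\<lambda>x. h \<otimes> x) (carrier G) (carrier G)"
proof (rule bij_betwI[where g = "\<lambda>x. inv h \<otimes> x"])
qed (auto simp: inv_cancel)

lemma semihyperbolic: "semihyperbolic_group G"
proof -
  obtain K where K: "1 \<le> K"
    "\<And>x y. \<lbrakk>x \<in> carrier G; y \<in> carrier G\<rbrakk> \<Longrightarrow> word_dist G S x y \<le> K * D x y + K"
    using word_dist_le_D by blast
  have "\<exists>\<beta>. \<beta> 0 = \<one> \<and> \<beta> 1 = b \<and> (\<forall>t\<in>{0..1}. coarse_centre (seg_fun \<one> b t) (\<beta> t))"
    if "b \<in> carrier G" for b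
    using exists_centre_path[OF one_closed that] by metis
  then obtain \<beta> where \<beta>: "\<And>b. b \<in> carrier G \<Longrightarrow> \<beta> b 0 = \<one> \<and> \<beta> b 1 = b \<and>
      (\<forall>t\<in>{0..1}. coarse_centre (seg_fun \<one> b t) (\<beta> b t))" by metis
  define \<gamma> where "\<gamma> a b t = a \<otimes> \<beta> (inv a \<otimes> b) t" for a b and t :: real
  have centre: "coarse_centre (seg_fun a b t) (\<gamma> a b t)"
    if ab: "a \<in> carrier G" "b \<in> carrier G" and t: "t \<in> {0..1}" for a b t
  proof -
    have b': "inv a \<otimes> b \<in> carrier G" using ab by simp
    have "coarse_centre (seg_fun (a \<otimes> \<one>) (a \<otimes> (inv a \<otimes> b)) t) (a \<otimes> \<beta> (inv a \<otimes> b) t)"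
      by (rule coarse_centre_isometry[OF translate_bij[OF ab(1)] D_translate[OF ab(1)] one_closed b' t])
        (use \<beta>[OF b'] t in auto)
    then show ?thesis using ab by (simp add: \<gamma>_def inv_cancel)
  qed
  have \<gamma>_in: "\<gamma> a b t \<in> carrier G" if "a \<in> carrier G" "b \<in> carrier G" "t \<in> {0..1}" for a b t
    using centre[OF that] by (simp add: coarse_centre_def)
  have ends: "\<gamma> a b 0 = a" "\<gamma> a b 1 = b" if "a \<in> carrier G" "b \<in> carrier G" for a b
    using \<beta>[of "inv a \<otimes> b"] that by (auto simp: \<gamma>_def inv_cancel)
  note metric = mspace_word_metric[OF generating_set] mdist_word_metric[OF generating_set]
  have "quasigeodesic_bicombing (word_metric G S) \<gamma>"
    unfolding quasigeodesic_bicombing_def metric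
  \<comment> \<open>The upper estimate is \<open>2 * K * u + 8 * K\<close>, where
    \<open>D a b \<le> L + 1 \<le> 2 * L\<close> because distinct group elements have word distance
    at least 1; the lower one is \<open>u / K - 16\<close>, with 14 from the co-Lipschitz bound and
    1 from each comparison of metrics.\<close>
  proof (intro conjI ballI exI[of _ "8 * K + 16"] impI)
    fix a b assume ab: "a \<in> carrier G" "b \<in> carrier G"
    show "\<gamma> a b \<in> {0..1} \<rightarrow> carrier G" using \<gamma>_in[OF ab] by auto
    assume "a \<noteq> b"
    define L where "L = word_dist G S a b"
    have "0 < L"
      using Metric_space.mdist_pos_eq[OF Metric_space_word_dist[OF generating_set] ab] \<open>a \<noteq> b\<close>
      by (simp add: L_def)
    then have L: "1 \<le> L" using ab by (simp add: L_def word_dist_def)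
    have D_ge: "L \<le> K * D a b + K" and D_le: "D a b \<le> L + 1"
      using K(2)[OF ab] D_le_word_dist[OF ab] by (simp_all add: L_def)
    show "quasigeodesic (word_metric G S) (8 * K + 16) (8 * K + 16) (word_dist G S a b)
        (\<lambda>t. \<gamma> a b (t / word_dist G S a b)) a b"
      unfolding quasigeodesic_def metric L_def[symmetric]
    proof (intro conjI ballI)
      show "0 \<le> L" using L by simp
      have in_unit: "s / L \<in> {0..1}" if "s \<in> {0..L}" for s using that L by simp
      show "(\<lambda>t. \<gamma> a b (t / L)) \<in> {0..L} \<rightarrow> carrier G" using \<gamma>_in[OF ab in_unit] by auto
      show "\<gamma> a b (0 / L) = a" "\<gamma> a b (L / L) = b" using ends[OF ab] L by simp_all
      fix s t assume "s \<in> {0..L}" "t \<in> {0..L}"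
      note st = this[THEN in_unit]
      let ?x = "\<gamma> a b (s / L)" and ?y = "\<gamma> a b (t / L)"
      note xy = \<gamma>_in[OF ab st(1)] \<gamma>_in[OF ab st(2)]
      define u where "u = \<bar>s - t\<bar>"
      have u: "\<bar>s / L - t / L\<bar> = u / L" "0 \<le> u" "u \<le> L"
        using L \<open>s \<in> {0..L}\<close> \<open>t \<in> {0..L}\<close> by (auto simp: u_def simp flip: diff_divide_distrib)
      have upper: "D ?x ?y \<le> u / L * D a b + 7"
        using coarse_centre_Lipschitz[OF ab st centre[OF ab st(1)] centre[OF ab st(2)]] u(1) by simp
      have lower: "u / L * D a b - 14 \<le> D ?x ?y"
        using coarse_centre_coLipschitz[OF ab st centre[OF ab st(1)] centre[OF ab st(2)]] u(1) by simp
      have "u / L * D a b \<le> u / L * (2 * L)" using D_le L u(2) by (intro mult_left_mono) auto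
      also have "\<dots> = 2 * u" using L by simp
      finally have "word_dist G S ?x ?y \<le> K * (2 * u + 7) + K"
        using K(2)[OF xy] upper K(1) by (smt (verit) mult_left_mono)
      moreover have "2 * K * u \<le> (8 * K + 16) * u" using K(1) u(2) by (intro mult_right_mono) auto
      ultimately show "word_dist G S ?x ?y \<le> (8 * K + 16) * \<bar>s - t\<bar> + (8 * K + 16)"
        unfolding u_def[symmetric] by (simp add: algebra_simps)
      have "u / L * (L / K - 1) \<le> u / L * D a b"
        using D_ge K(1) L u(2) by (intro mult_left_mono) (auto simp: field_simps)
      moreover have "u / L * (L / K - 1) = u / K - u / L" using L by (simp add: field_simps)
      moreover have "u / L \<le> 1" "u / (8 * K + 16) \<le> u / K"
        using L u K(1) by (auto intro!: divide_left_mono)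
      ultimately have "u / (8 * K + 16) - 16 \<le> word_dist G S ?x ?y"
        using lower D_le_word_dist[OF xy] by linarith
      then show "\<bar>s - t\<bar> / (8 * K + 16) - (8 * K + 16) \<le> word_dist G S ?x ?y"
        using K(1) by (simp add: u_def)
    qed
  qed (use K(1) in auto)
  moreover have "bounded_bicombing (word_metric G S) \<gamma>"
    unfolding bounded_bicombing_def metric
  proof (intro exI[of _ "9 * K"] conjI ballI)
    show "0 \<le> 9 * K" using K(1) by simp
    fix a b a' b' t assume in_G: "a \<in> carrier G" "b \<in> carrier G" "a' \<in> carrier G" "b' \<in> carrier G"
      and t: "t \<in> {0..1::real}"
    let ?m = "max (word_dist G S a a') (word_dist G S b b')"
    have "0 \<le> ?m" by (simp add: word_dist_def le_max_iff_disj)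
    have "D (\<gamma> a b t) (\<gamma> a' b' t) \<le> max (D a a') (D b b') + 7"
      using coarse_centre_bounded[OF in_G t centre centre] in_G t by blast
    also have "\<dots> \<le> ?m + 8" using D_le_word_dist[of a a'] D_le_word_dist[of b b'] in_G by auto
    finally have "K * D (\<gamma> a b t) (\<gamma> a' b' t) \<le> K * (?m + 8)" using K(1) by (intro mult_left_mono) auto
    then have "word_dist G S (\<gamma> a b t) (\<gamma> a' b' t) \<le> K * ?m + 9 * K"
      using K(2)[OF \<gamma>_in[OF in_G(1,2) t] \<gamma>_in[OF in_G(3,4) t]] by (simp add: algebra_simps)
    also have "\<dots> \<le> 9 * K * ?m + 9 * K" using K(1) \<open>0 \<le> ?m\<close> by (intro add_mono mult_right_mono) auto
    finally show "word_dist G S (\<gamma> a b t) (\<gamma> a' b' t) \<le> 9 * K * ?m + 9 * K" .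
  qed
  moreover have "equivariant_bicombing G \<gamma>"
    unfolding equivariant_bicombing_def
  proof (intro ballI)
    fix g a b and t :: real
    assume in_G: "g \<in> carrier G" "a \<in> carrier G" "b \<in> carrier G" and t: "t \<in> {0..1}"
    have b': "inv a \<otimes> b \<in> carrier G" using in_G by simp
    have "\<beta> (inv a \<otimes> b) t \<in> carrier G"
      using \<beta>[OF b'] t by (auto simp: coarse_centre_def)
    then show "\<gamma> (g \<otimes> a) (g \<otimes> b) t = g \<otimes> \<gamma> a b t"
      using in_G by (simp add: \<gamma>_def m_assoc inv_mult_translate)
  qed
  ultimately show ?thesis
    unfolding semihyperbolic_group_def using is_group generating_set by blast
qed

end

section \<open>Walls of a hierarchically hyperbolic group\<close>

text \<open>By the four point condition \<open>z\<close> is almost on a geodesic to \<open>p\<close>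
  from one of \<open>x\<close> and \<open>y\<close>, say \<open>w\<close>. Then
  \<open>d(w,p)\<close> is almost \<open>d(w,z) + d(z,p)\<close>, whereas \<open>d(w,q)\<close> is
  at most \<open>d(w,z) + d(z,q)\<close>; subtracting removes \<open>d(w,z)\<close>.\<close>

lemma mdist_diff_quasiconvex:
  assumes hyp: "four_point_hyperbolic m \<delta>"
    and in_m: "x \<in> mspace m" "y \<in> mspace m" "z \<in> mspace m" "p \<in> mspace m" "q \<in> mspace m"
    and xyz: "gromov_product m x y z \<le> c"
    and s: "mdist m x p - mdist m x q \<le> s" "mdist m y p - mdist m y q \<le> s"
  shows "mdist m z p - mdist m z q \<le> s + 2 * (c + \<delta>)"
proof -
  have *: "mdist m z p - mdist m z q \<le> s + 2 * (c + \<delta>)"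
    if "w \<in> mspace m" "gromov_product m w p z \<le> c + \<delta>" "mdist m w p - mdist m w q \<le> s" for w
    using that mdist_triangle[of w m z q] in_m by (simp add: gromov_product_def mdist_commute)
  from four_point_hyperbolicD[OF hyp in_m(3,1,4,2)] show ?thesis
    using *[OF in_m(1)] *[OF in_m(2)] xyz s by (auto simp: gromov_product_commute)
qed

context hhg_structure
begin

definition halfspace :: "'i \<Rightarrow> 'c \<Rightarrow> 'c \<Rightarrow> real \<Rightarrow> 'g set" where
  "halfspace U p q s =
     {x \<in> carrier G. mdist (C U) (proj U x) p - mdist (C U) (proj U x) q \<le> s}"

definition hhg_walls :: "real \<Rightarrow> ('g set \<times> 'g set) set" where
  "hhg_walls g = {(halfspace U p q s, halfspace U q p (- s - g)) | U p q s.
     U \<in> \<SS> \<and> p \<in> mspace (C U) \<and> q \<in> mspace (C U)}"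

lemma mspace_word: "mspace (word_metric G S) = carrier G"
  and mdist_word: "mdist (word_metric G S) = word_dist G S"
  using mspace_word_metric[OF generating] mdist_word_metric[OF generating] by auto

lemma halfspace_translate:
  assumes h: "h \<in> carrier G" and U: "U \<in> \<SS>" and pq: "p \<in> mspace (C U)" "q \<in> mspace (C U)"
  shows "(\<lambda>x. h \<otimes> x) ` halfspace U p q s = halfspace (act h U) (isom h U p) (isom h U q) s"
proof -
  have eq: "mdist (C (act h U)) (proj (act h U) (h \<otimes> x)) (isom h U r) = mdist (C U) (proj U x) r"
    if "x \<in> carrier G" "r \<in> mspace (C U)" for x r
    using isom_dist[OF h U proj_in[OF U] that(2), of x] isom_proj[OF h U that(1)] that(1)
    by (simp add: mspace_word)
  show ?thesis
  proof
    show "(\<lambda>x. h \<otimes> x) ` halfspace U p q s \<subseteq> halfspace (act h U) (isom h U p) (isom h U q) s"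
      using eq pq h by (auto simp: halfspace_def)
    show "halfspace (act h U) (isom h U p) (isom h U q) s \<subseteq> (\<lambda>x. h \<otimes> x) ` halfspace U p q s"
    proof
      fix y assume y: "y \<in> halfspace (act h U) (isom h U p) (isom h U q) s"
      then have y_in: "y \<in> carrier G" by (simp add: halfspace_def)
      then have x: "inv h \<otimes> y \<in> carrier G" "h \<otimes> (inv h \<otimes> y) = y" using h by (simp_all add: inv_cancel)
      then have "inv h \<otimes> y \<in> halfspace U p q s"
        using y eq[OF x(1)] pq by (auto simp: halfspace_def)
      then show "y \<in> (\<lambda>x. h \<otimes> x) ` halfspace U p q s" using x(2) by force
    qed
  qed
qed

lemma hhg_walls_translate:
  assumes h: "h \<in> carrier G" and AB: "(A, B) \<in> hhg_walls g"
  shows "((\<lambda>x. h \<otimes> x) ` A, (\<lambda>x. h \<otimes> x) ` B) \<in> hhg_walls g"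
proof -
  obtain U p q s where U: "U \<in> \<SS>" "p \<in> mspace (C U)" "q \<in> mspace (C U)"
    and eq: "A = halfspace U p q s" "B = halfspace U q p (- s - g)"
    using AB by (auto simp: hhg_walls_def)
  have "act h U \<in> \<SS>" using element_image[OF h U(1)] by blast
  moreover have "isom h U p \<in> mspace (C (act h U))" "isom h U q \<in> mspace (C (act h U))"
    using isom_bij[OF h U(1)] U(2,3) by (auto simp: bij_betw_def)
  ultimately show ?thesis
    using halfspace_translate[OF h U(1-3)] halfspace_translate[OF h U(1,3,2)]
    unfolding hhg_walls_def eq by blast
qed

lemma wall_space_hhg_walls: "0 < g \<Longrightarrow> wall_space (carrier G) (hhg_walls g)"
proof
  fix A B assume "0 < g" and AB: "(A, B) \<in> hhg_walls g"
  obtain U p q s where U: "U \<in> \<SS>" "p \<in> mspace (C U)" "q \<in> mspace (C U)"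
    and eq: "A = halfspace U p q s" "B = halfspace U q p (- s - g)"
    using AB by (auto simp: hhg_walls_def)
  show "A \<subseteq> carrier G" by (auto simp: eq halfspace_def)
  show "A \<inter> B = {}" using \<open>0 < g\<close> by (auto simp: eq halfspace_def)
  have "A = halfspace U p q (- (- s - g) - g)" by (simp add: eq)
  then show "(B, A) \<in> hhg_walls g" using U eq unfolding hhg_walls_def by blast
qed

text \<open>An edge moves each projection by at most \<open>2 * E\<close> and changes a difference
  of two distances by at most \<open>4 * E\<close>, which is less than the gap.\<close>

lemma hhg_walls_no_jump:
  assumes "(A, B) \<in> hhg_walls g" "4 * E < g" "x \<in> A" "y \<in> carrier G" "word_dist G S x y \<le> 1"
  shows "y \<notin> B"
proof
  assume "y \<in> B"
  obtain U p q s where U: "U \<in> \<SS>" "p \<in> mspace (C U)" "q \<in> mspace (C U)"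
    and eq: "A = halfspace U p q s" "B = halfspace U q p (- s - g)"
    using assms(1) by (auto simp: hhg_walls_def)
  have x: "x \<in> mspace (word_metric G S)" and y: "y \<in> mspace (word_metric G S)"
    using assms(3,4) by (auto simp: eq halfspace_def mspace_word)
  note in_U = proj_in[OF U(1) x] proj_in[OF U(1) y] U(2,3)
  have "dpts U x y \<le> E * word_dist G S x y + E" using coarsely_Lipschitz[OF U(1) x y] by (simp add: mdist_word)
  also have "\<dots> \<le> E * 1 + E" using assms(5) E_pos by (intro add_mono mult_left_mono) auto
  finally have "dpts U x y \<le> 2 * E" by simp
  moreover have "mdist (C U) (proj U x) q \<le> dpts U x y + mdist (C U) (proj U y) q"
    "mdist (C U) (proj U y) p \<le> dpts U y x + mdist (C U) (proj U x) p"
    by (simp_all add: mdist_triangle in_U)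
  moreover have "mdist (C U) (proj U x) p - mdist (C U) (proj U x) q \<le> s"
    "mdist (C U) (proj U y) q - mdist (C U) (proj U y) p \<le> - s - g"
    using assms(3) \<open>y \<in> B\<close> by (auto simp: eq halfspace_def)
  ultimately show False using assms(2) by (simp add: mdist_commute)
qed

lemma separated_le_word_length:
  assumes g: "4 * E < g" and xy: "x \<in> carrier G" "y \<in> carrier G"
    and sep: "wall_space.separated (carrier G) (hhg_walls g) n x y"
  shows "n \<le> word_length G S (inv x \<otimes> y)"
proof -
  interpret wall_space "carrier G" "hhg_walls g" using wall_space_hhg_walls g E_pos by simp
  obtain f where f: "f 0 = x" "f (word_length G S (inv x \<otimes> y)) = y" "\<And>i. f i \<in> carrier G"
    "\<And>i. word_dist G S (f i) (f (Suc i)) \<le> 1"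
    using word_path[OF generating xy] by metis
  show ?thesis
  proof (cases "n = 0")
    case False
    then obtain A B where AB: "chain x n A B" "y \<in> B" using sep by (auto simp: separated_def)
    show ?thesis
      by (rule chain_le_path_length[where f = f, OF AB(1) xy(1) f(1,3)])
        (use hhg_walls_no_jump g f AB(2) in auto)
  qed simp
qed

text \<open>By uniqueness some domain \<open>V\<close> has \<open>dpts V x y\<close> at least
  \<open>n * g\<close>. The difference of the distances to the two projections rises from
  \<open>- dpts V x y\<close> at \<open>x\<close> to \<open>dpts V x y\<close> at \<open>y\<close>,
  which leaves room for \<open>n\<close> levels at spacing \<open>g\<close>.\<close>

lemma separated_if_far:
  assumes g: "0 < g"
  obtains \<kappa> where "\<And>x y. \<lbrakk>x \<in> carrier G; y \<in> carrier G; \<kappa> \<le> word_dist G S x y\<rbrakk> \<Longrightarrow>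
    wall_space.separated (carrier G) (hhg_walls g) n x y"
proof -
  interpret wall_space "carrier G" "hhg_walls g" using wall_space_hhg_walls[OF g] .
  obtain \<theta> where \<theta>: "\<And>x y. \<lbrakk>x \<in> carrier G; y \<in> carrier G; \<theta> \<le> word_dist G S x y\<rbrakk> \<Longrightarrow>
      \<exists>V\<in>\<SS>. real n * g \<le> dpts V x y"
    using uniqueness[of "real n * g"] g by (auto simp: mspace_word mdist_word)
  have "separated n x y" if xy: "x \<in> carrier G" "y \<in> carrier G" "\<theta> \<le> word_dist G S x y" for x y
  proof -
    obtain V where V: "V \<in> \<SS>" "real n * g \<le> dpts V x y" using \<theta>[OF xy] by blast
    have in_V: "proj V x \<in> mspace (C V)" "proj V y \<in> mspace (C V)"
      using proj_in[OF V(1)] xy by (auto simp: mspace_word)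
    let ?A = "\<lambda>i. halfspace V (proj V x) (proj V y) (- dpts V x y + real i * g)"
    let ?B = "\<lambda>i. halfspace V (proj V y) (proj V x) (- (- dpts V x y + real i * g) - g)"
    have wall: "(?A i, ?B i) \<in> hhg_walls g" for i
      unfolding hhg_walls_def using V(1) in_V by blast
    have chain: "chain x (Suc i) (?A i) (?B i)" for i
    proof (induction i)
      case 0
      have "x \<in> ?A 0" using xy in_V by (simp add: halfspace_def)
      from chain.single[OF wall this] show ?case by simp
    next
      case (Suc i)
      have "carrier G \<subseteq> ?B i \<union> ?A (Suc i)" by (auto simp: halfspace_def algebra_simps)
      from chain.step[OF Suc wall this] show ?case .
    qed
    show ?thesis
    proof (cases n)
      case 0
      then show ?thesis by (simp add: separated_def)
    next
      case (Suc i)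
      have "real n * g \<le> 2 * dpts V x y"
        using V(2) mdist_nonneg[of "C V" "proj V x" "proj V y"] by linarith
      then have "y \<in> ?B i" using xy in_V
        by (simp add: halfspace_def Suc mdist_commute algebra_simps)
      then show ?thesis using chain[of i] Suc unfolding separated_def by blast
    qed
  qed
  then show thesis using that by blast
qed

lemma separated_translate:
  assumes g: "0 < g" and h: "h \<in> carrier G"
    and sep: "wall_space.separated (carrier G) (hhg_walls g) n x y"
  shows "wall_space.separated (carrier G) (hhg_walls g) n (h \<otimes> x) (h \<otimes> y)"
proof -
  interpret wall_space "carrier G" "hhg_walls g" using wall_space_hhg_walls[OF g] .
  have "chain (h \<otimes> x) n ((\<lambda>x. h \<otimes> x) ` A) ((\<lambda>x. h \<otimes> x) ` B)" if "chain x n A B" for A B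
    using that
  proof (induction rule: chain.induct)
    case (single A B)
    then show ?case using hhg_walls_translate[OF h] by (intro chain.single) auto
  next
    case (step n A B A' B')
    have "carrier G \<subseteq> (\<lambda>x. h \<otimes> x) ` B \<union> (\<lambda>x. h \<otimes> x) ` A'"
    proof
      fix z assume z: "z \<in> carrier G"
      then have "inv h \<otimes> z \<in> carrier G" "h \<otimes> (inv h \<otimes> z) = z"
        using h by (simp_all add: inv_cancel)
      then have "inv h \<otimes> z \<in> B \<union> A'" "h \<otimes> (inv h \<otimes> z) = z"
        using step.hyps(3) by blast+
      then show "z \<in> (\<lambda>x. h \<otimes> x) ` B \<union> (\<lambda>x. h \<otimes> x) ` A'" by force
    qed
    from chain.step[OF step.IH hhg_walls_translate[OF h step.hyps(2)] this] show ?case .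
  qed
  then show ?thesis using sep unfolding separated_def by blast
qed

lemma hhg_walls_helly:
  obtains g where "4 * E < g" "helly_wall_space (carrier G) (hhg_walls g)"
proof -
  obtain \<kappa> where \<kappa>: "0 \<le> \<kappa>" and helly_sets: "\<And>\<L> P. \<lbrakk>\<L> \<noteq> {}; \<And>A. A \<in> \<L> \<Longrightarrow> A \<subseteq> mspace (word_metric G S);
      \<And>A B. \<lbrakk>A \<in> \<L>; B \<in> \<L>\<rbrakk> \<Longrightarrow> A \<inter> B \<noteq> {}; finite P; \<And>A. A \<in> \<L> \<Longrightarrow> A \<inter> P \<noteq> {}\<rbrakk> \<Longrightarrow>
    \<exists>z\<in>mspace (word_metric G S). \<forall>U\<in>\<SS>. \<forall>A\<in>\<L>. \<exists>x\<in>A. \<exists>y\<in>A.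
      gromov_product (C U) (proj U x) (proj U y) (proj U z) \<le> \<kappa>"
    using helly by blast
  \<comment> \<open>The first summand absorbs the overrun allowed by
    \<open>mdist_diff_quasiconvex\<close> for a point of the coarse hull; \<open>4 * E + 1\<close>
    keeps edges from jumping across a wall.\<close>
  define g where "g = 2 * (\<kappa> + 4 * E) + 4 * E + 1"
  have g: "4 * E < g" "0 < g" using \<kappa> E_pos by (auto simp: g_def)
  interpret W: wall_space "carrier G" "hhg_walls g" using wall_space_hhg_walls[OF g(2)] .
  have "helly_wall_space (carrier G) (hhg_walls g)"
  proof
    show "\<exists>m. \<forall>n. W.separated n x y \<longrightarrow> n \<le> m" if "x \<in> carrier G" "y \<in> carrier G" for x y
      using separated_le_word_length[OF g(1) that] by blast
  next
    fix \<F> P assume \<F>: "\<F> \<subseteq> hhg_walls g" "\<F> \<noteq> {}"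
      "\<And>A B A' B'. \<lbrakk>(A, B) \<in> \<F>; (A', B') \<in> \<F>\<rbrakk> \<Longrightarrow> A \<inter> A' \<noteq> {}"
      and P: "finite P" "\<And>A B. (A, B) \<in> \<F> \<Longrightarrow> A \<inter> P \<noteq> {}"
    have "\<exists>z\<in>mspace (word_metric G S). \<forall>U\<in>\<SS>. \<forall>A\<in>fst ` \<F>. \<exists>x\<in>A. \<exists>y\<in>A.
      gromov_product (C U) (proj U x) (proj U y) (proj U z) \<le> \<kappa>"
    proof (rule helly_sets[OF _ _ _ P(1)])
      show "A \<subseteq> mspace (word_metric G S)" if "A \<in> fst ` \<F>" for A
        using that W.wall_subset \<F>(1) unfolding mspace_word by fastforce
      show "A \<inter> B \<noteq> {}" if AB: "A \<in> fst ` \<F>" "B \<in> fst ` \<F>" for A B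
      proof -
        obtain A' B' where "(A, A') \<in> \<F>" "(B, B') \<in> \<F>" using AB by auto
        then show ?thesis by (rule \<F>(3))
      qed
      show "A \<inter> P \<noteq> {}" if A: "A \<in> fst ` \<F>" for A
      proof -
        obtain A' where "(A, A') \<in> \<F>" using A by auto
        then show ?thesis by (rule P(2))
      qed
    qed (use \<F>(2) in simp)
    then obtain z where z: "z \<in> mspace (word_metric G S)" and hull: "\<forall>U\<in>\<SS>. \<forall>A\<in>fst ` \<F>.
        \<exists>x\<in>A. \<exists>y\<in>A. gromov_product (C U) (proj U x) (proj U y) (proj U z) \<le> \<kappa>" by (elim bexE)
    have "z \<notin> B" if AB: "(A, B) \<in> \<F>" for A B
    proof
      assume zB: "z \<in> B"
      have "(A, B) \<in> hhg_walls g" using AB \<F>(1) by blast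
      then obtain U p q s where U: "U \<in> \<SS>" "p \<in> mspace (C U)" "q \<in> mspace (C U)"
        and eq: "A = halfspace U p q s" "B = halfspace U q p (- s - g)"
        by (auto simp: hhg_walls_def)
      have "A \<in> fst ` \<F>" using AB by force
      from hull[rule_format, OF U(1) this] obtain x y where xy: "x \<in> A" "y \<in> A"
        "gromov_product (C U) (proj U x) (proj U y) (proj U z) \<le> \<kappa>" by blast
      have "x \<in> mspace (word_metric G S)" "y \<in> mspace (word_metric G S)"
        using xy by (auto simp: eq halfspace_def mspace_word)
      from mdist_diff_quasiconvex[OF four_point[OF U(1)] this[THEN proj_in[OF U(1)]] proj_in[OF U(1) z] U(2,3) xy(3)]
      have "mdist (C U) (proj U z) p - mdist (C U) (proj U z) q \<le> s + 2 * (\<kappa> + 4 * E)"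
        using xy(1,2) by (auto simp: eq halfspace_def)
      then show False using zB E_pos by (simp add: eq halfspace_def g_def)
    qed
    then show "\<exists>z\<in>carrier G. \<forall>(A, B)\<in>\<F>. z \<notin> B" using z by (auto simp: mspace_word)
  qed
  then show thesis using that g(1) by blast
qed

theorem hhg_semihyperbolic: "semihyperbolic_group G"
proof -
  obtain g where g: "4 * E < g" "helly_wall_space (carrier G) (hhg_walls g)" by (rule hhg_walls_helly)
  interpret W: helly_wall_space "carrier G" "hhg_walls g" using g(2) .
  have g_pos: "0 < g" using g(1) E_pos by simp
  \<comment> \<open>This is used twice: it makes balls of the wall metric finite, and it is the
    coarse comparison with the word metric.\<close>
  have bounded: "\<exists>\<kappa>. \<forall>x\<in>carrier G. \<forall>y\<in>carrier G. W.wall_dist x y \<le> R \<longrightarrow> word_dist G S x y \<le> \<kappa>" for R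
  proof -
    define n where "n = nat \<lceil>\<bar>R\<bar>\<rceil> + 1"
    have n: "R < real n" unfolding n_def by linarith
    obtain \<kappa> where \<kappa>: "\<And>x y. \<lbrakk>x \<in> carrier G; y \<in> carrier G; \<kappa> \<le> word_dist G S x y\<rbrakk> \<Longrightarrow> W.separated n x y"
      using separated_if_far[OF g_pos, of n] by blast
    have "word_dist G S x y \<le> \<kappa>" if xy: "x \<in> carrier G" "y \<in> carrier G" "W.wall_dist x y \<le> R" for x y
    proof (rule ccontr)
      assume "\<not> ?thesis"
      then have "n \<le> W.wall_number x y" using W.le_wall_number[OF xy(1,2)] \<kappa>[OF xy(1,2)] by simp
      then show False using xy(3) n by (simp add: W.wall_dist_def)
    qed
    then show ?thesis by blast
  qed
  have "coarsely_injective_group G W.wall_dist S"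
  proof
    show "finite {y \<in> carrier G. W.wall_dist x y \<le> R}" if x: "x \<in> carrier G" for x R
    proof -
      obtain \<kappa> where "\<And>y. \<lbrakk>y \<in> carrier G; W.wall_dist x y \<le> R\<rbrakk> \<Longrightarrow> word_dist G S x y \<le> \<kappa>"
        using bounded[of R] x by blast
      then have "{y \<in> carrier G. W.wall_dist x y \<le> R} \<subseteq> {y \<in> carrier G. word_dist G S x y \<le> \<kappa>}"
        by auto
      then show ?thesis using finite_word_balls[OF generating x] by (rule finite_subset)
    qed
    show "W.wall_dist (h \<otimes> x) (h \<otimes> y) = W.wall_dist x y"
      if in_G: "h \<in> carrier G" "x \<in> carrier G" "y \<in> carrier G" for h x y
    proof -
      have "W.separated n (h \<otimes> x) (h \<otimes> y) \<longleftrightarrow> W.separated n x y" for n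
        using separated_translate[OF g_pos in_G(1), of n x y]
          separated_translate[OF g_pos inv_closed[OF in_G(1)], of n "h \<otimes> x" "h \<otimes> y"] in_G
        by (auto simp: inv_cancel)
      then show ?thesis by (simp add: W.wall_dist_def W.wall_number_def)
    qed
    show "W.wall_dist x y \<le> word_dist G S x y + 1" if xy: "x \<in> carrier G" "y \<in> carrier G" for x y
      using separated_le_word_length[OF g(1) xy W.separated_wall_number[OF xy]] xy
      by (simp add: W.wall_dist_def word_dist_def)
    show "0 \<le> W.wall_dist x y" for x y by (rule W.wall_dist_nonneg)
    show "W.wall_dist x x \<le> 1" if "x \<in> carrier G" for x using W.wall_dist_self[OF that] by simp
    show "W.wall_dist x y = W.wall_dist y x" if "x \<in> carrier G" "y \<in> carrier G" for x y
      using W.wall_dist_sym[OF that] .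
    show "W.wall_dist x z \<le> W.wall_dist x y + W.wall_dist y z"
      if "x \<in> carrier G" "y \<in> carrier G" "z \<in> carrier G" for x y z
      using W.wall_dist_triangle[OF that] .
    show "\<exists>z\<in>carrier G. \<forall>x\<in>P. W.wall_dist z x \<le> r x + 3"
      if "finite P" "P \<subseteq> carrier G" "P \<noteq> {}"
        "\<And>x y. \<lbrakk>x \<in> P; y \<in> P\<rbrakk> \<Longrightarrow> W.wall_dist x y \<le> r x + r y" for P r
      using W.wall_dist_helly[OF that] .
  qed (use generating bounded in blast)+
  then show ?thesis by (rule coarsely_injective_group.semihyperbolic)
qed

end

lemma hierarchically_hyperbolic_group_imp_semihyperbolic:
  assumes "hierarchically_hyperbolic_group TYPE('i) TYPE('c) G"
  shows "semihyperbolic_group G"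
proof -
  obtain S and \<SS> :: "'i set" and nest orth and C :: "'i \<Rightarrow> 'c metric" and proj rho rhomap E act isom
    where "hhg_structure G S \<SS> nest orth C proj rho rhomap E act isom"
    using assms unfolding hierarchically_hyperbolic_group_def by (elim exE)
  then show ?thesis by (rule hhg_structure.hhg_semihyperbolic)
qed

text \<open>Hierarchical hyperbolicity of mapping class groups enters as a hypothesis, with its own
  types of domains and points. Both halves are instances of the preceding lemma.\<close>

theorem corollaryF:
  shows "(\<forall>G :: 'g monoid.
            hierarchically_hyperbolic_group TYPE('i) TYPE('c) G \<longrightarrow> semihyperbolic_group G) \<and>
         ((\<forall>S :: 'a topology. finite_type_surface S \<longrightarrow>
            hierarchically_hyperbolic_group TYPE('j) TYPE('d) (mapping_class_group S)) \<longrightarrow>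
          (\<forall>S :: 'a topology. finite_type_surface S \<longrightarrow>
            semihyperbolic_group (mapping_class_group S)))"
  by (intro conjI allI impI) (erule hierarchically_hyperbolic_group_imp_semihyperbolic,
      drule spec, drule mp, assumption, erule hierarchically_hyperbolic_group_imp_semihyperbolic)

end
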